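(* Let $0<\alpha<1$ and $T>0$. Assume that the function $f$ on $[0,1]$ is differentiable $4$ times such that $f(0)=f'(0)=f''(0)=f'''(0)=0$, $f(1)=f'(1)=f''(1)=0$, and $f^{(4)}(x)$ is bounded. Then the inverse problem of finding a pair of functions $\{u(x,t),g(x)\}$ such that $$ \begin{array}{ll} {}^cD^{\alpha}_{0|t}u=\dfrac{\partial^2 u}{\partial x^2}+\dfrac{1}{x}\dfrac{\partial u}{\partial x}, & 0<x<1,\ 0<t<T,\\[2mm] \displaystyle\lim_{x\to 0}x\,\dfrac{\partial u}{\partial x}=0,\quad u(1,t)=0, & 0<t<T,\\[2mm] u(x,0)=g(x),\quad u(x,T)=f(x), & 0<x<1, \end{array} $$ has a unique solution given by $$u(x,t)=\sum_{k=1}^{\infty}\frac{f_k}{E_\alpha(-\lambda_k^2T^\alpha)}\,E_\alpha(-\lambda_k^2t^\alpha)\,J_0(\lambda_kx),\qquad g(x)=\sum_{k=1}^{\infty}\frac{f_k}{E_\alpha(-\lambda_k^2T^\alpha)}\,J_0(\lambda_kx),$$ where $$f_k=\frac{2}{J_1^2(\lambda_k)}\int_0^1 x\,f(x)\,J_0(\lambda_kx)\,dx .$$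
   Context: $J_\nu$ denotes the Bessel function of the first kind of order $\nu$, and $0<\lambda_1<\lambda_2<\cdots$ are the positive zeros of $J_0$ in ascending order. $E_\alpha(z)=\sum_{k=0}^\infty \frac{z^k}{\Gamma(\alpha k+1)}$ is the one-parameter Mittag-Leffler function. For $0<\alpha<1$ the Caputo fractional derivative is $${}^cD^\alpha_{0|t}\varphi(t)=\frac{1}{\Gamma(1-\alpha)}\int_0^t\frac{\varphi'(\tau)}{(t-\tau)^\alpha}\,d\tau,$$ and for $u(x,t)$ it is applied in the variable $t$ with $x$ fixed. The function $f$ is given; $u$ and the initial datum $g$ are both unknown. *)

theory Defs
  imports "HOL-Analysis.Analysis"
begin

text \<open>
  Bessel function of the first kind, of integer order \<open>n\<close>. The factor \<open>(x/2)\<close> is raised to a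
  natural power, so that \<open>J\<^sub>0(0) = 1\<close> (whereas \<open>0 powr 0 = 0\<close>).
\<close>

definition besselJ :: "nat \<Rightarrow> real \<Rightarrow> real" where
  "besselJ n x = (\<Sum>k. (-1) ^ k / (fact k * Gamma (real (k + n) + 1)) * (x / 2) ^ (2 * k + n))"

text \<open>
  \<open>bessel_zero k\<close> for \<open>k \<ge> 1\<close> is the \<open>k\<close>-th positive zero of \<open>J\<^sub>0\<close>; the value at \<open>0\<close> only starts
  the recursion and is not a zero.
\<close>

primrec bessel_zero :: "nat \<Rightarrow> real" where
  "bessel_zero 0 = 0"
| "bessel_zero (Suc k) = (LEAST x. bessel_zero k < x \<and> besselJ 0 x = 0)"

definition mittag_leffler :: "real \<Rightarrow> real \<Rightarrow> real" where
  "mittag_leffler \<alpha> z = (\<Sum>k. z ^ k / Gamma (\<alpha> * real k + 1))"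

text \<open>
  The integrand's values at the two endpoints are irrelevant (a null set). Since both \<open>deriv\<close> and
  \<open>integral\<close> are total, \<open>has_caputo\<close> records that \<open>\<phi>'\<close> exists on \<open>(0,t)\<close> and that the integral
  converges absolutely.
\<close>

definition caputo :: "real \<Rightarrow> (real \<Rightarrow> real) \<Rightarrow> real \<Rightarrow> real" where
  "caputo \<alpha> \<phi> t = 1 / Gamma (1 - \<alpha>) * integral {0..t} (\<lambda>\<tau>. deriv \<phi> \<tau> / (t - \<tau>) powr \<alpha>)"

definition has_caputo :: "real \<Rightarrow> (real \<Rightarrow> real) \<Rightarrow> real \<Rightarrow> bool" where
  "has_caputo \<alpha> \<phi> t \<longleftrightarrow>
     (\<forall>\<tau>\<in>{0<..<t}. \<phi> differentiable (at \<tau>)) \<and>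
     (\<lambda>\<tau>. deriv \<phi> \<tau> / (t - \<tau>) powr \<alpha>) absolutely_integrable_on {0..t}"

text \<open>
  Classical solutions: every derivative in the equation exists pointwise, and \<open>u\<close> is continuous on
  the closed rectangle. Without the latter the conditions at \<open>t = 0\<close>, \<open>t = T\<close> and \<open>x = 1\<close> would not
  be tied to the equation, which only concerns the open rectangle.
\<close>

definition inverse_solution ::
  "real \<Rightarrow> real \<Rightarrow> (real \<Rightarrow> real) \<Rightarrow> (real \<Rightarrow> real \<Rightarrow> real) \<Rightarrow> (real \<Rightarrow> real) \<Rightarrow> bool" where
  "inverse_solution \<alpha> T f u g \<longleftrightarrow>
     continuous_on ({0..1} \<times> {0..T}) (\<lambda>(x, t). u x t) \<and>
     (\<forall>x\<in>{0<..<1}. \<forall>t\<in>{0<..<T}.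
        has_caputo \<alpha> (\<lambda>s. u x s) t \<and>
        (\<lambda>y. u y t) differentiable (at x) \<and>
        deriv (\<lambda>y. u y t) differentiable (at x) \<and>
        caputo \<alpha> (\<lambda>s. u x s) t =
          deriv (deriv (\<lambda>y. u y t)) x + 1 / x * deriv (\<lambda>y. u y t) x) \<and>
     (\<forall>t\<in>{0<..<T}. ((\<lambda>x. x * deriv (\<lambda>y. u y t) x) \<longlongrightarrow> 0) (at_right 0) \<and> u 1 t = 0) \<and>
     (\<forall>x\<in>{0<..<1}. u x 0 = g x \<and> u x T = f x)"

definition fb_coeff :: "(real \<Rightarrow> real) \<Rightarrow> nat \<Rightarrow> real" where
  "fb_coeff f k = 2 / (besselJ 1 (bessel_zero k))\<^sup>2 *
     integral {0..1} (\<lambda>x. x * f x * besselJ 0 (bessel_zero k * x))"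

definition u_term :: "real \<Rightarrow> real \<Rightarrow> (real \<Rightarrow> real) \<Rightarrow> real \<Rightarrow> real \<Rightarrow> nat \<Rightarrow> real" where
  "u_term \<alpha> T f x t k =
     fb_coeff f k / mittag_leffler \<alpha> (- (bessel_zero k)\<^sup>2 * T powr \<alpha>) *
     mittag_leffler \<alpha> (- (bessel_zero k)\<^sup>2 * t powr \<alpha>) * besselJ 0 (bessel_zero k * x)"

definition g_term :: "real \<Rightarrow> real \<Rightarrow> (real \<Rightarrow> real) \<Rightarrow> real \<Rightarrow> nat \<Rightarrow> real" where
  "g_term \<alpha> T f x k =
     fb_coeff f k / mittag_leffler \<alpha> (- (bessel_zero k)\<^sup>2 * T powr \<alpha>) *
     besselJ 0 (bessel_zero k * x)"

end

theory Submission
  imports Defs "HOL-Complex_Analysis.Great_Picard"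
begin

text \<open>
  Existence is termwise. A function attaining its maximum over \<open>[0,t]\<close> at \<open>t\<close> has nonnegative Caputo
  derivative there; applied to \<open>y t = E\<^sub>\<alpha>(- l t\<^sup>\<alpha>)\<close> and to \<open>t * y' t\<close>, this gives \<open>0 < y \<le> 1\<close>,
  \<open>- \<alpha> \<le> t * y' t \<le> 0\<close>, and hence two-sided bounds of \<open>y\<close> by multiples of \<open>1 / (1 + l t\<^sup>\<alpha>)\<close>. The
  assumptions on \<open>f\<close> allow four integrations by parts, so that \<open>f\<^sub>k = O(\<lambda>\<^sub>k powr (-7/2))\<close> and the
  coefficients \<open>f\<^sub>k / E\<^sub>\<alpha>(- \<lambda>\<^sub>k\<^sup>2 T\<^sup>\<alpha>)\<close> are absolutely summable.

  For uniqueness, the maximum principle makes solutions depend on their initial data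
  Lipschitz-continuously in the sup norm. Absolutely convergent Fourier-Bessel series are
  dense among the admissible initial data, so the \<open>k\<close>-th coefficient of any solution
  is multiplied by \<open>E\<^sub>\<alpha>(- \<lambda>\<^sub>k\<^sup>2 t\<^sup>\<alpha>) > 0\<close> over time and is determined by its value at \<open>T\<close>. Completeness of
  the system \<open>J\<^sub>0(\<lambda>\<^sub>k x)\<close> follows by power iteration with the Green operator.
\<close>

text \<open>The two bounds on \<open>y\<close> balance each other. By the lower bound, division by
  \<open>E\<^sub>\<alpha>(- \<lambda>\<^sub>k\<^sup>2 T\<^sup>\<alpha>)\<close> costs a factor
  \<open>\<lambda>\<^sub>k\<^sup>2\<close>; the decay of \<open>f\<^sub>k\<close> then leaves the
  exponent -3/2, summable because \<open>\<lambda>\<^sub>k\<close> is at least \<open>k / 2\<close>.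
  For every t > 0 the upper bound returns \<open>\<lambda>\<^sub>k\<^sup>2\<close>, which pays for
  two derivatives in x and for the Caputo derivative. The obstacle in uniqueness is that a classical
  solution is controlled only pointwise inside the rectangle: its derivatives are not known to be
  integrable in x, so the equation cannot be multiplied by
  \<open>J\<^sub>0(\<lambda>\<^sub>k x)\<close> and integrated. The maximum principle looks at a
  single point, and stability carries the evolution law from series solutions over to all others.
  The facts on Bessel functions come from energies and comparison for the differential equation, not
  from asymptotic expansions. Since \<open>bessel_zero\<close> is a \<open>LEAST\<close> over the
  reals, separation and unboundedness of the zeros must be known before its values mean
  anything.\<close>

section \<open>The extremum principle for the Caputo derivative\<close>

text \<open>The unqualified names refer to the Bochner integral.\<close>

lemmas hk_integral_add = Henstock_Kurzweil_Integration.integral_add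
lemmas hk_integral_combine = Henstock_Kurzweil_Integration.integral_combine
lemmas hk_integral_cong = Henstock_Kurzweil_Integration.integral_cong
lemmas hk_integral_diff = Henstock_Kurzweil_Integration.integral_diff
lemmas hk_integral_le = Henstock_Kurzweil_Integration.integral_le
lemmas hk_integral_mult_right = Henstock_Kurzweil_Integration.integral_mult_right
lemmas hk_integral_nonneg = Henstock_Kurzweil_Integration.integral_nonneg
lemmas hk_integral_norm_bound_integral = Henstock_Kurzweil_Integration.integral_norm_bound_integral

text \<open>Dominated convergence for series. Extending the terms by zero off \<open>S\<close> moves
  the claim to Lebesgue measure, and the result is carried back to the gauge integral that occurs in
  \<open>caputo\<close>.\<close>

lemma sums_integral_absolutely_integrable:
  fixes f :: "nat \<Rightarrow> real \<Rightarrow> real"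
  assumes S: "S \<in> sets lebesgue"
    and int: "\<And>k. f k absolutely_integrable_on S"
    and pt: "\<And>x. x \<in> S \<Longrightarrow> summable (\<lambda>k. \<bar>f k x\<bar>)"
    and sm: "summable (\<lambda>k. integral S (\<lambda>x. \<bar>f k x\<bar>))"
  shows "(\<lambda>x. \<Sum>k. f k x) absolutely_integrable_on S"
    and "(\<lambda>k. integral S (f k)) sums integral S (\<lambda>x. \<Sum>k. f k x)"
proof -
  define F where "F = (\<lambda>k x. indicat_real S x *\<^sub>R f k x)"
  have 1: "integrable lebesgue (F k)" for k
    using int[of k] by (simp add: F_def set_integrable_def)
  have 2: "AE x in lebesgue. summable (\<lambda>k. norm (F k x))"
  proof (rule AE_I2)
    fix x show "summable (\<lambda>k. norm (F k x))"
      by (cases "x \<in> S") (simp_all add: F_def pt)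
  qed
  have i: "integral\<^sup>L lebesgue (F k) = integral S (f k)" for k
    using set_lebesgue_integral_eq_integral(2)[OF int[of k]]
    by (simp add: F_def set_lebesgue_integral_def)
  have "(\<lambda>x. \<bar>f k x\<bar>) absolutely_integrable_on S" for k
    using absolutely_integrable_norm[OF int[of k]] by (simp add: o_def)
  then have "(\<integral>x. norm (F k x) \<partial>lebesgue) = integral S (\<lambda>x. \<bar>f k x\<bar>)" for k
    using set_lebesgue_integral_eq_integral(2)[of S "\<lambda>x. \<bar>f k x\<bar>"]
    by (simp add: F_def set_lebesgue_integral_def abs_mult)
  then have 3: "summable (\<lambda>k. \<integral>x. norm (F k x) \<partial>lebesgue)"
    using sm by simp
  have eq: "(\<Sum>k. F k x) = indicat_real S x *\<^sub>R (\<Sum>k. f k x)" for x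
    by (cases "x \<in> S") (simp_all add: F_def)
  have "integrable lebesgue (\<lambda>x. \<Sum>k. F k x)"
    by (rule integrable_suminf[OF 1 2 3])
  then show ai: "(\<lambda>x. \<Sum>k. f k x) absolutely_integrable_on S"
    by (simp add: eq set_integrable_def)
  have "(\<lambda>k. integral\<^sup>L lebesgue (F k)) sums (\<integral>x. (\<Sum>k. F k x) \<partial>lebesgue)"
    by (rule sums_integral[OF 1 2 3])
  then show "(\<lambda>k. integral S (f k)) sums integral S (\<lambda>x. \<Sum>k. f k x)"
    using set_lebesgue_integral_eq_integral(2)[OF ai]
    by (simp add: i eq set_lebesgue_integral_def)
qed

lemma absolutely_integrable_Icc_iff_Ioo:
  fixes f :: "real \<Rightarrow> real"
  shows "f absolutely_integrable_on {a..b} \<longleftrightarrow> f absolutely_integrable_on {a<..<b}"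
  unfolding absolutely_integrable_on_def using integrable_on_open_interval_real by metis

text \<open>The values of \<open>deriv \<phi>\<close> at \<open>0\<close> and \<open>t\<close> are
  unknown; on the open interval any known derivative \<open>d\<close> may replace it, and the
  integral stays the same.\<close>

lemma has_caputoI:
  assumes t: "0 < t"
    and d: "\<And>s. 0 < s \<Longrightarrow> s < t \<Longrightarrow> (\<phi> has_real_derivative d s) (at s)"
    and int: "(\<lambda>s. d s / (t - s) powr \<alpha>) absolutely_integrable_on {0<..<t}"
  shows "has_caputo \<alpha> \<phi> t"
    and "caputo \<alpha> \<phi> t = 1 / Gamma (1 - \<alpha>) * integral {0<..<t} (\<lambda>s. d s / (t - s) powr \<alpha>)"
proof -
  have eq: "deriv \<phi> s = d s" if "s \<in> {0<..<t}" for s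
    using d that by (auto intro: DERIV_imp_deriv)
  have "(\<lambda>s. deriv \<phi> s / (t - s) powr \<alpha>) absolutely_integrable_on {0<..<t}"
    by (rule absolutely_integrable_spike[OF int, of "{}"]) (simp_all add: eq)
  moreover have "\<phi> differentiable (at s)" if "s \<in> {0<..<t}" for s
    using d[of s] that real_differentiable_def by auto
  ultimately show "has_caputo \<alpha> \<phi> t"
    by (simp add: has_caputo_def absolutely_integrable_Icc_iff_Ioo)
  show "caputo \<alpha> \<phi> t = 1 / Gamma (1 - \<alpha>) * integral {0<..<t} (\<lambda>s. d s / (t - s) powr \<alpha>)"
    unfolding caputo_def integral_open_interval_real
    by (metis (mono_tags, lifting) hk_integral_cong eq)
qed

lemma has_caputoD:
  assumes "has_caputo \<alpha> \<phi> t"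
  shows "\<And>s. 0 < s \<Longrightarrow> s < t \<Longrightarrow> (\<phi> has_real_derivative deriv \<phi> s) (at s)"
    and "(\<lambda>s. deriv \<phi> s / (t - s) powr \<alpha>) absolutely_integrable_on {0<..<t}"
    and "(\<lambda>s. deriv \<phi> s / (t - s) powr \<alpha>) absolutely_integrable_on {0..t}"
  using assms
  by (auto simp: has_caputo_def absolutely_integrable_Icc_iff_Ioo DERIV_deriv_iff_real_differentiable)

lemma caputo_eq_Ioo:
  "caputo \<alpha> \<phi> t = 1 / Gamma (1 - \<alpha>) * integral {0<..<t} (\<lambda>s. deriv \<phi> s / (t - s) powr \<alpha>)"
  by (simp add: caputo_def integral_open_interval_real)

section \<open>Linearity of the Caputo derivative\<close>

lemma caputo_diff:
  assumes t: "0 < t" and f: "has_caputo \<alpha> \<phi> t" and g: "has_caputo \<alpha> \<psi> t"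
  shows "has_caputo \<alpha> (\<lambda>s. \<phi> s - \<psi> s) t"
    and "caputo \<alpha> (\<lambda>s. \<phi> s - \<psi> s) t = caputo \<alpha> \<phi> t - caputo \<alpha> \<psi> t"
proof -
  let ?f = "\<lambda>s. deriv \<phi> s / (t - s) powr \<alpha>" and ?g = "\<lambda>s. deriv \<psi> s / (t - s) powr \<alpha>"
  have D: "((\<lambda>s. \<phi> s - \<psi> s) has_real_derivative (deriv \<phi> s - deriv \<psi> s)) (at s)"
    if "0 < s" "s < t" for s
    by (intro DERIV_diff has_caputoD(1)[OF f] has_caputoD(1)[OF g] that)
  have eq: "(\<lambda>s. (deriv \<phi> s - deriv \<psi> s) / (t - s) powr \<alpha>) = (\<lambda>s. ?f s - ?g s)"
    by (simp add: diff_divide_distrib)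
  have I: "(\<lambda>s. (deriv \<phi> s - deriv \<psi> s) / (t - s) powr \<alpha>) absolutely_integrable_on {0<..<t}"
    unfolding eq by (intro set_integral_diff(1) has_caputoD(2)[OF f] has_caputoD(2)[OF g])
  show "has_caputo \<alpha> (\<lambda>s. \<phi> s - \<psi> s) t"
    by (rule has_caputoI(1)[OF t D I])
  have C: "caputo \<alpha> (\<lambda>s. \<phi> s - \<psi> s) t = 1 / Gamma (1 - \<alpha>) * integral {0<..<t} (\<lambda>s. ?f s - ?g s)"
    using has_caputoI(2)[OF t D I] by (simp only: eq)
  have "integral {0<..<t} (\<lambda>s. ?f s - ?g s) = integral {0<..<t} ?f - integral {0<..<t} ?g"
    by (intro hk_integral_diff set_lebesgue_integral_eq_integral(1)
        has_caputoD(2)[OF f] has_caputoD(2)[OF g])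
  then show "caputo \<alpha> (\<lambda>s. \<phi> s - \<psi> s) t = caputo \<alpha> \<phi> t - caputo \<alpha> \<psi> t"
    unfolding C caputo_eq_Ioo[of \<alpha> \<phi>] caputo_eq_Ioo[of \<alpha> \<psi>]
    by (simp only: right_diff_distrib)
qed

lemma caputo_cmult:
  assumes t: "0 < t" and f: "has_caputo \<alpha> \<phi> t"
  shows "has_caputo \<alpha> (\<lambda>s. c * \<phi> s) t"
    and "caputo \<alpha> (\<lambda>s. c * \<phi> s) t = c * caputo \<alpha> \<phi> t"
proof -
  let ?f = "\<lambda>s. deriv \<phi> s / (t - s) powr \<alpha>"
  have D: "((\<lambda>s. c * \<phi> s) has_real_derivative (c * deriv \<phi> s)) (at s)"
    if "0 < s" "s < t" for s
    by (intro DERIV_cmult has_caputoD(1)[OF f] that)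
  have eq: "(\<lambda>s. c * deriv \<phi> s / (t - s) powr \<alpha>) = (\<lambda>s. c * ?f s)"
    by simp
  have I: "(\<lambda>s. c * deriv \<phi> s / (t - s) powr \<alpha>) absolutely_integrable_on {0<..<t}"
    unfolding eq by (intro set_integrable_mult_right has_caputoD(2)[OF f])
  show "has_caputo \<alpha> (\<lambda>s. c * \<phi> s) t"
    by (rule has_caputoI(1)[OF t D I])
  have "caputo \<alpha> (\<lambda>s. c * \<phi> s) t = 1 / Gamma (1 - \<alpha>) * integral {0<..<t} (\<lambda>s. c * ?f s)"
    using has_caputoI(2)[OF t D I] by (simp only: eq)
  then show "caputo \<alpha> (\<lambda>s. c * \<phi> s) t = c * caputo \<alpha> \<phi> t"
    unfolding caputo_eq_Ioo[of \<alpha> \<phi>] hk_integral_mult_right by simp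
qed

text \<open>
  Integrating the Caputo integral by parts produces the kernel \<open>(t - s) powr (-\<alpha> - 1)\<close> against
  \<open>\<phi> t - \<phi> s \<ge> 0\<close>; only the boundary term at \<open>0\<close> survives.
\<close>

lemma caputo_at_max:
  assumes a: "0 < \<alpha>" "\<alpha> < 1" and t: "0 < t" and cap: "has_caputo \<alpha> \<phi> t"
    and cont: "continuous_on {0..t} \<phi>" and diff: "\<phi> differentiable (at t)"
    and max: "\<And>s. 0 \<le> s \<Longrightarrow> s \<le> t \<Longrightarrow> \<phi> s \<le> \<phi> t"
  shows "(\<phi> t - \<phi> 0) * t powr (-\<alpha>) \<le> Gamma (1 - \<alpha>) * caputo \<alpha> \<phi> t"
proof -
  let ?k = "\<lambda>s. deriv \<phi> s / (t - s) powr \<alpha>"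
  define F where "F = (\<lambda>s. (\<phi> t - \<phi> s) * (t - s) powr (-\<alpha>))"
  have k: "?k integrable_on {0..t}"
    using has_caputoD(3)[OF cap] set_lebesgue_integral_eq_integral(1) by blast
  have ineq: "F 0 - F s \<le> integral {0..s} ?k" if s: "0 < s" "s < t" for s
  proof -
    \<comment> \<open>\<open>G\<close> is the derivative of \<open>- F\<close>. The term subtracted
      from the Caputo integrand in it is nonnegative by \<open>max\<close>, which gives the
      inequality.\<close>
    define G where "G = (\<lambda>r. ?k r - \<alpha> * (\<phi> t - \<phi> r) * (t - r) powr (-\<alpha> - 1))"
    have "(G has_integral (- F s - (- F 0))) {0..s}"
    proof (rule fundamental_theorem_of_calculus_interior)
      show "0 \<le> s" using s by simp
      show "continuous_on {0..s} (\<lambda>s. - F s)"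
        unfolding F_def using s
        by (intro continuous_intros continuous_on_subset[OF cont]) auto
      fix r assume r: "r \<in> {0<..<s}"
      then have "((\<lambda>s. - F s) has_real_derivative G r) (at r)"
        unfolding F_def G_def using s
        by (auto intro!: derivative_eq_intros has_caputoD(1)[OF cap]
            simp: powr_minus powr_diff field_simps)
      then show "((\<lambda>s. - F s) has_vector_derivative G r) (at r)"
        by (simp add: has_real_derivative_iff_has_vector_derivative)
    qed
    moreover have "(?k has_integral integral {0..s} ?k) {0..s}"
      using integrable_on_subinterval[OF k, of 0 s] s by (simp add: integrable_integral)
    moreover have "G r \<le> ?k r" if "r \<in> {0..s}" for r
      using max[of r] that s a by (simp add: G_def)
    ultimately have "- F s - (- F 0) \<le> integral {0..s} ?k"
      by (rule has_integral_le)
    then show ?thesis by simp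
  qed
  \<comment> \<open>Differentiability at \<open>t\<close> absorbs the singularity: \<open>F\<close>
    is a difference quotient times a positive power of \<open>t - s\<close>.\<close>
  have "((\<lambda>s. (\<phi> t - \<phi> s) / (t - s) * (t - s) powr (1 - \<alpha>)) \<longlongrightarrow> deriv \<phi> t * 0) (at_left t)"
  proof (rule tendsto_mult)
    have "((\<lambda>s. (\<phi> s - \<phi> t) / (s - t)) \<longlongrightarrow> deriv \<phi> t) (at t)"
      using diff by (simp add: DERIV_deriv_iff_real_differentiable[symmetric] has_field_derivative_iff)
    moreover have "(\<lambda>s. (\<phi> s - \<phi> t) / (s - t)) = (\<lambda>s. (\<phi> t - \<phi> s) / (t - s))"
      by (rule ext) (metis minus_diff_eq minus_divide_divide)
    ultimately show "((\<lambda>s. (\<phi> t - \<phi> s) / (t - s)) \<longlongrightarrow> deriv \<phi> t) (at_left t)"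
      by (metis tendsto_within_subset subset_UNIV)
    have "continuous_on {..t} (\<lambda>s. (t - s) powr (1 - \<alpha>))"
      using a by (intro continuous_on_powr' continuous_intros) auto
    then have "((\<lambda>s. (t - s) powr (1 - \<alpha>)) \<longlongrightarrow> (t - t) powr (1 - \<alpha>)) (at t within {..t})"
      unfolding continuous_on_def by blast
    then show "((\<lambda>s. (t - s) powr (1 - \<alpha>)) \<longlongrightarrow> 0) (at_left t)"
      using a by (auto intro: tendsto_within_subset)
  qed
  moreover have "\<forall>\<^sub>F s in at_left t. (\<phi> t - \<phi> s) / (t - s) * (t - s) powr (1 - \<alpha>) = F s"
    using eventually_at_left_real[OF t]
    by eventually_elim (simp add: F_def powr_diff powr_minus field_simps)
  ultimately have F0: "(F \<longlongrightarrow> 0) (at_left t)"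
    by (simp add: tendsto_cong)
  have "continuous_on {0..t} (\<lambda>s. integral {0..s} ?k)"
    by (rule indefinite_integral_continuous_1[OF k])
  then have "((\<lambda>s. integral {0..s} ?k) \<longlongrightarrow> integral {0..t} ?k) (at t within {0..t})"
    using t unfolding continuous_on_def by auto
  then have I: "((\<lambda>s. integral {0..s} ?k) \<longlongrightarrow> integral {0..t} ?k) (at_left t)"
    using t by (simp add: at_within_Icc_at_left)
  have ev: "\<forall>\<^sub>F s in at_left t. F 0 - F s \<le> integral {0..s} ?k"
    using eventually_at_left_real[OF t] by eventually_elim (auto intro: ineq)
  have "F 0 - 0 \<le> integral {0..t} ?k"
    by (rule tendsto_le[OF _ I tendsto_diff[OF tendsto_const F0] ev]) simp
  moreover have "Gamma (1 - \<alpha>) > 0"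
    using a by (simp add: Gamma_real_pos)
  ultimately show ?thesis
    using t by (simp add: F_def caputo_def)
qed

lemma caputo_pos_at_max:
  assumes a: "0 < \<alpha>" "\<alpha> < 1" and t: "0 < t" and cap: "has_caputo \<alpha> \<phi> t"
    and cont: "continuous_on {0..t} \<phi>" and diff: "\<phi> differentiable (at t)"
    and max: "\<And>s. 0 \<le> s \<Longrightarrow> s \<le> t \<Longrightarrow> \<phi> s \<le> \<phi> t" and gt: "\<phi> 0 < \<phi> t"
  shows "0 < caputo \<alpha> \<phi> t"
proof -
  have "0 < (\<phi> t - \<phi> 0) * t powr (-\<alpha>)"
    using gt t by simp
  also have "\<dots> \<le> Gamma (1 - \<alpha>) * caputo \<alpha> \<phi> t"
    by (rule caputo_at_max[OF a t cap cont diff max])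
  finally have P: "0 < Gamma (1 - \<alpha>) * caputo \<alpha> \<phi> t" .
  show ?thesis
    by (rule zero_less_mult_pos[OF P]) (use a in \<open>simp add: Gamma_real_pos\<close>)
qed

text \<open>The second derivative is known at \<open>x\<close> alone, so the mean value theorem
  takes the place of Taylor's formula: a positive \<open>c\<close> makes \<open>\<psi>'\<close>
  positive just to the right of \<open>x\<close>, and \<open>\<psi>\<close> would rise above its
  maximum.\<close>

lemma deriv_at_interior_max:
  fixes \<psi> :: "real \<Rightarrow> real"
  assumes ab: "a < x" "x < b"
    and D: "\<And>y. a < y \<Longrightarrow> y < b \<Longrightarrow> (\<psi> has_real_derivative \<psi>' y) (at y)"
    and D2: "(\<psi>' has_real_derivative c) (at x)"
    and max: "\<And>y. a < y \<Longrightarrow> y < b \<Longrightarrow> \<psi> y \<le> \<psi> x"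
  shows "\<psi>' x = 0" "c \<le> 0"
proof -
  show z: "\<psi>' x = 0"
  proof (rule DERIV_local_max[OF D[OF ab]])
    show "0 < min (x - a) (b - x)" using ab by simp
    show "\<forall>y. \<bar>x - y\<bar> < min (x - a) (b - x) \<longrightarrow> \<psi> y \<le> \<psi> x"
      using max by (auto simp: abs_if split: if_splits)
  qed
  show "c \<le> 0"
  proof (rule ccontr)
    assume "\<not> c \<le> 0"
    then obtain d where d: "d > 0" "\<And>h. h > 0 \<Longrightarrow> h < d \<Longrightarrow> \<psi>' x < \<psi>' (x + h)"
      using DERIV_pos_inc_right[OF D2] by auto
    define y where "y = x + min d (b - x) / 2"
    have y: "x < y" "y < b" "y < x + d"
      using d ab by (auto simp: y_def min_def field_simps)
    obtain z where "x < z" "z < y" "\<psi> y - \<psi> x = (y - x) * \<psi>' z"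
      using MVT2[OF y(1), of \<psi> \<psi>'] D ab y by force
    moreover have "\<psi>' z > 0"
      using d(2)[of "z - x"] \<open>x < z\<close> \<open>z < y\<close> y \<open>\<psi>' x = 0\<close> by simp
    ultimately have "\<psi> y > \<psi> x"
      using y by (smt (verit, best) mult_pos_pos)
    then show False using max[of y] y ab by simp
  qed
qed

section \<open>Mittag-Leffler relaxation\<close>

lemma Gamma_plus1_pos: "0 < x \<Longrightarrow> Gamma (x + 1) = x * Gamma (x :: real)"
  by (rule Gamma_plus1) (auto elim!: nonpos_Ints_cases)

text \<open>Log-convexity of Gamma at \<open>x\<close>, the mean of \<open>x + a - 1\<close> and
  \<open>x + a\<close> with weights \<open>a\<close> and \<open>1 - a\<close>, combined with the
  functional equation. It makes the ratio of consecutive Mittag-Leffler terms tend to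
  \<open>0\<close>.\<close>

lemma Gamma_le_Gamma_shift:
  fixes x a :: real
  assumes a: "0 < a" "a < 1" and x: "1 \<le> x"
  shows "Gamma x \<le> Gamma (x + a) * (x + a - 1) powr (-a)"
proof -
  define b where "b = x + a"
  have b: "b - 1 > 0" using a x by (simp add: b_def)
  have "(ln \<circ> Gamma) ((1 - (1 - a)) *\<^sub>R (b - 1) + (1 - a) *\<^sub>R b)
      \<le> (1 - (1 - a)) * (ln \<circ> Gamma) (b - 1) + (1 - a) * (ln \<circ> Gamma) b"
    by (rule convex_onD[OF log_convex_Gamma_real]) (use a b in auto)
  moreover have "(1 - (1 - a)) *\<^sub>R (b - 1) + (1 - a) *\<^sub>R b = x"
    by (simp add: b_def algebra_simps)
  ultimately have c: "ln (Gamma x) \<le> a * ln (Gamma (b - 1)) + (1 - a) * ln (Gamma b)"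
    by simp
  have Gb: "Gamma b = (b - 1) * Gamma (b - 1)"
    using Gamma_plus1_pos[of "b - 1"] b by simp
  have G: "Gamma (b - 1) > 0" "Gamma b > 0" "Gamma x > 0"
    using b x by (auto intro!: Gamma_real_pos)
  have "ln (Gamma b) = ln (b - 1) + ln (Gamma (b - 1))"
    unfolding Gb by (rule ln_mult_pos[OF b G(1)])
  with c have "ln (Gamma x) \<le> ln (Gamma b) + (- a) * ln (b - 1)"
    by (simp add: algebra_simps)
  then have "exp (ln (Gamma x)) \<le> exp (ln (Gamma b) + (- a) * ln (b - 1))"
    by simp
  then show ?thesis
    using G b by (simp add: exp_diff exp_minus powr_def b_def divide_inverse)
qed

lemma summable_mittag_leffler:
  assumes a: "0 < \<alpha>" "\<alpha> < 1"
  shows "summable (\<lambda>k. z ^ k / Gamma (\<alpha> * real k + 1) :: real)"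
proof -
  have "((\<lambda>k. \<bar>z\<bar> * (\<alpha> * real k + \<alpha>) powr (-\<alpha>)) \<longlongrightarrow> \<bar>z\<bar> * 0) sequentially"
  proof (intro tendsto_mult tendsto_const tendsto_neg_powr)
    show "filterlim (\<lambda>k. \<alpha> * real k + \<alpha>) at_top sequentially"
      using a by (subst add.commute, intro filterlim_tendsto_add_at_top[OF tendsto_const]
          filterlim_tendsto_pos_mult_at_top[OF tendsto_const] filterlim_real_sequentially)
  qed (use a in auto)
  then have "\<forall>\<^sub>F k in sequentially. \<bar>z\<bar> * (\<alpha> * real k + \<alpha>) powr (-\<alpha>) < 1 / 2"
    by (rule order_tendstoD(2)) simp
  then obtain N where N: "\<And>k. k \<ge> N \<Longrightarrow> \<bar>z\<bar> * (\<alpha> * real k + \<alpha>) powr (-\<alpha>) < 1 / 2"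
    by (auto simp: eventually_sequentially)
  show ?thesis
  proof (rule summable_ratio_test[of "1/2" N])
    fix k assume k: "k \<ge> N"
    define x where "x = \<alpha> * real k + 1"
    have x: "x \<ge> 1" using a by (simp add: x_def)
    have G: "Gamma x > 0" "Gamma (x + \<alpha>) > 0"
      using x a by (auto intro!: Gamma_real_pos)
    have "Gamma x * \<bar>z\<bar> \<le> Gamma (x + \<alpha>) * (x + \<alpha> - 1) powr (-\<alpha>) * \<bar>z\<bar>"
      by (intro mult_right_mono Gamma_le_Gamma_shift a x) simp
    also have "\<dots> \<le> Gamma (x + \<alpha>) * (1 / 2)"
      unfolding mult.assoc
      by (rule mult_left_mono) (use N[OF k] G in \<open>simp_all add: x_def mult_ac\<close>)
    finally have "\<bar>z\<bar> / Gamma (x + \<alpha>) \<le> 1 / 2 / Gamma x"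
      using G by (simp add: field_simps)
    then have "\<bar>z\<bar> ^ k * (\<bar>z\<bar> / Gamma (x + \<alpha>)) \<le> \<bar>z\<bar> ^ k * (1 / 2 / Gamma x)"
      by (rule mult_left_mono) simp
    moreover have "\<alpha> * real (Suc k) + 1 = x + \<alpha>"
      by (simp add: x_def algebra_simps)
    ultimately show "norm (z ^ Suc k / Gamma (\<alpha> * real (Suc k) + 1))
        \<le> 1 / 2 * norm (z ^ k / Gamma (\<alpha> * real k + 1))"
      using G by (simp add: x_def[symmetric] power_abs abs_mult mult_ac)
  qed simp
qed

text \<open>In the basis \<open>t powr (\<alpha> * k) / Gamma (\<alpha> * k + 1)\<close> the Caputo
  derivative is the left shift of the coefficients \<open>b\<close>. Both \<open>y\<close> and
  \<open>t * y' t\<close> have this form.\<close>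

definition ml_series :: "real \<Rightarrow> (nat \<Rightarrow> real) \<Rightarrow> real \<Rightarrow> real" where
  "ml_series \<alpha> b t = (\<Sum>k. b k / Gamma (\<alpha> * real k + 1) * (t powr \<alpha>) ^ k)"

definition ml_deriv :: "real \<Rightarrow> (nat \<Rightarrow> real) \<Rightarrow> real \<Rightarrow> real" where
  "ml_deriv \<alpha> b t = (\<Sum>k. b (Suc k) * t powr (\<alpha> * real (Suc k) - 1) / Gamma (\<alpha> * real (Suc k)))"

section \<open>Power series in \<open>t powr \<alpha>\<close> with geometrically bounded
  coefficients\<close>

context
  fixes \<alpha> M R :: real and b :: "nat \<Rightarrow> real"
  assumes a: "0 < \<alpha>" "\<alpha> < 1" and b: "\<And>k. \<bar>b k\<bar> \<le> M * R ^ k"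
begin

lemma ml_Gamma_pos: "0 < Gamma (\<alpha> * real k + 1)"
  using a by (intro Gamma_real_pos) (simp add: add_nonneg_pos)

lemma ml_abs_summable: "summable (\<lambda>k. \<bar>b k\<bar> / Gamma (\<alpha> * real k + 1) * z ^ k)"
proof (rule summable_comparison_test[OF _ summable_mult[OF summable_mittag_leffler[OF a, of "R * \<bar>z\<bar>"], of M]],
    intro exI allI impI)
  fix k
  have "norm (\<bar>b k\<bar> / Gamma (\<alpha> * real k + 1) * z ^ k) = \<bar>b k\<bar> * (\<bar>z\<bar> ^ k / Gamma (\<alpha> * real k + 1))"
    using ml_Gamma_pos[of k] by (simp add: abs_mult power_abs)
  also have "\<dots> \<le> M * R ^ k * (\<bar>z\<bar> ^ k / Gamma (\<alpha> * real k + 1))"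
    by (rule mult_right_mono[OF b]) (use ml_Gamma_pos[of k] in simp)
  finally show "norm (\<bar>b k\<bar> / Gamma (\<alpha> * real k + 1) * z ^ k)
      \<le> M * ((R * \<bar>z\<bar>) ^ k / Gamma (\<alpha> * real k + 1))"
    by (simp add: power_mult_distrib)
qed

lemma ml_summable: "summable (\<lambda>k. b k / Gamma (\<alpha> * real k + 1) * z ^ k)"
proof (rule summable_comparison_test[OF _ ml_abs_summable[of "\<bar>z\<bar>"]], intro exI allI impI)
  fix k
  show "norm (b k / Gamma (\<alpha> * real k + 1) * z ^ k) \<le> \<bar>b k\<bar> / Gamma (\<alpha> * real k + 1) * \<bar>z\<bar> ^ k"
    using ml_Gamma_pos[of k] by (simp add: abs_mult power_abs)
qed

lemma ml_series_continuous: "continuous_on {0..} (ml_series \<alpha> b)"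
proof -
  let ?S = "\<lambda>z. \<Sum>k. b k / Gamma (\<alpha> * real k + 1) * z ^ k"
  have "continuous_on UNIV ?S"
    by (intro continuous_at_imp_continuous_on ballI isCont_powser_converges_everywhere ml_summable)
  moreover have "continuous_on {0..} (\<lambda>t. t powr \<alpha>)"
    using a by (intro continuous_on_powr' continuous_on_id continuous_on_const) auto
  ultimately have "continuous_on {0..} (\<lambda>t. ?S (t powr \<alpha>))"
    by (rule continuous_on_compose2) simp
  then show ?thesis
    by (simp add: ml_series_def[abs_def])
qed

text \<open>Links the chain rule to \<open>ml_deriv\<close> through \<open>Gamma (\<alpha> * n + 1)
  = \<alpha> * n * Gamma (\<alpha> * n)\<close>. The sequence \<open>c\<close> is arbitrary because
  both \<open>b\<close> and its absolute values are inserted.\<close>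

lemma ml_deriv_term:
  assumes t: "0 < t"
  shows "diffs (\<lambda>k. c k / Gamma (\<alpha> * real k + 1)) k * (t powr \<alpha>) ^ k * (\<alpha> * t powr (\<alpha> - 1))
    = c (Suc k) * t powr (\<alpha> * real (Suc k) - 1) / Gamma (\<alpha> * real (Suc k))"
proof -
  define n where "n = real (Suc k)"
  have n: "n > 0" by (simp add: n_def)
  have 1: "Gamma (\<alpha> * n + 1) = \<alpha> * n * Gamma (\<alpha> * n)"
    using a n by (intro Gamma_plus1_pos) simp
  have 2: "(t powr \<alpha>) ^ k * t powr (\<alpha> - 1) = t powr (\<alpha> * n - 1)"
    using t by (simp add: n_def powr_power powr_add[symmetric] algebra_simps)
  have "0 < Gamma (\<alpha> * n)"
    using a n by (intro Gamma_real_pos) simp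
  then have "n * (c (Suc k) / (\<alpha> * n * Gamma (\<alpha> * n))) * (t powr \<alpha>) ^ k * (\<alpha> * t powr (\<alpha> - 1))
      = c (Suc k) * ((t powr \<alpha>) ^ k * t powr (\<alpha> - 1)) / Gamma (\<alpha> * n)"
    using a n by simp
  then show ?thesis
    unfolding diffs_def n_def[symmetric] 1 2 by simp
qed

lemma ml_deriv_abs_summable:
  assumes t: "0 < t"
  shows "summable (\<lambda>k. \<bar>b (Suc k)\<bar> * t powr (\<alpha> * real (Suc k) - 1) / Gamma (\<alpha> * real (Suc k)))"
proof -
  have "summable (\<lambda>k. diffs (\<lambda>k. \<bar>b k\<bar> / Gamma (\<alpha> * real k + 1)) k * (t powr \<alpha>) ^ k)"
    by (rule termdiff_converges_all) (rule ml_abs_summable)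
  then have "summable (\<lambda>k. diffs (\<lambda>k. \<bar>b k\<bar> / Gamma (\<alpha> * real k + 1)) k * (t powr \<alpha>) ^ k
      * (\<alpha> * t powr (\<alpha> - 1)))"
    by (rule summable_mult2)
  then show ?thesis
    by (simp only: ml_deriv_term[OF t])
qed

lemma ml_series_deriv:
  assumes t: "0 < t"
  shows "(ml_series \<alpha> b has_real_derivative ml_deriv \<alpha> b t) (at t)"
proof -
  let ?c = "\<lambda>k. b k / Gamma (\<alpha> * real k + 1)"
  let ?S = "\<lambda>z. \<Sum>k. ?c k * z ^ k"
  have "(?S has_real_derivative (\<Sum>k. diffs ?c k * (t powr \<alpha>) ^ k)) (at (t powr \<alpha>))"
    by (rule termdiffs_strong_converges_everywhere) (rule ml_summable)
  moreover have "((\<lambda>t. t powr \<alpha>) has_real_derivative (\<alpha> * t powr (\<alpha> - 1))) (at t)"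
    using t by (rule has_real_derivative_powr)
  ultimately have "((\<lambda>t. ?S (t powr \<alpha>)) has_real_derivative
      ((\<Sum>k. diffs ?c k * (t powr \<alpha>) ^ k) * (\<alpha> * t powr (\<alpha> - 1)))) (at t)"
    by (rule DERIV_chain2)
  moreover have "summable (\<lambda>k. diffs ?c k * (t powr \<alpha>) ^ k)"
    by (rule termdiff_converges_all) (rule ml_summable)
  then have "(\<Sum>k. diffs ?c k * (t powr \<alpha>) ^ k) * (\<alpha> * t powr (\<alpha> - 1))
      = (\<Sum>k. diffs ?c k * (t powr \<alpha>) ^ k * (\<alpha> * t powr (\<alpha> - 1)))"
    by (rule suminf_mult2)
  ultimately show ?thesis
    by (simp only: ml_deriv_term[OF t] ml_series_def[abs_def] ml_deriv_def)
qed

end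

lemma has_integral_Beta_scaled:
  fixes p q t :: real
  assumes p: "0 < p" and q: "0 < q" and t: "0 < t"
  shows "((\<lambda>s. s powr (p - 1) * (t - s) powr (q - 1)) has_integral (t powr (p + q - 1) * Beta p q)) {0<..<t}"
proof -
  have "((\<lambda>s. (1/t * s) powr (p - 1) * (1 - 1/t * s) powr (q - 1)) has_integral (t * Beta p q)) {0..t}"
    using has_integral_stretch_real[OF has_integral_Beta_real[OF p q], of "1/t"] t
      image_mult_atLeastAtMost[of t 0 1]
    by (simp add: mult.commute)
  then have "((\<lambda>s. (1/t * s) powr (p - 1) * (1 - 1/t * s) powr (q - 1)) has_integral (t * Beta p q)) {0<..<t}"
    by (simp add: has_integral_Icc_iff_Ioo)
  then have "((\<lambda>s. t powr (p + q - 2) * ((1/t * s) powr (p - 1) * (1 - 1/t * s) powr (q - 1)))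
      has_integral (t powr (p + q - 2) * (t * Beta p q))) {0<..<t}"
    by (rule has_integral_mult_right)
  moreover have "t powr (p + q - 2) * ((1/t * s) powr (p - 1) * (1 - 1/t * s) powr (q - 1))
      = s powr (p - 1) * (t - s) powr (q - 1)" if "s \<in> {0<..<t}" for s
  proof -
    have "1 - 1/t * s = (t - s) / t" using t by (simp add: field_simps)
    moreover have "t powr (p + q - 2) = t powr (p - 1) * t powr (q - 1)"
      by (simp add: powr_add[symmetric])
    ultimately show ?thesis
      using that t by (simp add: powr_divide)
  qed
  moreover have "t powr (p + q - 2) * (t * Beta p q) = t powr (p + q - 1) * Beta p q"
    using t powr_add[of t "p + q - 2" 1] by simp
  ultimately show ?thesis
    using has_integral_eq by (metis (no_types, lifting))
qed

text \<open>A Beta integral sends each power in the derivative to the preceding basis function, so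
  the coefficients shift and the constant term drops out. Sum and integral commute because every
  term keeps its sign: the same Beta integral yields its L1 norm.\<close>

lemma ml_series_caputo:
  fixes \<alpha> M R :: real and b :: "nat \<Rightarrow> real"
  assumes a: "0 < \<alpha>" "\<alpha> < 1" and b: "\<And>k. \<bar>b k\<bar> \<le> M * R ^ k" and t: "0 < t"
  shows "has_caputo \<alpha> (ml_series \<alpha> b) t"
    and "caputo \<alpha> (ml_series \<alpha> b) t = ml_series \<alpha> (\<lambda>k. b (Suc k)) t"
proof -
  define f where "f = (\<lambda>k s. b (Suc k) * s powr (\<alpha> * real (Suc k) - 1) / Gamma (\<alpha> * real (Suc k)) / (t - s) powr \<alpha>)"
  have G: "Gamma (\<alpha> * real (Suc k)) > 0" for k
    using a by (intro Gamma_real_pos) simp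
  have B: "((\<lambda>s. s powr (\<alpha> * real (Suc k) - 1) * (t - s) powr (-\<alpha>)) has_integral
      (t powr \<alpha>) ^ k * (Gamma (\<alpha> * real (Suc k)) * Gamma (1 - \<alpha>) / Gamma (\<alpha> * real k + 1))) {0<..<t}" for k
    using has_integral_Beta_scaled[of "\<alpha> * real (Suc k)" "1 - \<alpha>" t] a t
    by (simp add: Beta_def powr_power algebra_simps add_pos_nonneg)
  have f: "(f k has_integral (b (Suc k) * ((t powr \<alpha>) ^ k * (Gamma (1 - \<alpha>) / Gamma (\<alpha> * real k + 1))))) {0<..<t}" for k
    using has_integral_mult_right[OF B[of k], of "b (Suc k) / Gamma (\<alpha> * real (Suc k))"] G[of k]
    by (simp add: f_def powr_minus divide_simps)
  have af: "((\<lambda>s. \<bar>f k s\<bar>) has_integral (\<bar>b (Suc k)\<bar> * ((t powr \<alpha>) ^ k * (Gamma (1 - \<alpha>) / Gamma (\<alpha> * real k + 1))))) {0<..<t}" for k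
    using has_integral_mult_right[OF B[of k], of "\<bar>b (Suc k)\<bar> / Gamma (\<alpha> * real (Suc k))"] G[of k]
    by (simp add: f_def powr_minus divide_simps abs_mult)
  have 1: "f k absolutely_integrable_on {0<..<t}" for k
    using f[of k] af[of k] by (auto simp: absolutely_integrable_on_def)
  have 2: "summable (\<lambda>k. \<bar>f k s\<bar>)" if "s \<in> {0<..<t}" for s
  proof -
    have "summable (\<lambda>k. \<bar>b (Suc k)\<bar> * s powr (\<alpha> * real (Suc k) - 1) / Gamma (\<alpha> * real (Suc k)) / (t - s) powr \<alpha>)"
      by (intro summable_divide ml_deriv_abs_summable[OF a b]) (use that in auto)
    then show ?thesis
      using G by (simp add: f_def abs_mult less_imp_le)
  qed
  have b': "\<bar>b (Suc k)\<bar> \<le> (M * R) * R ^ k" for k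
    using b[of "Suc k"] by (simp add: mult_ac)
  have "summable (\<lambda>k. \<bar>b (Suc k)\<bar> / Gamma (\<alpha> * real k + 1) * (t powr \<alpha>) ^ k * Gamma (1 - \<alpha>))"
    by (intro summable_mult2 ml_abs_summable[OF a b'])
  then have 3: "summable (\<lambda>k. integral {0<..<t} (\<lambda>s. \<bar>f k s\<bar>))"
    unfolding integral_unique[OF af] by (simp add: mult_ac)
  have D: "(ml_series \<alpha> b has_real_derivative ml_deriv \<alpha> b s) (at s)"
    if "0 < s" "s < t" for s
    by (rule ml_series_deriv[OF a b that(1)])
  have eq: "ml_deriv \<alpha> b s / (t - s) powr \<alpha>
      = (\<Sum>k. f k s)" if "s \<in> {0<..<t}" for s
  proof -
    have "summable (\<lambda>k. \<bar>b (Suc k) * s powr (\<alpha> * real (Suc k) - 1) / Gamma (\<alpha> * real (Suc k))\<bar>)"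
      using ml_deriv_abs_summable[OF a b, of s] that G by (simp add: abs_mult less_imp_le)
    then show ?thesis
      unfolding f_def ml_deriv_def by (rule suminf_divide[symmetric, OF summable_rabs_cancel])
  qed
  have S: "{0<..<t} \<in> sets lebesgue" by simp
  have I: "(\<lambda>s. ml_deriv \<alpha> b s / (t - s) powr \<alpha>)
      absolutely_integrable_on {0<..<t}"
  proof (rule absolutely_integrable_spike[OF sums_integral_absolutely_integrable(1)[OF S 1 2 3] negligible_empty])
    fix s assume "s \<in> {0<..<t} - {}"
    then show "ml_deriv \<alpha> b s / (t - s) powr \<alpha>
        = (\<Sum>k. f k s)"
      by (intro eq) simp
  qed
  show "has_caputo \<alpha> (ml_series \<alpha> b) t"
    by (rule has_caputoI(1)[OF t D I])
  note has_caputoI(2)[OF t D I]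
  also note hk_integral_cong[OF eq]
  also have "integral {0<..<t} (\<lambda>s. \<Sum>k. f k s)
      = (\<Sum>k. b (Suc k) * ((t powr \<alpha>) ^ k * (Gamma (1 - \<alpha>) / Gamma (\<alpha> * real k + 1))))"
    using sums_integral_absolutely_integrable(2)[OF S 1 2 3] unfolding integral_unique[OF f]
    by (rule sums_unique)
  also have "1 / Gamma (1 - \<alpha>) * \<dots>
      = (\<Sum>k. 1 / Gamma (1 - \<alpha>) * (b (Suc k) * ((t powr \<alpha>) ^ k * (Gamma (1 - \<alpha>) / Gamma (\<alpha> * real k + 1)))))"
  proof (rule suminf_mult[symmetric])
    show "summable (\<lambda>k. b (Suc k) * ((t powr \<alpha>) ^ k * (Gamma (1 - \<alpha>) / Gamma (\<alpha> * real k + 1))))"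
      using summable_mult2[OF ml_summable[OF a b'], of "t powr \<alpha>" "Gamma (1 - \<alpha>)"] by (simp add: mult_ac)
  qed
  also have "\<dots> = ml_series \<alpha> (\<lambda>k. b (Suc k)) t"
  proof -
    have "Gamma (1 - \<alpha>) \<noteq> 0" using a Gamma_real_pos[of "1 - \<alpha>"] by linarith
    then show ?thesis by (simp add: ml_series_def mult_ac)
  qed
  finally show "caputo \<alpha> (ml_series \<alpha> b) t = ml_series \<alpha> (\<lambda>k. b (Suc k)) t" .
qed

text \<open>At a maximum over \<open>{0..t}\<close> that exceeds \<open>m\<close>, hence also the
  initial value, the Caputo derivative is strictly positive, against \<open>le\<close>.\<close>

lemma caputo_le_principle:
  assumes a: "0 < \<alpha>" "\<alpha> < 1" and cont: "continuous_on {0..} \<phi>"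
    and cap: "\<And>t. 0 < t \<Longrightarrow> has_caputo \<alpha> \<phi> t" and m: "\<phi> 0 \<le> m"
    and le: "\<And>t. 0 < t \<Longrightarrow> m < \<phi> t \<Longrightarrow> caputo \<alpha> \<phi> t \<le> 0" and t: "0 \<le> t"
  shows "\<phi> t \<le> m"
proof (rule ccontr)
  assume neg: "\<not> \<phi> t \<le> m"
  have c: "continuous_on {0..s} \<phi>" for s
    by (rule continuous_on_subset[OF cont]) auto
  obtain s where s: "s \<in> {0..t}" "\<And>r. r \<in> {0..t} \<Longrightarrow> \<phi> r \<le> \<phi> s"
    using continuous_attains_sup[OF _ _ c[of t]] t by auto
  have gt: "\<phi> s > m" using s(2)[of t] t neg by simp
  then have s0: "s > 0" using m s(1) by (cases "s = 0") auto
  have "0 < caputo \<alpha> \<phi> s"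
  proof (rule caputo_pos_at_max[OF a s0 cap[OF s0] c])
    \<comment> \<open>\<open>has_caputo\<close> at \<open>s\<close> speaks of times before
      \<open>s\<close>; a later time gives differentiability at \<open>s\<close> itself.\<close>
    have "has_caputo \<alpha> \<phi> (s + 1)" using cap s0 by simp
    then show "\<phi> differentiable at s" using s0 by (simp add: has_caputo_def)
    show "\<phi> r \<le> \<phi> s" if "0 \<le> r" "r \<le> s" for r
      using s that by simp
    show "\<phi> 0 < \<phi> s" using gt m by simp
  qed
  then show False using le[OF s0 gt] by simp
qed

definition ml_relax :: "real \<Rightarrow> real \<Rightarrow> real \<Rightarrow> real" where
  "ml_relax \<alpha> l t = mittag_leffler \<alpha> (- l * t powr \<alpha>)"

lemma ml_relax_eq_series: "ml_relax \<alpha> l = ml_series \<alpha> (\<lambda>k. (- l) ^ k)"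
  unfolding fun_eq_iff ml_relax_def mittag_leffler_def ml_series_def power_mult_distrib by simp

section \<open>Sign, monotonicity and two-sided bounds of the relaxation function\<close>

context
  fixes \<alpha> l :: real
  assumes a: "0 < \<alpha>" "\<alpha> < 1" and l: "0 < l"
begin

private abbreviation "y \<equiv> ml_relax \<alpha> l"

text \<open>\<open>t * y' t\<close> solves a relaxation equation with source \<open>- \<alpha> * l * y\<close>, which yields the monotonicity of \<open>y\<close>.\<close>

private definition p where "p = ml_series \<alpha> (\<lambda>k. \<alpha> * real k * (- l) ^ k)"

private lemma bound_y: "\<bar>(- l) ^ k\<bar> \<le> 1 * l ^ k"
  using l by (simp add: power_abs)

private lemma bound_p: "\<bar>\<alpha> * real k * (- l) ^ k\<bar> \<le> \<alpha> * (2 * l) ^ k"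
proof -
  have "real k \<le> 2 ^ k"
    by (metis less_exp less_imp_le of_nat_le_iff of_nat_numeral of_nat_power)
  then show ?thesis
    using a l by (simp add: abs_mult power_abs power_mult_distrib mult_right_mono)
qed

lemma ml_relax_0: "y 0 = 1"
  unfolding ml_relax_eq_series ml_series_def powr_0 powser_zero by simp

private lemma p_0: "p 0 = 0"
  unfolding p_def ml_series_def powr_0 powser_zero by simp

lemma ml_relax_continuous: "continuous_on {0..} y"
  unfolding ml_relax_eq_series by (rule ml_series_continuous[OF a bound_y])

private lemma p_cont: "continuous_on {0..} p"
  unfolding p_def by (rule ml_series_continuous[OF a bound_p])

lemma ml_relax_caputo:
  assumes t: "0 < t"
  shows "has_caputo \<alpha> y t" "caputo \<alpha> y t = - l * y t"
proof -
  show "has_caputo \<alpha> y t"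
    unfolding ml_relax_eq_series by (rule ml_series_caputo(1)[OF a bound_y t])
  have "caputo \<alpha> y t = (\<Sum>k. - l * ((- l) ^ k / Gamma (\<alpha> * real k + 1) * (t powr \<alpha>) ^ k))"
    unfolding ml_relax_eq_series ml_series_caputo(2)[OF a bound_y t] ml_series_def
    by (intro arg_cong[where f = suminf] ext) simp
  also have "\<dots> = - l * y t"
    unfolding ml_relax_eq_series ml_series_def by (rule suminf_mult[OF ml_summable[OF a bound_y]])
  finally show "caputo \<alpha> y t = - l * y t" .
qed

text \<open>The shifted coefficient is \<open>\<alpha> * (k + 1) * (- l) ^ (k + 1)\<close>; in the
  factor \<open>k + 1\<close>, the \<open>k\<close> reproduces \<open>p\<close> and the
  \<open>1\<close> produces the source.\<close>

private lemma p_caputo: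
  assumes t: "0 < t"
  shows "has_caputo \<alpha> p t" "caputo \<alpha> p t = - l * (p t + \<alpha> * y t)"
proof -
  show "has_caputo \<alpha> p t"
    unfolding p_def by (rule ml_series_caputo(1)[OF a bound_p t])
  let ?f = "\<lambda>b k. b k / Gamma (\<alpha> * real k + 1) * (t powr \<alpha>) ^ k"
  let ?b = "\<lambda>k. \<alpha> * real k * (- l) ^ k"
  have sb: "summable (?f ?b)" and sy: "summable (?f (\<lambda>k. (- l) ^ k))"
    by (rule ml_summable[OF a bound_p], rule ml_summable[OF a bound_y])
  have "caputo \<alpha> p t = (\<Sum>k. - l * (?f ?b k + \<alpha> * ?f (\<lambda>k. (- l) ^ k) k))"
    unfolding p_def ml_series_caputo(2)[OF a bound_p t] ml_series_def
    by (intro arg_cong[where f = suminf] ext) (simp add: algebra_simps add_divide_distrib diff_divide_distrib)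
  also have "\<dots> = - l * (p t + \<alpha> * y t)"
    using suminf_mult[OF summable_add[OF sb summable_mult[OF sy, of \<alpha>]], of "- l"]
      suminf_add[OF sb summable_mult[OF sy, of \<alpha>]] suminf_mult[OF sy, of \<alpha>]
    by (simp only: p_def ml_relax_eq_series ml_series_def)
  finally show "caputo \<alpha> p t = - l * (p t + \<alpha> * y t)" .
qed

private lemma y_deriv_p:
  assumes t: "0 < t"
  shows "(y has_real_derivative p t / t) (at t)"
proof -
  let ?g = "\<lambda>k. (- l) ^ Suc k * t powr (\<alpha> * real (Suc k) - 1) / Gamma (\<alpha> * real (Suc k))"
  let ?f = "\<lambda>k. \<alpha> * real k * (- l) ^ k / Gamma (\<alpha> * real k + 1) * (t powr \<alpha>) ^ k"
  have G: "Gamma (\<alpha> * real (Suc k) + 1) = \<alpha> * real (Suc k) * Gamma (\<alpha> * real (Suc k))"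
    and G0: "Gamma (\<alpha> * real (Suc k)) > 0" for k
    using a by (auto intro!: Gamma_plus1_pos Gamma_real_pos simp del: of_nat_Suc)
  have z: "(t powr \<alpha>) ^ Suc k = t powr (\<alpha> * real (Suc k) - 1) * t" for k
    using t powr_add[of t "\<alpha> * real (Suc k) - 1" 1] by (simp add: powr_power mult.commute del: of_nat_Suc power_Suc)
  have eq: "?f (Suc k) / t = ?g k" for k
    unfolding G z using t a G0[of k] by (simp del: of_nat_Suc power_Suc)
  have s: "summable ?f" by (rule ml_summable[OF a bound_p])
  then have "summable (\<lambda>k. ?f (Suc k))" by (subst summable_Suc_iff)
  then have "(\<Sum>k. ?f (Suc k)) / t = (\<Sum>k. ?f (Suc k) / t)"
    by (rule suminf_divide[symmetric])
  moreover have "p t = (\<Sum>k. ?f (Suc k))"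
    unfolding p_def ml_series_def using suminf_split_head[OF s] by simp
  ultimately have "p t / t = (\<Sum>k. ?g k)"
    by (simp only: eq)
  then show ?thesis
    unfolding ml_relax_eq_series using ml_series_deriv[OF a bound_y t] by (simp add: ml_deriv_def)
qed

private lemma caputo_neg:
  assumes "0 < t" "has_caputo \<alpha> f t"
  shows "has_caputo \<alpha> (\<lambda>s. - f s) t" "caputo \<alpha> (\<lambda>s. - f s) t = - caputo \<alpha> f t"
  using caputo_cmult[OF assms, of "-1"] by (simp_all only: mult_minus1)

text \<open>Where \<open>- y\<close> is positive, its Caputo derivative \<open>l * y\<close> is
  negative.\<close>

private lemma y_nonneg: "0 \<le> t \<Longrightarrow> 0 \<le> y t"
  using caputo_le_principle[where \<phi> = "\<lambda>s. - y s" and m = 0 and t = t, OF a] l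
  by (simp add: caputo_neg ml_relax_caputo ml_relax_0 continuous_on_minus ml_relax_continuous
      mult_pos_neg less_imp_le)

text \<open>At a zero of \<open>y\<close> the function \<open>- y\<close> would attain a maximum
  above its initial value \<open>- 1\<close>, so its Caputo derivative would be strictly positive;
  but it equals \<open>l * y t = 0\<close>.\<close>

lemma ml_relax_pos:
  assumes t: "0 \<le> t"
  shows "0 < y t"
proof (rule ccontr)
  assume "\<not> 0 < y t"
  then have y0: "y t = 0" using y_nonneg[OF t] by simp
  then have t0: "t > 0" using t ml_relax_0 by (cases "t = 0") auto
  have "0 < caputo \<alpha> (\<lambda>s. - y s) t"
  proof (rule caputo_pos_at_max[OF a t0])
    show "has_caputo \<alpha> (\<lambda>s. - y s) t"
      by (intro caputo_neg ml_relax_caputo t0)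
    show "continuous_on {0..t} (\<lambda>s. - y s)"
      by (intro continuous_on_minus continuous_on_subset[OF ml_relax_continuous]) auto
    show "(\<lambda>s. - y s) differentiable at t"
      using DERIV_minus[OF y_deriv_p[OF t0]] real_differentiable_def by blast
    show "- y s \<le> - y t" if "0 \<le> s" for s
      using y_nonneg[OF that] y0 by simp
    show "- y 0 < - y t"
      by (simp add: y0 ml_relax_0)
  qed
  then show False
    by (simp add: caputo_neg ml_relax_caputo t0 y0)
qed

lemma ml_relax_le_1: "0 \<le> t \<Longrightarrow> y t \<le> 1"
  using caputo_le_principle[where \<phi> = y and m = 1 and t = t, OF a ml_relax_continuous] l
  by (simp add: ml_relax_caputo ml_relax_0 ml_relax_pos less_imp_le)

private lemma p_le_0: "0 \<le> t \<Longrightarrow> p t \<le> 0"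
  using caputo_le_principle[where \<phi> = p and m = 0 and t = t, OF a p_cont] l a
  by (simp add: p_caputo p_0 ml_relax_pos less_imp_le)

private lemma p_ge: "0 \<le> t \<Longrightarrow> - \<alpha> \<le> p t"
proof -
  assume t: "0 \<le> t"
  have "- p t \<le> \<alpha>"
  proof (rule caputo_le_principle[where \<phi> = "\<lambda>s. - p s", OF a])
    fix s :: real assume s: "0 < s" "\<alpha> < - p s"
    \<comment> \<open>Since \<open>y \<le> 1\<close>, the source is at most \<open>\<alpha>\<close>:
      once \<open>- p\<close> exceeds this value, the sum \<open>p + \<alpha> * y\<close> has the
      sign that the principle asks for.\<close>
    have "\<alpha> * y s \<le> \<alpha> * 1" using a ml_relax_le_1[of s] s by (intro mult_left_mono) auto
    then have "p s + \<alpha> * y s \<le> 0" using s by simp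
    then show "caputo \<alpha> (\<lambda>s. - p s) s \<le> 0"
      using l s by (simp add: caputo_neg p_caputo mult_nonneg_nonpos)
  qed (use a t in \<open>auto simp: caputo_neg p_caputo p_0 intro!: continuous_on_minus p_cont\<close>)
  then show ?thesis by simp
qed

lemma ml_relax_deriv:
  assumes t: "0 < t"
  shows "(y has_real_derivative deriv y t) (at t)" "deriv y t \<le> 0" "- \<alpha> / t \<le> deriv y t"
proof -
  have d: "deriv y t = p t / t" by (rule DERIV_imp_deriv[OF y_deriv_p[OF t]])
  show "(y has_real_derivative deriv y t) (at t)" unfolding d by (rule y_deriv_p[OF t])
  show "deriv y t \<le> 0" "- \<alpha> / t \<le> deriv y t"
    unfolding d using t p_le_0[of t] p_ge[of t]
    by (simp_all only: divide_right_mono divide_nonpos_pos less_imp_le)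
qed

lemma ml_relax_antimono:
  assumes "0 \<le> s" "s \<le> t" shows "y t \<le> y s"
proof (cases "s = t")
  case False
  show ?thesis
  proof (rule DERIV_nonpos_imp_decreasing_open[where f = y and a = s and b = t])
    show "s \<le> t" by fact
    show "\<exists>d. (y has_real_derivative d) (at x) \<and> d \<le> 0" if "s < x" "x < t" for x
      using ml_relax_deriv[of x] that assms by auto
    show "continuous_on {s..t} y"
      by (rule continuous_on_subset[OF ml_relax_continuous]) (use assms in auto)
  qed
qed simp

text \<open>\<open>- y\<close> increases, so its maximum over \<open>{0..t}\<close> is at
  \<open>t\<close>; the extremum estimate there reads \<open>(1 - y t) * t powr (-\<alpha>) \<le>
  Gamma (1 - \<alpha>) * l * y t\<close>. It bounds \<open>1 / y t\<close> by a function linear in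
  \<open>l\<close>.\<close>

lemma ml_relax_lower:
  assumes t: "0 < t"
  shows "1 \<le> y t * (1 + Gamma (1 - \<alpha>) * l * t powr \<alpha>)"
proof -
  have "(- y t - - y 0) * t powr (- \<alpha>) \<le> Gamma (1 - \<alpha>) * caputo \<alpha> (\<lambda>s. - y s) t"
  proof (rule caputo_at_max[OF a t])
    show "has_caputo \<alpha> (\<lambda>s. - y s) t"
      by (intro caputo_neg ml_relax_caputo t)
    show "continuous_on {0..t} (\<lambda>s. - y s)"
      by (intro continuous_on_minus continuous_on_subset[OF ml_relax_continuous]) auto
    show "(\<lambda>s. - y s) differentiable at t"
      using DERIV_minus[OF ml_relax_deriv(1)[OF t]] real_differentiable_def by blast
  qed (simp add: ml_relax_antimono)
  then show ?thesis
    using t by (simp add: caputo_neg ml_relax_caputo ml_relax_0 powr_minus field_simps)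
qed

text \<open>In the Caputo integral of \<open>y\<close>, up to \<open>t / 2\<close> the kernel is at
  most \<open>(t / 2) powr (-\<alpha>)\<close> and \<open>- y'\<close> has total integral at most
  \<open>1\<close>; beyond \<open>t / 2\<close>,
  \<open>- y' \<le> \<alpha> / s \<le> 2 * \<alpha> / t\<close> and the kernel has a Beta integral.
  The bound is free of \<open>l\<close>, which expresses smoothing at positive times.\<close>

lemma ml_relax_upper:
  assumes t: "0 < t"
  shows "Gamma (1 - \<alpha>) * (l * y t) \<le> (2 powr \<alpha> + 2 * \<alpha> * Beta 1 (1 - \<alpha>)) * t powr (-\<alpha>)"
proof -
  let ?k = "\<lambda>s. - (deriv y s / (t - s) powr \<alpha>)"
  have G: "Gamma (1 - \<alpha>) > 0" using a by (simp add: Gamma_real_pos)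
  have "Gamma (1 - \<alpha>) * (l * y t) = integral {0<..<t} ?k"
    using ml_relax_caputo(2)[OF t] G unfolding caputo_eq_Ioo by (simp add: field_simps)
  moreover have "?k integrable_on {0<..<t}"
    by (intro integrable_neg set_lebesgue_integral_eq_integral(1) has_caputoD(2) ml_relax_caputo t)
  ultimately have k: "(?k has_integral (Gamma (1 - \<alpha>) * (l * y t))) {0<..<t}"
    by (metis integrable_integral)
  have "((\<lambda>s. - deriv y s) has_integral (- y t - - y 0)) {0..t}"
  proof (rule fundamental_theorem_of_calculus_interior)
    show "continuous_on {0..t} (\<lambda>s. - y s)"
      by (intro continuous_on_minus continuous_on_subset[OF ml_relax_continuous]) auto
    show "((\<lambda>s. - y s) has_vector_derivative - deriv y x) (at x)" if "x \<in> {0<..<t}" for x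
      using DERIV_minus[OF ml_relax_deriv(1), of x] that
      by (simp add: has_real_derivative_iff_has_vector_derivative)
  qed (use t in simp)
  then have 1: "((\<lambda>s. - deriv y s * (t / 2) powr (-\<alpha>)) has_integral ((- y t - - y 0) * (t / 2) powr (-\<alpha>))) {0<..<t}"
    unfolding has_integral_Icc_iff_Ioo by (rule has_integral_mult_left)
  have "((\<lambda>s. s powr (1 - 1) * (t - s) powr (1 - \<alpha> - 1)) has_integral
      (t powr (1 + (1 - \<alpha>) - 1) * Beta 1 (1 - \<alpha>))) {0<..<t}"
    using a t by (intro has_integral_Beta_scaled) auto
  then have "((\<lambda>s. 2 * \<alpha> / t * (s powr (1 - 1) * (t - s) powr (1 - \<alpha> - 1))) has_integral
      2 * \<alpha> / t * (t powr (1 + (1 - \<alpha>) - 1) * Beta 1 (1 - \<alpha>))) {0<..<t}"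
    by (rule has_integral_mult_right)
  \<comment> \<open>Both majorants are added over the whole interval, so the integral itself is
    never cut at \<open>t / 2\<close>; the case distinction is pointwise.\<close>
  note 2 = has_integral_add[OF 1 this]
  have "Gamma (1 - \<alpha>) * (l * y t) \<le> (- y t - - y 0) * (t / 2) powr (-\<alpha>)
      + 2 * \<alpha> / t * (t powr (1 + (1 - \<alpha>) - 1) * Beta 1 (1 - \<alpha>))"
  proof (rule has_integral_le[OF k 2])
    fix s assume s: "s \<in> {0<..<t}"
    define d where "d = - deriv y s"
    have d: "0 \<le> d" "d \<le> \<alpha> / s"
      using ml_relax_deriv[of s] s by (simp_all add: d_def)
    have "d * (t - s) powr (-\<alpha>) \<le> d * (t / 2) powr (-\<alpha>) + 2 * \<alpha> / t * (t - s) powr (-\<alpha>)"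
    proof (cases "s \<le> t / 2")
      case True
      have "d * (t - s) powr (-\<alpha>) \<le> d * (t / 2) powr (-\<alpha>)"
        using True t a by (intro mult_left_mono d powr_mono2') auto
      moreover have "0 \<le> 2 * \<alpha> / t * (t - s) powr (-\<alpha>)" using a t by simp
      ultimately show ?thesis by linarith
    next
      case False
      have "\<alpha> / s \<le> \<alpha> / (t / 2)"
        using False t a by (intro divide_left_mono) auto
      with d have "d \<le> 2 * \<alpha> / t" by (simp add: mult.commute)
      then have "d * (t - s) powr (-\<alpha>) \<le> 2 * \<alpha> / t * (t - s) powr (-\<alpha>)"
        by (rule mult_right_mono) simp
      moreover have "0 \<le> d * (t / 2) powr (-\<alpha>)" using d by simp
      ultimately show ?thesis by linarith
    qed
    moreover have "?k s = d * (t - s) powr (-\<alpha>)"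
      by (simp add: d_def powr_minus divide_inverse)
    moreover have "s powr (1 - 1) * (t - s) powr (1 - \<alpha> - 1) = (t - s) powr (-\<alpha>)"
      using s by simp
    ultimately show "?k s \<le> - deriv y s * (t / 2) powr (-\<alpha>) + 2 * \<alpha> / t * (s powr (1 - 1) * (t - s) powr (1 - \<alpha> - 1))"
      by (simp only: d_def)
  qed
  also have "(- y t - - y 0) * (t / 2) powr (-\<alpha>) \<le> 1 * (t / 2) powr (-\<alpha>)"
    using ml_relax_pos[of t] t by (intro mult_right_mono) (simp_all add: ml_relax_0)
  also have "(t / 2) powr (-\<alpha>) = 2 powr \<alpha> * t powr (-\<alpha>)"
    using t by (simp add: powr_divide powr_minus_divide)
  also have "t powr (1 + (1 - \<alpha>) - 1) = t * t powr (-\<alpha>)"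
    using t powr_add[of t 1 "-\<alpha>"] by simp
  also have "1 * (2 powr \<alpha> * t powr (-\<alpha>)) + 2 * \<alpha> / t * (t * t powr (-\<alpha>) * Beta 1 (1 - \<alpha>))
      = (2 powr \<alpha> + 2 * \<alpha> * Beta 1 (1 - \<alpha>)) * t powr (-\<alpha>)"
    using t by (simp add: distrib_right)
  finally show ?thesis by simp
qed

end

section \<open>The zeros of the Bessel function\<close>

text \<open>Abbreviating \<open>besselJ 1\<close> keeps the simplifier from rewriting its index to \<open>Suc 0\<close>.\<close>

definition besselJ1 :: "real \<Rightarrow> real" where
  "besselJ1 = besselJ 1"

text \<open>Coefficients of \<open>J\<^sub>0\<close> in the variable \<open>x\<^sup>2 / 4\<close>,
  where it is an entire power series that can be differentiated termwise.\<close>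

definition bessel_coeff :: "nat \<Rightarrow> real" where
  "bessel_coeff k = (-1) ^ k / (fact k)\<^sup>2"

lemma Gamma_fact_real: "Gamma (real n + 1) = fact n"
  using Gamma_fact[of n, where 'a = real] by (simp add: add.commute)

lemma summable_bessel_coeff: "summable (\<lambda>k. bessel_coeff k * z ^ k)"
proof (rule summable_comparison_test[OF _ summable_exp[of "\<bar>z\<bar>"]], intro exI allI impI)
  fix k
  have "(1::real) \<le> fact k" by (rule fact_ge_1)
  then have "1 / (fact k)\<^sup>2 \<le> (1 / fact k :: real)"
    by (simp add: power2_eq_square divide_simps)
  then have "1 / (fact k)\<^sup>2 * \<bar>z\<bar> ^ k \<le> 1 / fact k * \<bar>z\<bar> ^ k"
    by (rule mult_right_mono) simp
  then show "norm (bessel_coeff k * z ^ k) \<le> inverse (fact k) * \<bar>z\<bar> ^ k"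
    by (simp add: bessel_coeff_def abs_mult power_abs divide_inverse)
qed

lemma bessel_coeff_Suc: "real (Suc k) * bessel_coeff (Suc k) = - ((-1) ^ k / (fact k * fact (Suc k)))"
proof -
  have "fact (Suc k) = real (Suc k) * fact k" by simp
  then show ?thesis
    unfolding bessel_coeff_def power2_eq_square by (simp add: divide_simps del: of_nat_Suc)
qed

text \<open>This recurrence is Bessel's equation at the level of coefficients.\<close>

lemma bessel_coeff_Suc': "real (Suc k) * (real (Suc k) * bessel_coeff (Suc k)) = - bessel_coeff k"
proof -
  have "fact (Suc k) = real (Suc k) * fact k" by simp
  then show ?thesis
    unfolding bessel_coeff_def power2_eq_square by (simp add: divide_simps del: of_nat_Suc)
qed

lemma besselJ_0_eq: "besselJ 0 x = (\<Sum>k. bessel_coeff k * (x\<^sup>2 / 4) ^ k)"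
proof -
  have "(x / 2) ^ (2 * k + 0) = (x\<^sup>2 / 4) ^ k" for k
    by (simp add: power_mult power_divide)
  then show ?thesis
    by (simp add: besselJ_def bessel_coeff_def Gamma_fact_real power2_eq_square)
qed

lemma besselJ_1_term:
  "(-1) ^ k / (fact k * Gamma (real (k + 1) + 1)) * (x / 2) ^ (2 * k + 1)
    = - (x / 2) * (diffs bessel_coeff k * (x\<^sup>2 / 4) ^ k)"
proof -
  have 1: "(x / 2) ^ (2 * k + 1) = (x / 2) * (x\<^sup>2 / 4) ^ k"
    by (simp add: power_mult power_divide)
  have 2: "Gamma (real (k + 1) + 1) = fact (Suc k)"
    using Gamma_fact_real[of "Suc k"] by simp
  show ?thesis
    unfolding 1 2 diffs_def bessel_coeff_Suc by (simp add: mult_ac)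
qed

lemma besselJ_1_eq: "besselJ1 x = - (x / 2) * (\<Sum>k. diffs bessel_coeff k * (x\<^sup>2 / 4) ^ k)"
  unfolding besselJ1_def besselJ_def besselJ_1_term
  by (intro suminf_mult termdiff_converges_all summable_bessel_coeff)

lemma has_derivative_besselJ_0: "(besselJ 0 has_real_derivative - besselJ1 x) (at x)"
proof -
  have "((\<lambda>z. \<Sum>k. bessel_coeff k * z ^ k) has_real_derivative
      (\<Sum>k. diffs bessel_coeff k * (x\<^sup>2 / 4) ^ k)) (at (x\<^sup>2 / 4))"
    by (rule termdiffs_strong_converges_everywhere[OF summable_bessel_coeff])
  moreover have "((\<lambda>x. x\<^sup>2 / 4) has_real_derivative x / 2) (at x)"
    by (auto intro!: derivative_eq_intros)
  ultimately have "((\<lambda>x. \<Sum>k. bessel_coeff k * (x\<^sup>2 / 4) ^ k) has_real_derivative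
      (\<Sum>k. diffs bessel_coeff k * (x\<^sup>2 / 4) ^ k) * (x / 2)) (at x)"
    by (rule DERIV_chain2)
  moreover have "(\<Sum>k. diffs bessel_coeff k * (x\<^sup>2 / 4) ^ k) * (x / 2) = - besselJ1 x"
    by (simp add: besselJ_1_eq)
  ultimately show ?thesis
    by (simp only: besselJ_0_eq[abs_def])
qed

text \<open>With \<open>S\<close> the power series of \<open>J\<^sub>0\<close> and
  \<open>z = x\<^sup>2 / 4\<close>, the function is \<open>- 2 * z * S' z\<close>, and
  \<open>(z * S')' = - S\<close> by the coefficient recurrence. This form stays regular at
  \<open>0\<close>, unlike the derivative of \<open>J\<^sub>1\<close> written with
  \<open>J\<^sub>1 x / x\<close>.\<close>

lemma has_derivative_x_besselJ_1: "((\<lambda>x. x * besselJ1 x) has_real_derivative x * besselJ 0 x) (at x)"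
proof -
  let ?c = "\<lambda>k. real k * bessel_coeff k"
  have s: "summable (\<lambda>k. ?c (Suc k) * z ^ k)" for z
    using termdiff_converges_all[OF summable_bessel_coeff, of z] by (simp add: diffs_def)
  have s': "summable (\<lambda>k. ?c k * z ^ k)" for z
    using summable_mult2[OF s, of z z] by (subst summable_Suc_iff[symmetric]) (simp add: mult_ac)
  have eq: "x * besselJ1 x = - 2 * (\<Sum>k. ?c k * (x\<^sup>2 / 4) ^ k)" for x
  proof -
    have "(\<Sum>k. ?c k * (x\<^sup>2 / 4) ^ k) = (\<Sum>k. ?c (Suc k) * (x\<^sup>2 / 4) ^ Suc k)"
      using suminf_split_head[OF s'] by (simp only: of_nat_0 mult_zero_left diff_zero)
    also have "\<dots> = (\<Sum>k. ?c (Suc k) * (x\<^sup>2 / 4) ^ k * (x\<^sup>2 / 4))"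
      by (simp add: mult_ac)
    also have "\<dots> = (\<Sum>k. ?c (Suc k) * (x\<^sup>2 / 4) ^ k) * (x\<^sup>2 / 4)"
      by (rule suminf_mult2[symmetric, OF s])
    finally show ?thesis
      by (simp add: besselJ_1_eq diffs_def power2_eq_square mult_ac)
  qed
  have d: "diffs ?c k = - bessel_coeff k" for k
    unfolding diffs_def bessel_coeff_Suc' ..
  have J: "(\<Sum>k. - bessel_coeff k * (x\<^sup>2 / 4) ^ k) = - besselJ 0 x"
    by (simp add: besselJ_0_eq suminf_minus[OF summable_bessel_coeff])
  have "((\<lambda>z. \<Sum>k. ?c k * z ^ k) has_real_derivative - besselJ 0 x) (at (x\<^sup>2 / 4))"
    using termdiffs_strong_converges_everywhere[OF s', of "x\<^sup>2 / 4"] by (simp only: d J)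
  moreover have "((\<lambda>x. x\<^sup>2 / 4) has_real_derivative x / 2) (at x)"
    by (auto intro!: derivative_eq_intros)
  ultimately have "((\<lambda>x. \<Sum>k. ?c k * (x\<^sup>2 / 4) ^ k) has_real_derivative (- besselJ 0 x) * (x / 2)) (at x)"
    by (rule DERIV_chain2)
  then have "((\<lambda>x. - 2 * (\<Sum>k. ?c k * (x\<^sup>2 / 4) ^ k)) has_real_derivative - 2 * ((- besselJ 0 x) * (x / 2))) (at x)"
    by (rule DERIV_cmult)
  moreover have "- 2 * ((- besselJ 0 x) * (x / 2)) = x * besselJ 0 x"
    by simp
  ultimately show ?thesis
    by (simp only: eq)
qed

text \<open>The quotient rule for \<open>x * p x / x\<close>: differentiability of \<open>p\<close>
  comes out as a result, so derivatives in divergence form can be converted.\<close>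

lemma DERIV_factor_ident:
  fixes p :: "real \<Rightarrow> real"
  assumes d: "((\<lambda>x. x * p x) has_real_derivative D) (at x)" and x: "x \<noteq> 0"
  shows "(p has_real_derivative (D - p x) / x) (at x)"
proof -
  have "((\<lambda>x. x * p x / x) has_real_derivative (D * x - (x * p x) * 1) / (x * x)) (at x)"
    by (intro DERIV_divide d DERIV_ident x)
  moreover have "(D * x - (x * p x) * 1) / (x * x) = (D - p x) / x"
    using x by (simp add: field_simps)
  ultimately have "((\<lambda>x. x * p x / x) has_real_derivative (D - p x) / x) (at x)"
    by simp
  then show ?thesis
  proof (rule DERIV_cong_ev[THEN iffD1, OF refl _ refl, rotated])
    show "\<forall>\<^sub>F y in nhds x. y * p y / y = p y"
      using t1_space_nhds[OF x] by eventually_elim simp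
  qed
qed

lemma has_derivative_besselJ_1:
  assumes "x \<noteq> 0"
  shows "(besselJ1 has_real_derivative besselJ 0 x - besselJ1 x / x) (at x)"
  using DERIV_factor_ident[OF has_derivative_x_besselJ_1 assms] assms by (simp add: diff_divide_distrib)

lemma besselJ_0_0 [simp]: "besselJ 0 0 = 1"
  unfolding besselJ_0_eq using powser_zero[of bessel_coeff] by (simp add: bessel_coeff_def)

lemma besselJ_1_0 [simp]: "besselJ1 0 = 0"
  by (simp add: besselJ_1_eq)

lemma continuous_besselJ_0: "continuous_on A (besselJ 0)"
  by (intro continuous_at_imp_continuous_on ballI DERIV_isCont[OF has_derivative_besselJ_0])

lemma continuous_besselJ_1: "continuous_on A (besselJ1)"
proof -
  have "continuous_on UNIV (\<lambda>z. \<Sum>k. diffs bessel_coeff k * z ^ k)"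
    by (intro continuous_at_imp_continuous_on ballI isCont_powser_converges_everywhere
        termdiff_converges_all summable_bessel_coeff)
  then have "continuous_on UNIV (\<lambda>x. \<Sum>k. diffs bessel_coeff k * (x\<^sup>2 / 4) ^ k)"
    by (rule continuous_on_compose2) (auto intro!: continuous_intros)
  then have "continuous_on UNIV (\<lambda>x. - (x / 2) * (\<Sum>k. diffs bessel_coeff k * (x\<^sup>2 / 4) ^ k))"
    by (intro continuous_on_mult continuous_intros) auto
  then show ?thesis
    unfolding besselJ_1_eq[abs_def] by (rule continuous_on_subset) simp
qed

lemmas continuous_on_besselJ_0 [continuous_intros] = continuous_on_compose2[OF continuous_besselJ_0[of UNIV] _ subset_UNIV]
lemmas continuous_on_besselJ_1 [continuous_intros] = continuous_on_compose2[OF continuous_besselJ_1[of UNIV] _ subset_UNIV]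

lemmas DERIV_besselJ_0 [derivative_intros] = DERIV_chain2[OF has_derivative_besselJ_0]
lemmas DERIV_besselJ_1 [derivative_intros] = DERIV_chain2[OF has_derivative_besselJ_1]

text \<open>The mixed terms cancel in the derivative, leaving
  \<open>- 2 * J\<^sub>1\<^sup>2 / x\<close>. Started at \<open>0\<close>, the energy bounds both
  functions by \<open>1\<close>; started at a zero of \<open>J\<^sub>0\<close>, it bounds them by
  the value of \<open>|J\<^sub>1|\<close> there.\<close>

lemma bessel_energy_antimono:
  assumes "0 \<le> a" "a \<le> b"
  shows "(besselJ 0 b)\<^sup>2 + (besselJ1 b)\<^sup>2 \<le> (besselJ 0 a)\<^sup>2 + (besselJ1 a)\<^sup>2"
proof (rule DERIV_nonpos_imp_decreasing_open[where f = "\<lambda>x. (besselJ 0 x)\<^sup>2 + (besselJ1 x)\<^sup>2" and a = a and b = b])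
  show "continuous_on {a..b} (\<lambda>x. (besselJ 0 x)\<^sup>2 + (besselJ1 x)\<^sup>2)"
    by (intro continuous_intros)
  fix x assume x: "a < x" "x < b"
  have "((\<lambda>x. (besselJ 0 x)\<^sup>2 + (besselJ1 x)\<^sup>2) has_real_derivative - 2 * (besselJ1 x)\<^sup>2 / x) (at x)"
    using x assms
    by (auto intro!: derivative_eq_intros simp: power2_eq_square field_simps)
  then show "\<exists>y. ((\<lambda>x. (besselJ 0 x)\<^sup>2 + (besselJ1 x)\<^sup>2) has_real_derivative y) (at x) \<and> y \<le> 0"
    using x assms by (intro exI conjI) auto
qed fact

lemma bessel_energy_le_1: "0 \<le> x \<Longrightarrow> (besselJ 0 x)\<^sup>2 + (besselJ1 x)\<^sup>2 \<le> 1"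
  using bessel_energy_antimono[of 0 x] by simp

lemma abs_besselJ_0_le: "0 \<le> x \<Longrightarrow> \<bar>besselJ 0 x\<bar> \<le> 1"
  using bessel_energy_le_1[of x] zero_le_power2[of "besselJ 0 x"] zero_le_power2[of "besselJ1 x"]
  unfolding abs_square_le_1[symmetric] by linarith

lemma abs_besselJ_1_le: "0 \<le> x \<Longrightarrow> \<bar>besselJ1 x\<bar> \<le> 1"
  using bessel_energy_le_1[of x] zero_le_power2[of "besselJ 0 x"] zero_le_power2[of "besselJ1 x"]
  unfolding abs_square_le_1[symmetric] by linarith

text \<open>\<open>(x * J\<^sub>1)' = x * J\<^sub>0\<close> with \<open>|J\<^sub>0| \<le> 1\<close>
  is compared with the derivative of \<open>x\<^sup>2 / 2\<close>.\<close>

lemma abs_besselJ_1_le_half: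
  assumes x: "0 \<le> x"
  shows "\<bar>besselJ1 x\<bar> \<le> x / 2"
proof (cases "x = 0")
  case False
  have "x * besselJ1 x - x\<^sup>2 / 2 \<le> 0 * besselJ1 0 - 0\<^sup>2 / 2"
  proof (rule DERIV_nonpos_imp_decreasing_open[where f = "\<lambda>x. x * besselJ1 x - x\<^sup>2 / 2"])
    show "continuous_on {0..x} (\<lambda>x. x * besselJ1 x - x\<^sup>2 / 2)"
      by (intro continuous_intros) auto
    fix y assume y: "0 < y" "y < x"
    have "((\<lambda>x. x * besselJ1 x - x\<^sup>2 / 2) has_real_derivative (y * besselJ 0 y - y)) (at y)"
      by (intro DERIV_diff has_derivative_x_besselJ_1) (auto intro!: derivative_eq_intros)
    moreover have "y * besselJ 0 y - y \<le> 0"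
      using abs_besselJ_0_le[of y] y by (simp add: mult_left_le)
    ultimately show "\<exists>d. ((\<lambda>x. x * besselJ1 x - x\<^sup>2 / 2) has_real_derivative d) (at y) \<and> d \<le> 0"
      by blast
  qed (use x in simp)
  moreover have "0 * besselJ1 0 + 0\<^sup>2 / 2 \<le> x * besselJ1 x + x\<^sup>2 / 2"
  proof (rule DERIV_nonneg_imp_increasing_open[where f = "\<lambda>x. x * besselJ1 x + x\<^sup>2 / 2"])
    show "continuous_on {0..x} (\<lambda>x. x * besselJ1 x + x\<^sup>2 / 2)"
      by (intro continuous_intros) auto
    fix y assume y: "0 < y" "y < x"
    have "((\<lambda>x. x * besselJ1 x + x\<^sup>2 / 2) has_real_derivative (y * besselJ 0 y + y)) (at y)"
      by (intro DERIV_add has_derivative_x_besselJ_1) (auto intro!: derivative_eq_intros)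
    moreover have "y * besselJ 0 y + y * 1 \<ge> 0"
      using abs_besselJ_0_le[of y] y unfolding distrib_left[symmetric] by simp
    ultimately show "\<exists>d. ((\<lambda>x. x * besselJ1 x + x\<^sup>2 / 2) has_real_derivative d) (at y) \<and> 0 \<le> d"
      by auto
  qed (use x in simp)
  ultimately have "\<bar>x * besselJ1 x\<bar> \<le> x * (x / 2)"
    by (simp add: power2_eq_square abs_le_iff)
  then show ?thesis
    using False x by (simp add: abs_mult)
qed simp

lemma besselJ_0_ge:
  assumes x: "0 \<le> x"
  shows "1 - x\<^sup>2 / 4 \<le> besselJ 0 x"
proof -
  have "besselJ 0 0 + 0\<^sup>2 / 4 \<le> besselJ 0 x + x\<^sup>2 / 4"
  proof (rule DERIV_nonneg_imp_increasing_open[where f = "\<lambda>x. besselJ 0 x + x\<^sup>2 / 4"])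
    show "continuous_on {0..x} (\<lambda>x. besselJ 0 x + x\<^sup>2 / 4)"
      by (intro continuous_intros) auto
    fix y assume y: "0 < y" "y < x"
    have "((\<lambda>x. besselJ 0 x + x\<^sup>2 / 4) has_real_derivative (- besselJ1 y + y / 2)) (at y)"
      by (auto intro!: derivative_eq_intros)
    moreover have "- besselJ1 y + y / 2 \<ge> 0"
      using abs_besselJ_1_le_half[of y] y by simp
    ultimately show "\<exists>d. ((\<lambda>x. besselJ 0 x + x\<^sup>2 / 4) has_real_derivative d) (at y) \<and> 0 \<le> d"
      by blast
  qed (use x in simp)
  then show ?thesis by simp
qed

lemma besselJ_0_zero_ge_2:
  assumes "0 \<le> x" "besselJ 0 x = 0"
  shows "2 \<le> x"
proof (rule ccontr)
  assume "\<not> 2 \<le> x"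
  then have "x * x < 2 * 2" using assms(1) by (intro mult_strict_mono) auto
  then show False using besselJ_0_ge[OF assms(1)] assms(2) by (simp add: power2_eq_square)
qed

text \<open>
  \<open>sqrt x * besselJ 0 x\<close> solves \<open>y'' + q y = 0\<close> with \<open>q x = 1 + 1 / (4 x\<^sup>2)\<close> decreasing, so that
  \<open>y\<^sup>2 + y'\<^sup>2 / q\<close> increases.
\<close>

lemma besselJ_1_at_zero:
  assumes x: "0 \<le> x" "besselJ 0 x = 0"
  shows "9 / 16 \<le> x * (besselJ1 x)\<^sup>2"
proof -
  \<comment> \<open>\<open>D x = 2 * sqrt x * y' x\<close>; with it,
    \<open>G = y\<^sup>2 + y'\<^sup>2 / q\<close> contains no square roots.\<close>
  define D where "D = (\<lambda>x. besselJ 0 x - 2 * x * besselJ1 x)"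
  define G where "G = (\<lambda>x. x * (besselJ 0 x)\<^sup>2 + x * (D x)\<^sup>2 / (4 * x\<^sup>2 + 1))"
  have pos: "4 * y\<^sup>2 + 1 > 0" for y :: real
    by (simp add: add_nonneg_pos)
  have x2: "2 \<le> x" by (rule besselJ_0_zero_ge_2[OF x])
  have dD: "(D has_real_derivative (- besselJ1 y - 2 * y * besselJ 0 y)) (at y)" if "0 < y" for y
    unfolding D_def using that by (auto intro!: derivative_eq_intros simp: field_simps)
  \<comment> \<open>The comparison starts at \<open>1\<close>, where
    \<open>J\<^sub>0 \<ge> 3 / 4\<close> by \<open>besselJ_0_ge\<close>; its square is the constant
    \<open>9 / 16\<close>. At a zero of \<open>J\<^sub>0\<close>, \<open>G\<close> is at most
    \<open>x * J\<^sub>1\<^sup>2\<close>.\<close>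
  have "G 1 \<le> G x"
  proof (rule DERIV_nonneg_imp_increasing_open[where f = G])
    show "continuous_on {1..x} G"
      unfolding G_def D_def using pos
      by (intro continuous_intros ballI) (auto simp: less_imp_neq[symmetric] intro!: continuous_intros)
    fix y assume y: "1 < y" "y < x"
    have "(G has_real_derivative
       ((besselJ 0 y)\<^sup>2 + y * (2 * besselJ 0 y * (- besselJ1 y)) +
       (((D y)\<^sup>2 + y * (2 * D y * (- besselJ1 y - 2 * y * besselJ 0 y))) * (4 * y\<^sup>2 + 1)
        - y * (D y)\<^sup>2 * (8 * y)) / (4 * y\<^sup>2 + 1)\<^sup>2)) (at y)"
      unfolding G_def using y pos[of y]
      by (auto intro!: derivative_eq_intros dD simp: power2_eq_square)
    also have "((besselJ 0 y)\<^sup>2 + y * (2 * besselJ 0 y * (- besselJ1 y)) +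
       (((D y)\<^sup>2 + y * (2 * D y * (- besselJ1 y - 2 * y * besselJ 0 y))) * (4 * y\<^sup>2 + 1)
        - y * (D y)\<^sup>2 * (8 * y)) / (4 * y\<^sup>2 + 1)\<^sup>2) = 2 * (D y)\<^sup>2 / (4 * y\<^sup>2 + 1)\<^sup>2"
    proof -
      have "((besselJ 0 y)\<^sup>2 + y * (2 * besselJ 0 y * (- besselJ1 y))) * (4 * y\<^sup>2 + 1)\<^sup>2 +
       (((D y)\<^sup>2 + y * (2 * D y * (- besselJ1 y - 2 * y * besselJ 0 y))) * (4 * y\<^sup>2 + 1)
        - y * (D y)\<^sup>2 * (8 * y)) = 2 * (D y)\<^sup>2"
        unfolding D_def by algebra
      then show ?thesis
        using pos[of y] by (simp add: add_divide_eq_iff)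
    qed
    finally show "\<exists>d. (G has_real_derivative d) (at y) \<and> 0 \<le> d"
      by (intro exI conjI) auto
  qed (use x2 in simp)
  moreover have "9 / 16 \<le> G 1"
  proof -
    have "(3 / 4) * (3 / 4) \<le> besselJ 0 1 * besselJ 0 1"
      using besselJ_0_ge[of 1] by (intro mult_mono) auto
    then show ?thesis by (simp add: G_def power2_eq_square add_increasing2)
  qed
  moreover have "G x \<le> x * (besselJ1 x)\<^sup>2"
  proof -
    have "G x = x * (besselJ1 x)\<^sup>2 * (4 * x\<^sup>2 / (4 * x\<^sup>2 + 1))"
      by (simp add: G_def D_def x(2) power_mult_distrib)
    also have "\<dots> \<le> x * (besselJ1 x)\<^sup>2 * 1"
      using x2 pos[of x] by (intro mult_left_mono) auto
    finally show ?thesis by simp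
  qed
  ultimately show ?thesis by linarith
qed

text \<open>Rolle's theorem gives a zero \<open>c\<close> of \<open>J\<^sub>1\<close> between
  \<open>a\<close> and \<open>b\<close>. On the way from \<open>a\<close> to \<open>c\<close>,
  \<open>J\<^sub>1\<close> changes by \<open>|J\<^sub>1 a|\<close>, while the energy and
  \<open>a \<ge> 2\<close> bound its slope by \<open>3 / 2 * |J\<^sub>1 a|\<close>; so
  \<open>c - a \<ge> 2 / 3\<close>.\<close>

lemma besselJ_0_zeros_gap:
  assumes a: "0 \<le> a" "besselJ 0 a = 0" and b: "a < b" "besselJ 0 b = 0"
  shows "a + 1 / 2 \<le> b"
proof -
  have a2: "2 \<le> a" by (rule besselJ_0_zero_ge_2[OF a])
  obtain c where c: "a < c" "c < b" and dc: "(besselJ 0 has_real_derivative 0) (at c)"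
    using Rolle[OF b(1), of "besselJ 0"] a b continuous_besselJ_0[of "{a..b}"]
      has_derivative_besselJ_0 real_differentiable_def by metis
  have c0: "besselJ1 c = 0"
    using DERIV_unique[OF dc has_derivative_besselJ_0[of c]] by simp
  obtain d where d: "a < d" "d < c"
    and m: "besselJ1 c - besselJ1 a = (c - a) * (besselJ 0 d - besselJ1 d / d)"
    using MVT2[OF c(1), of "besselJ1" "\<lambda>x. besselJ 0 x - besselJ1 x / x"] has_derivative_besselJ_1 a2
    by force
  define j where "j = \<bar>besselJ1 a\<bar>"
  have j: "j > 0" using besselJ_1_at_zero[OF a] by (auto simp: j_def)
  have e: "(besselJ 0 d)\<^sup>2 + (besselJ1 d)\<^sup>2 \<le> j\<^sup>2"
    using bessel_energy_antimono[of a d] a d by (simp add: j_def)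
  have "\<bar>besselJ 0 d\<bar> \<le> j" "\<bar>besselJ1 d\<bar> \<le> j"
    using e j zero_le_power2[of "besselJ 0 d"] zero_le_power2[of "besselJ1 d"]
      abs_le_square_iff[of "besselJ 0 d" j] abs_le_square_iff[of "besselJ1 d" j] by linarith+
  moreover from this have "\<bar>besselJ1 d / d\<bar> \<le> j / 2"
    unfolding abs_divide using a2 d by (intro frac_le) auto
  ultimately have "\<bar>besselJ 0 d - besselJ1 d / d\<bar> \<le> 3 / 2 * j"
    by linarith
  then have "(c - a) * \<bar>besselJ 0 d - besselJ1 d / d\<bar> \<le> (c - a) * (3 / 2 * j)"
    using c by (intro mult_left_mono) auto
  moreover have "besselJ1 a = - ((c - a) * (besselJ 0 d - besselJ1 d / d))"
    using m c0 by linarith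
  then have "j = (c - a) * \<bar>besselJ 0 d - besselJ1 d / d\<bar>"
    unfolding j_def using c by (simp only: abs_minus_cancel abs_mult)
  ultimately have "j \<le> (c - a) * (3 / 2 * j)" by linarith
  then have "1 * j \<le> (c - a) * (3 / 2) * j" by (simp only: mult_1 mult.assoc)
  then have "1 \<le> (c - a) * (3 / 2)"
    using j by (simp only: mult_le_cancel_right_pos)
  then have "2 / 3 \<le> c - a" by simp
  then show ?thesis using c by linarith
qed

text \<open>Sturm comparison with \<open>sin (x - a)\<close>.\<close>

lemma besselJ_0_has_zero:
  assumes a: "0 < a"
  shows "\<exists>x. a \<le> x \<and> x \<le> a + pi \<and> besselJ 0 x = 0"
proof (rule ccontr)
  assume "\<not> ?thesis"
  then have nz: "besselJ 0 x \<noteq> 0" if "a \<le> x" "x \<le> a + pi" for x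
    using that by auto
  define \<sigma> where "\<sigma> = sgn (besselJ 0 a)"
  have pos: "0 < \<sigma> * besselJ 0 x" if x: "a \<le> x" "x \<le> a + pi" for x
  proof (rule ccontr)
    assume n: "\<not> 0 < \<sigma> * besselJ 0 x"
    have "0 < \<sigma> * besselJ 0 a" using nz[of a] by (simp add: \<sigma>_def sgn_if)
    moreover have "continuous_on {a..x} (\<lambda>x. \<sigma> * besselJ 0 x)"
      by (intro continuous_intros)
    ultimately have "\<exists>z\<ge>a. z \<le> x \<and> \<sigma> * besselJ 0 z = 0"
      using n x(1) by (intro IVT2') auto
    then obtain z where "a \<le> z" "z \<le> x" "\<sigma> * besselJ 0 z = 0"
      by blast
    then show False using nz[of z] nz[of a] x by (auto simp: \<sigma>_def sgn_if split: if_splits)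
  qed
  define y where "y = (\<lambda>x. sqrt x * (\<sigma> * besselJ 0 x))"
  define y' where "y' = (\<lambda>x. \<sigma> * (besselJ 0 x / (2 * sqrt x) - sqrt x * besselJ1 x))"
  \<comment> \<open>The Wronskian of \<open>y\<close> and \<open>sin (x - a)\<close>. As long as
    \<open>y\<close> is positive it decreases, because \<open>q > 1\<close>; but the sign change of
    the cosine takes it from \<open>- y a\<close> to \<open>y (a + pi)\<close>.\<close>
  define W where "W = (\<lambda>x. y' x * sin (x - a) - y x * cos (x - a))"
  have y_pos: "0 < y x" if "a \<le> x" "x \<le> a + pi" for x
    unfolding y_def by (rule mult_pos_pos) (use a that pos[OF that] in simp_all)
  have dy: "(y has_real_derivative y' x) (at x)" if "0 < x" for x
    unfolding y_def y'_def using that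
    by (auto intro!: derivative_eq_intros simp: field_simps)
  have dy': "(y' has_real_derivative - (1 + 1 / (4 * x\<^sup>2)) * y x) (at x)" if x: "0 < x" for x
  proof -
    define s where "s = sqrt x"
    have s: "s > 0" "x = s * s" using x by (simp_all add: s_def)
    have "(y' has_real_derivative \<sigma> * ((- besselJ1 x * (2 * s) - besselJ 0 x * (2 * (inverse s / 2))) / ((2 * s) * (2 * s))
        - (inverse s / 2 * besselJ1 x + s * (besselJ 0 x - besselJ1 x / x)))) (at x)"
      unfolding y'_def s_def using x
      by (auto intro!: derivative_eq_intros)
    also have "\<sigma> * ((- besselJ1 x * (2 * s) - besselJ 0 x * (2 * (inverse s / 2))) / ((2 * s) * (2 * s))
        - (inverse s / 2 * besselJ1 x + s * (besselJ 0 x - besselJ1 x / x))) = - (1 + 1 / (4 * x\<^sup>2)) * y x"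
      unfolding y_def s_def[symmetric] using s(1)
      by (simp add: s(2) power2_eq_square field_simps)
    finally show ?thesis .
  qed
  have "W (a + pi) \<le> W a"
  proof (rule DERIV_nonpos_imp_decreasing_open[where f = W])
    have D: "(W has_real_derivative (- (1 / (4 * x\<^sup>2)) * y x * sin (x - a))) (at x)" if "0 < x" for x
      unfolding W_def using that
      by (auto intro!: derivative_eq_intros dy dy' simp: algebra_simps)
    show "continuous_on {a..a + pi} W"
      by (intro continuous_at_imp_continuous_on ballI DERIV_isCont[OF D]) (use a in auto)
    fix x assume x: "a < x" "x < a + pi"
    have "0 \<le> sin (x - a)" using x by (intro sin_ge_zero) auto
    moreover have "0 \<le> y x"
      using y_pos[of x] x by simp
    ultimately have "- (1 / (4 * x\<^sup>2)) * y x * sin (x - a) \<le> 0"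
      by simp
    then show "\<exists>d. (W has_real_derivative d) (at x) \<and> d \<le> 0"
      using D[of x] x a by auto
  qed simp
  moreover have "W a < 0"
    using y_pos[of a] by (simp add: W_def)
  moreover have "W (a + pi) > 0"
    using y_pos[of "a + pi"] by (simp add: W_def)
  ultimately show False by linarith
qed

text \<open>The \<open>LEAST\<close> is attained: the gap turns the open condition
  \<open>a < x\<close> into the closed one \<open>a + 1 / 2 \<le> x\<close>, so the admissible zeros
  form a nonempty closed set. At the start \<open>a = 0\<close>, which is no zero, the bound
  \<open>2\<close> on all zeros replaces the gap.\<close>

lemma bessel_zero_step:
  assumes a: "a = 0 \<or> 0 < a \<and> besselJ 0 a = 0"
  defines "z \<equiv> (LEAST x. a < x \<and> besselJ 0 x = 0)"
  shows "a + 1 / 2 \<le> z" "besselJ 0 z = 0" "\<And>x. a < x \<Longrightarrow> besselJ 0 x = 0 \<Longrightarrow> z \<le> x"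
proof -
  define A where "A = {x. a + 1 / 2 \<le> x} \<inter> {x. besselJ 0 x = 0}"
  have gap: "a + 1 / 2 \<le> x" if "a < x" "besselJ 0 x = 0" for x
    using a
  proof
    assume "a = 0" then show ?thesis using besselJ_0_zero_ge_2[of x] that by simp
  next
    assume "0 < a \<and> besselJ 0 a = 0" then show ?thesis using besselJ_0_zeros_gap[of a x] that by simp
  qed
  have "closed A"
    unfolding A_def
    by (intro closed_Int closed_Collect_le closed_Collect_eq continuous_on_besselJ_0 continuous_intros)
  moreover have "A \<noteq> {}"
    using besselJ_0_has_zero[of "a + 1 / 2"] a by (auto simp: A_def)
  moreover have bdd: "bdd_below A"
    by (rule bdd_belowI[of _ "a + 1 / 2"]) (simp add: A_def)
  ultimately have m: "Inf A \<in> A" by (intro closed_contains_Inf)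
  have least: "Inf A \<le> x" if "a < x" "besselJ 0 x = 0" for x
    by (rule cInf_lower[OF _ bdd]) (use gap that in \<open>simp add: A_def\<close>)
  have "z = Inf A"
    unfolding z_def by (rule Least_equality) (use m least in \<open>auto simp: A_def\<close>)
  then show "a + 1 / 2 \<le> z" "besselJ 0 z = 0" "\<And>x. a < x \<Longrightarrow> besselJ 0 x = 0 \<Longrightarrow> z \<le> x"
    using m least by (auto simp: A_def)
qed

section \<open>Enumeration of the positive zeros, with indices shifted to start at
  \<open>0\<close>\<close>

abbreviation zeroJ :: "nat \<Rightarrow> real" where
  "zeroJ k \<equiv> bessel_zero (Suc k)"

lemma bessel_zero_Suc: "0 < zeroJ k" "besselJ 0 (zeroJ k) = 0"
proof (induction k)
  case 0
  { case 1 show ?case using bessel_zero_step(1)[of 0] by simp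
  next case 2 show ?case using bessel_zero_step(2)[of 0] by simp }
next
  case (Suc k)
  have "0 < zeroJ k \<and> besselJ 0 (zeroJ k) = 0" using Suc by simp
  note st = bessel_zero_step[OF disjI2[OF this]]
  { case 1 show ?case using st(1)[folded bessel_zero.simps(2)] Suc(1) by linarith
  next case 2 show ?case using st(2)[folded bessel_zero.simps(2)] . }
qed

lemma bessel_zero_step':
  "bessel_zero k + 1 / 2 \<le> zeroJ k"
  "bessel_zero k < x \<Longrightarrow> besselJ 0 x = 0 \<Longrightarrow> zeroJ k \<le> x"
proof -
  have "bessel_zero k = 0 \<or> 0 < bessel_zero k \<and> besselJ 0 (bessel_zero k) = 0"
  proof (cases k)
    case (Suc j)
    show ?thesis unfolding Suc by (intro disjI2 conjI bessel_zero_Suc)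
  qed simp
  note st = bessel_zero_step[OF this]
  show "bessel_zero k + 1 / 2 \<le> zeroJ k"
    by (rule st(1)[folded bessel_zero.simps(2)])
  show "bessel_zero k < x \<Longrightarrow> besselJ 0 x = 0 \<Longrightarrow> zeroJ k \<le> x"
    by (rule st(3)[folded bessel_zero.simps(2)])
qed

lemma bessel_zero_growth: "real k / 2 \<le> bessel_zero k"
proof (induction k)
  case (Suc k)
  then show ?case using bessel_zero_step'(1)[of k] by (simp add: field_simps del: bessel_zero.simps)
qed simp

lemma strict_mono_bessel_zero: "strict_mono bessel_zero"
  unfolding strict_mono_Suc_iff using bessel_zero_step'(1) by (metis add_strict_increasing2 less_add_same_cancel1 half_gt_zero zero_less_one order_less_le_trans)

text \<open>The zeros grow without bound, so there is a first \<open>bessel_zero m\<close> not below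
  \<open>x\<close>; \<open>x\<close> lies beyond its predecessor, and minimality in the recursion
  forces equality.\<close>

lemma besselJ_0_zero_cases:
  assumes "0 < x" "besselJ 0 x = 0"
  obtains k where "x = zeroJ k"
proof -
  obtain n :: nat where "2 * x < real n" using reals_Archimedean2 by blast
  then have ex: "x \<le> bessel_zero n" using bessel_zero_growth[of n] by simp
  define m where "m = (LEAST n. x \<le> bessel_zero n)"
  have m: "x \<le> bessel_zero m" unfolding m_def using LeastI[of "\<lambda>n. x \<le> bessel_zero n" n, OF ex] .
  then obtain k where k: "m = Suc k" using assms(1) by (cases m) auto
  have "\<not> x \<le> bessel_zero k" using not_less_Least[of k "\<lambda>n. x \<le> bessel_zero n"] k by (simp add: m_def)
  then have "zeroJ k \<le> x" using assms(2) by (intro bessel_zero_step'(2)) auto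
  then show ?thesis using m k that by (metis antisym)
qed

section \<open>Fourier-Bessel coefficients\<close>

declare bessel_zero.simps(2) [simp del]

text \<open>The L2 inner product with weight \<open>x\<close>, in which the radial Laplacian is
  symmetric.\<close>

definition wip :: "(real \<Rightarrow> real) \<Rightarrow> (real \<Rightarrow> real) \<Rightarrow> real" where
  "wip f g = integral {0..1} (\<lambda>x. x * f x * g x)"

abbreviation bfun :: "nat \<Rightarrow> real \<Rightarrow> real" where
  "bfun k x \<equiv> besselJ 0 (zeroJ k * x)"

text \<open>\<open>h'' + h' / x = k\<close> in divergence form, with a Dirichlet condition at \<open>1\<close>.\<close>

definition radial_laplacian :: "(real \<Rightarrow> real) \<Rightarrow> (real \<Rightarrow> real) \<Rightarrow> (real \<Rightarrow> real) \<Rightarrow> bool" where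
  "radial_laplacian h h' k \<longleftrightarrow> continuous_on {0..1} h \<and> h 1 = 0 \<and> continuous_on {0..1} (\<lambda>x. x * h' x) \<and>
    (\<forall>x\<in>{0<..<1}. (h has_real_derivative h' x) (at x) \<and>
      ((\<lambda>x. x * h' x) has_real_derivative x * k x) (at x))"

text \<open>Green's identity against \<open>besselJ 0 (l * x)\<close>: at \<open>1\<close> both
  \<open>h\<close> and the Bessel factor vanish, at \<open>0\<close> the factors \<open>x\<close>
  do. The gauge form of the fundamental theorem makes integrability part of the conclusion, so
  \<open>k\<close> may be a mere pointwise derivative.\<close>

lemma radial_laplacian_parts:
  assumes h: "radial_laplacian h h' k" and l: "0 < l" "besselJ 0 l = 0"
  shows "((\<lambda>x. x * k x * besselJ 0 (l * x)) has_integral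
    - l\<^sup>2 * wip h (\<lambda>x. besselJ 0 (l * x))) {0..1}"
proof -
  have c: "continuous_on {0..1} h" "continuous_on {0..1} (\<lambda>x. x * h' x)"
    using h by (auto simp: radial_laplacian_def)
  define P where "P = (\<lambda>x. (x * h' x) * besselJ 0 (l * x) + h x * ((l * x) * besselJ1 (l * x)))"
  let ?P' = "\<lambda>x. x * k x * besselJ 0 (l * x) + l\<^sup>2 * (x * h x * besselJ 0 (l * x))"
  have "(?P' has_integral (P 1 - P 0)) {0..1}"
  proof (rule fundamental_theorem_of_calculus_interior)
    show "continuous_on {0..1} P"
      unfolding P_def by (intro continuous_on_add continuous_on_mult[OF c(2)] continuous_on_mult[OF c(1)] continuous_intros)
    fix x :: real assume x: "x \<in> {0<..<1}"
    have 1: "(h has_real_derivative h' x) (at x)"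
        "((\<lambda>x. x * h' x) has_real_derivative x * k x) (at x)"
      using h x by (auto simp: radial_laplacian_def)
    have 2: "((\<lambda>x. (l * x) * besselJ1 (l * x)) has_real_derivative (l * x * besselJ 0 (l * x)) * l) (at x)"
      by (rule DERIV_chain2[OF has_derivative_x_besselJ_1]) (auto intro!: derivative_eq_intros)
    have 3: "((\<lambda>x. besselJ 0 (l * x)) has_real_derivative (- besselJ1 (l * x)) * l) (at x)"
      by (rule DERIV_chain2[OF has_derivative_besselJ_0]) (auto intro!: derivative_eq_intros)
    have "(P has_real_derivative ((x * k x) * besselJ 0 (l * x) + ((- besselJ1 (l * x)) * l) * (x * h' x) +
        (h' x * ((l * x) * besselJ1 (l * x)) + ((l * x * besselJ 0 (l * x)) * l) * h x))) (at x)"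
      unfolding P_def by (intro DERIV_add DERIV_mult 1 2 3)
    also have "((x * k x) * besselJ 0 (l * x) + ((- besselJ1 (l * x)) * l) * (x * h' x) +
        (h' x * ((l * x) * besselJ1 (l * x)) + ((l * x * besselJ 0 (l * x)) * l) * h x)) = ?P' x"
      by (simp add: power2_eq_square algebra_simps)
    finally show "(P has_vector_derivative ?P' x) (at x)"
      by (simp add: has_real_derivative_iff_has_vector_derivative)
  qed simp
  moreover have "P 1 = 0" "P 0 = 0"
    using l h by (auto simp: P_def radial_laplacian_def)
  ultimately have 1: "(?P' has_integral 0) {0..1}" by simp
  have "continuous_on {0..1} (\<lambda>x. x * h x * besselJ 0 (l * x))"
    by (intro continuous_intros c)
  then have "((\<lambda>x. x * h x * besselJ 0 (l * x)) has_integral wip h (\<lambda>x. besselJ 0 (l * x))) {0..1}"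
    unfolding wip_def by (intro integrable_integral integrable_continuous_interval)
  then have "((\<lambda>x. l\<^sup>2 * (x * h x * besselJ 0 (l * x))) has_integral
      l\<^sup>2 * wip h (\<lambda>x. besselJ 0 (l * x))) {0..1}"
    by (rule has_integral_mult_right)
  from has_integral_diff[OF 1 this] show ?thesis by simp
qed

text \<open>The Bessel energy times \<open>x\<^sup>2 / 2\<close> is an antiderivative: the decay
  \<open>- 2 * J\<^sub>1\<^sup>2 / x\<close> of the energy removes the \<open>J\<^sub>1\<close>
  part.\<close>

lemma bfun_norm: "wip (bfun k) (bfun k) = (besselJ1 (zeroJ k))\<^sup>2 / 2"
proof -
  define l where "l = zeroJ k"
  have l: "0 < l" "besselJ 0 l = 0" using bessel_zero_Suc by (auto simp: l_def)
  define P where "P = (\<lambda>x. x\<^sup>2 / 2 * ((besselJ 0 (l * x))\<^sup>2 + (besselJ1 (l * x))\<^sup>2))"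
  have "((\<lambda>x. x * besselJ 0 (l * x) * besselJ 0 (l * x)) has_integral (P 1 - P 0)) {0..1}"
  proof (rule fundamental_theorem_of_calculus_interior)
    show "continuous_on {0..1} P"
      unfolding P_def by (intro continuous_intros) auto
    fix x :: real assume x: "x \<in> {0<..<1}"
    have "(P has_real_derivative x * besselJ 0 (l * x) * besselJ 0 (l * x)) (at x)"
      unfolding P_def using x l
      by (auto intro!: derivative_eq_intros simp: power2_eq_square field_simps)
    then show "(P has_vector_derivative x * besselJ 0 (l * x) * besselJ 0 (l * x)) (at x)"
      by (simp add: has_real_derivative_iff_has_vector_derivative)
  qed simp
  then show ?thesis
    unfolding wip_def l_def[symmetric] using l by (simp add: P_def integral_unique)
qed

lemma besselJ_1_zero_pos: "3 / 4 * zeroJ k powr (-1/2) \<le> \<bar>besselJ1 (zeroJ k)\<bar>"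
proof -
  define l where "l = zeroJ k"
  have l: "0 < l" "besselJ 0 l = 0" using bessel_zero_Suc by (auto simp: l_def)
  have "sqrt (9 / 16) \<le> sqrt (l * (besselJ1 l)\<^sup>2)"
    using besselJ_1_at_zero[of l] l by simp
  also have "sqrt (9 / 16) = 3 / 4"
    by (simp add: real_sqrt_divide)
  finally have "3 / 4 \<le> sqrt l * \<bar>besselJ1 l\<bar>"
    by (simp add: real_sqrt_mult)
  then have "3 / 4 * l powr (-1/2) \<le> sqrt l * \<bar>besselJ1 l\<bar> * l powr (-1/2)"
    by (rule mult_right_mono) simp
  also have "\<dots> = \<bar>besselJ1 l\<bar>"
    using l by (simp add: powr_half_sqrt[symmetric] powr_minus)
  finally show ?thesis by (simp add: l_def)
qed

lemma besselJ1_zero_neq_0: "besselJ1 (zeroJ k) \<noteq> 0"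
  using besselJ_1_zero_pos[of k] bessel_zero_Suc(1)[of k]
  by (metis abs_zero half_gt_zero_iff less_eq_real_def linorder_not_less mult_pos_pos powr_gt_zero
      zero_less_divide_iff zero_less_numeral)

lemma bfun_eigen:
  "radial_laplacian (bfun k) (\<lambda>x. - zeroJ k * besselJ1 (zeroJ k * x))
    (\<lambda>x. - (zeroJ k)\<^sup>2 * bfun k x)"
proof -
  define l where "l = zeroJ k"
  have l: "0 < l" "besselJ 0 l = 0" using bessel_zero_Suc by (auto simp: l_def)
  have 2: "((\<lambda>x. - ((l * x) * besselJ1 (l * x))) has_real_derivative - ((l * x * besselJ 0 (l * x)) * l)) (at x)" for x
    by (rule DERIV_minus, rule DERIV_chain2[OF has_derivative_x_besselJ_1]) (auto intro!: derivative_eq_intros)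
  have 3: "((\<lambda>x. besselJ 0 (l * x)) has_real_derivative (- besselJ1 (l * x)) * l) (at x)" for x
    by (rule DERIV_chain2[OF has_derivative_besselJ_0]) (auto intro!: derivative_eq_intros)
  have e: "(\<lambda>x. x * (- l * besselJ1 (l * x))) = (\<lambda>x. - ((l * x) * besselJ1 (l * x)))"
    by (simp add: fun_eq_iff mult_ac)
  show ?thesis
    unfolding radial_laplacian_def l_def[symmetric] e
  proof (intro conjI ballI)
    show "continuous_on {0..1} (\<lambda>x. besselJ 0 (l * x))" "continuous_on {0..1} (\<lambda>x. - (l * x * besselJ1 (l * x)))"
      by (intro continuous_intros)+
    show "besselJ 0 (l * 1) = 0" using l by simp
    fix x :: real
    show "((\<lambda>x. besselJ 0 (l * x)) has_real_derivative - l * besselJ1 (l * x)) (at x)"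
      by (rule DERIV_cong[OF 3]) simp
    show "((\<lambda>x. - (l * x * besselJ1 (l * x))) has_real_derivative x * (- l\<^sup>2 * besselJ 0 (l * x))) (at x)"
      by (rule DERIV_cong[OF 2]) (simp add: power2_eq_square mult_ac)
  qed
qed

text \<open>One integral is evaluated with either eigenvalue, and squares of distinct positive zeros
  differ.\<close>

lemma bfun_orthogonal:
  assumes "j \<noteq> k" shows "wip (bfun j) (bfun k) = 0"
proof -
  let ?l = "zeroJ j" and ?m = "zeroJ k"
  have "((\<lambda>x. x * (- ?l\<^sup>2 * bfun j x) * bfun k x) has_integral - ?m\<^sup>2 * wip (bfun j) (bfun k)) {0..1}"
    by (rule radial_laplacian_parts[OF bfun_eigen]) (rule bessel_zero_Suc)+
  moreover have "((\<lambda>x. - ?l\<^sup>2 * (x * bfun j x * bfun k x)) has_integral - ?l\<^sup>2 * wip (bfun j) (bfun k)) {0..1}"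
    unfolding wip_def
    by (intro has_integral_mult_right integrable_integral integrable_continuous_interval continuous_intros)
  moreover have "(\<lambda>x. x * (- ?l\<^sup>2 * bfun j x) * bfun k x) = (\<lambda>x. - ?l\<^sup>2 * (x * bfun j x * bfun k x))"
    by (simp add: fun_eq_iff mult_ac)
  ultimately have "- ?m\<^sup>2 * wip (bfun j) (bfun k) = - ?l\<^sup>2 * wip (bfun j) (bfun k)"
    by (simp only: has_integral_unique)
  then have "?m\<^sup>2 * wip (bfun j) (bfun k) = ?l\<^sup>2 * wip (bfun j) (bfun k)"
    by (simp only: mult_minus_left neg_equal_iff_equal)
  moreover have "?l \<noteq> ?m"
    using assms strict_mono_eq[OF strict_mono_bessel_zero] by simp
  then have "?m\<^sup>2 \<noteq> ?l\<^sup>2"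
    using bessel_zero_Suc(1)[of j] bessel_zero_Suc(1)[of k] by (simp add: power2_eq_iff)
  ultimately show ?thesis by simp
qed

lemma fb_coeff_eq: "fb_coeff f (Suc k) = wip f (bfun k) / wip (bfun k) (bfun k)"
  unfolding fb_coeff_def bfun_norm besselJ1_def wip_def by simp

lemma fb_coeff_laplacian:
  assumes h: "radial_laplacian h h' k"
  shows "fb_coeff h (Suc n) = - fb_coeff k (Suc n) / (zeroJ n)\<^sup>2"
proof -
  have "wip k (bfun n) = - (zeroJ n)\<^sup>2 * wip h (bfun n)"
    unfolding wip_def[of k] by (intro integral_unique radial_laplacian_parts[OF h] bessel_zero_Suc)
  then show ?thesis
    using bessel_zero_Suc(1)[of n] by (simp add: fb_coeff_eq)
qed

text \<open>AM-GM: \<open>|J| \<le> s / 2 + J\<^sup>2 / (2 s)\<close> with \<open>s = |J\<^sub>1(\<lambda>)|\<close>, twice the square of the norm being \<open>s\<^sup>2\<close>.\<close>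

lemma fb_coeff_bound:
  assumes int: "(\<lambda>x. x * k x * bfun n x) integrable_on {0..1}" and B: "\<And>x. 0 < x \<Longrightarrow> x < 1 \<Longrightarrow> \<bar>k x\<bar> \<le> B"
  shows "\<bar>fb_coeff k (Suc n)\<bar> \<le> 4 / 3 * B * zeroJ n powr (1/2)"
proof -
  define l where "l = zeroJ n"
  have l: "0 < l" using bessel_zero_Suc by (simp add: l_def)
  define s where "s = \<bar>besselJ1 l\<bar>"
  have s: "s > 0" using besselJ1_zero_neq_0[of n] by (simp add: s_def l_def)
  have B0: "0 \<le> B" using B[of "1/2"] by simp
  have "continuous_on {0..1} (\<lambda>x. x * bfun n x * bfun n x)" by (intro continuous_intros)
  then have "((\<lambda>x. x * bfun n x * bfun n x) has_integral s\<^sup>2 / 2) {0..1}"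
    using bfun_norm[of n] unfolding wip_def s_def l_def
    by (metis (no_types, lifting) integrable_integral integrable_continuous_interval power2_abs)
  then have "((\<lambda>x. B / (2 * s) * (x * bfun n x * bfun n x)) has_integral B / (2 * s) * (s\<^sup>2 / 2)) {0..1}"
    by (rule has_integral_mult_right)
  moreover have "((\<lambda>x. x) has_integral 1 / 2) {0..1::real}"
    using ident_has_integral[of 0 "1::real"] by simp
  then have "((\<lambda>x. B * s / 2 * x) has_integral B * s / 2 * (1 / 2)) {0..1}"
    by (rule has_integral_mult_right)
  ultimately have I: "((\<lambda>x. B * s / 2 * x + B / (2 * s) * (x * bfun n x * bfun n x)) has_integral
      (B * s / 2 * (1 / 2) + B / (2 * s) * (s\<^sup>2 / 2))) {0<..<1}"
    unfolding has_integral_Icc_iff_Ioo[symmetric] by (rule has_integral_add[rotated])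
  have "norm (integral {0<..<1} (\<lambda>x. x * k x * bfun n x))
      \<le> integral {0<..<1} (\<lambda>x. B * s / 2 * x + B / (2 * s) * (x * bfun n x * bfun n x))"
  proof (rule hk_integral_norm_bound_integral)
    show "(\<lambda>x. x * k x * bfun n x) integrable_on {0<..<1}"
      using int by (simp add: integrable_on_open_interval_real)
    show "(\<lambda>x. B * s / 2 * x + B / (2 * s) * (x * bfun n x * bfun n x)) integrable_on {0<..<1}"
      using I by blast
    fix x :: real assume x: "x \<in> {0<..<1}"
    define J where "J = \<bar>bfun n x\<bar>"
    have "0 \<le> (s - J)\<^sup>2" by simp
    then have "2 * s * J \<le> s\<^sup>2 + J\<^sup>2" by (simp add: power2_diff)
    then have "J \<le> s / 2 + J\<^sup>2 / (2 * s)"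
      using s by (simp add: field_simps power2_eq_square)
    then have "(x * B) * J \<le> (x * B) * (s / 2 + J\<^sup>2 / (2 * s))"
      using x B0 by (intro mult_left_mono) auto
    moreover have "(x * \<bar>k x\<bar>) * J \<le> (x * B) * J"
      using x B[of x] by (intro mult_right_mono mult_left_mono) (auto simp: J_def)
    moreover have "(x * B) * (s / 2 + J\<^sup>2 / (2 * s)) = B * s / 2 * x + B / (2 * s) * (x * bfun n x * bfun n x)"
      by (simp add: J_def power2_eq_square algebra_simps)
    moreover have "norm (x * k x * bfun n x) = (x * \<bar>k x\<bar>) * J"
      using x by (simp add: abs_mult J_def)
    ultimately show "norm (x * k x * bfun n x) \<le> B * s / 2 * x + B / (2 * s) * (x * bfun n x * bfun n x)"
      by linarith
  qed
  then have "\<bar>wip k (bfun n)\<bar> \<le> B * s / 2"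
    unfolding integral_unique[OF I] wip_def integral_open_interval_real
    using s by (simp add: power2_eq_square field_simps)
  then have "\<bar>wip k (bfun n)\<bar> / (s\<^sup>2 / 2) \<le> B * s / 2 / (s\<^sup>2 / 2)"
    by (rule divide_right_mono) simp
  moreover have W: "wip (bfun n) (bfun n) = s\<^sup>2 / 2"
    by (simp add: bfun_norm s_def l_def)
  have "fb_coeff k (Suc n) = wip k (bfun n) / (s\<^sup>2 / 2)"
    unfolding fb_coeff_eq W ..
  then have "\<bar>fb_coeff k (Suc n)\<bar> = \<bar>wip k (bfun n)\<bar> / (s\<^sup>2 / 2)"
    by (simp add: abs_mult)
  ultimately have "\<bar>fb_coeff k (Suc n)\<bar> \<le> B * s / 2 / (s\<^sup>2 / 2)"
    by linarith
  also have "\<dots> = B * (1 / s)"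
    using s by (simp add: power2_eq_square)
  also have "\<dots> \<le> B * (4 / 3 * l powr (1/2))"
  proof (rule mult_left_mono[OF _ B0])
    have "3 / 4 * l powr (-1/2) \<le> s" using besselJ_1_zero_pos[of n] by (simp add: s_def l_def)
    then have "1 / s \<le> 1 / (3 / 4 * l powr (-1/2))"
      using l by (intro divide_left_mono) (auto simp: s)
    then show "1 / s \<le> 4 / 3 * l powr (1/2)"
      using l by (simp add: powr_minus_divide)
  qed
  finally show ?thesis by (simp add: l_def mult_ac)
qed

lemma fb_coeff_laplacian_bound:
  assumes h: "radial_laplacian h h' k" and B: "\<And>x. 0 < x \<Longrightarrow> x < 1 \<Longrightarrow> \<bar>k x\<bar> \<le> B"
  shows "\<bar>fb_coeff h (Suc n)\<bar> \<le> 4 / 3 * B * zeroJ n powr (-3/2)"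
proof -
  define l where "l = zeroJ n"
  have l: "0 < l" using bessel_zero_Suc by (simp add: l_def)
  have "(\<lambda>x. x * k x * bfun n x) integrable_on {0..1}"
    using radial_laplacian_parts[OF h bessel_zero_Suc] by blast
  then have "\<bar>fb_coeff k (Suc n)\<bar> \<le> 4 / 3 * B * l powr (1/2)"
    unfolding l_def by (rule fb_coeff_bound[OF _ B])
  then have "\<bar>fb_coeff k (Suc n)\<bar> / l\<^sup>2 \<le> 4 / 3 * B * l powr (1/2) / l\<^sup>2"
    by (rule divide_right_mono) simp
  then have "\<bar>fb_coeff h (Suc n)\<bar> \<le> 4 / 3 * B * l powr (1/2) / l\<^sup>2"
    unfolding fb_coeff_laplacian[OF h] l_def[symmetric] by (simp only: abs_divide abs_minus_cancel abs_power2)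
  also have "\<dots> = 4 / 3 * B * (l powr (1/2) / l powr 2)"
    using l by (simp add: powr_numeral)
  also have "l powr (1/2) / l powr 2 = l powr (-3/2)"
    by (simp add: powr_diff[symmetric])
  finally show ?thesis by (simp add: l_def)
qed

lemma summable_bessel_zero: "summable (\<lambda>k. zeroJ k powr (-3/2))"
proof (rule summable_comparison_test[OF _ summable_mult[of "\<lambda>k. real (Suc k) powr (-3/2)" "(1/2) powr (-3/2)"]],
    intro exI allI impI)
  show "summable (\<lambda>k. real (Suc k) powr (-3/2))"
    using summable_real_powr_iff[of "-3/2"] by (subst summable_Suc_iff) simp
  fix k
  have "zeroJ k powr (-3/2) \<le> (real (Suc k) / 2) powr (-3/2)"
    using bessel_zero_growth[of "Suc k"] by (intro powr_mono2') auto
  also have "\<dots> = (1/2) powr (-3/2) * real (Suc k) powr (-3/2)"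
    by (simp add: powr_mult[symmetric])
  finally show "norm (zeroJ k powr (-3/2)) \<le> (1/2) powr (-3/2) * real (Suc k) powr (-3/2)"
    by simp
qed

section \<open>Completeness of the Fourier-Bessel system\<close>

abbreviation cont01 :: "(real \<Rightarrow> real) \<Rightarrow> bool" where
  "cont01 f \<equiv> continuous_on {0..1} f"

section \<open>The weighted inner product on continuous functions\<close>

lemma wip_integrand: "cont01 f \<Longrightarrow> cont01 g \<Longrightarrow> (\<lambda>x. x * f x * g x) integrable_on {0..1}"
  by (intro integrable_continuous_interval continuous_intros)

lemma wip_commute: "wip f g = wip g f"
  by (simp add: wip_def mult_ac)

lemma wip_cong: "(\<And>x. x \<in> {0..1} \<Longrightarrow> f x = f' x) \<Longrightarrow> (\<And>x. x \<in> {0..1} \<Longrightarrow> g x = g' x) \<Longrightarrow> wip f g = wip f' g'"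
  unfolding wip_def by (intro hk_integral_cong) simp

lemma wip_add_left:
  assumes "cont01 f" "cont01 g" "cont01 h"
  shows "wip (\<lambda>x. f x + g x) h = wip f h + wip g h"
proof -
  have "(\<lambda>x. x * (f x + g x) * h x) = (\<lambda>x. x * f x * h x + x * g x * h x)"
    by (simp add: fun_eq_iff algebra_simps)
  then show ?thesis
    unfolding wip_def
    by (simp only: hk_integral_add wip_integrand assms)
qed

lemma wip_diff_left:
  assumes "cont01 f" "cont01 g" "cont01 h"
  shows "wip (\<lambda>x. f x - g x) h = wip f h - wip g h"
proof -
  have "(\<lambda>x. x * (f x - g x) * h x) = (\<lambda>x. x * f x * h x - x * g x * h x)"
    by (simp add: fun_eq_iff algebra_simps)
  then show ?thesis
    unfolding wip_def
    by (simp only: hk_integral_diff wip_integrand assms)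
qed

lemma wip_cmult_left: "wip (\<lambda>x. c * f x) h = c * wip f h"
  unfolding wip_def hk_integral_mult_right[symmetric] by (simp add: mult_ac)

lemma wip_self_nonneg: "0 \<le> wip f f"
  unfolding wip_def
  by (cases "(\<lambda>x. x * f x * f x) integrable_on {0..1}")
    (auto intro!: hk_integral_nonneg simp: mult.assoc not_integrable_integral)

lemma wip_self_eq_0:
  assumes f: "cont01 f" and 0: "wip f f = 0" and x: "x \<in> {0..1}"
  shows "f x = 0"
proof -
  have Z: "\<forall>x\<in>{0..1}. x * f x * f x = 0"
    using 0 unfolding wip_def
    by (subst (asm) integral_eq_0_iff) (auto intro!: continuous_intros f simp: mult.assoc)
  \<comment> \<open>Away from \<open>0\<close> the weight can be cancelled; at \<open>0\<close> it
    vanishes, and continuity has to decide.\<close>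
  have z: "f y = 0" if "y \<in> {0<..1}" for y using bspec[OF Z, of y] that by simp
  show ?thesis
  proof (cases "x = 0")
    case True
    have "(f \<longlongrightarrow> f 0) (at 0 within {0..1})"
      using f by (auto simp: continuous_on_def)
    then have "(f \<longlongrightarrow> f 0) (at_right 0)"
      by (simp add: at_within_Icc_at_right)
    moreover have "\<forall>\<^sub>F y in at_right 0. f y = 0"
      using eventually_at_right_real[of 0 1] by (auto elim!: eventually_mono intro: z)
    ultimately have "((\<lambda>y. 0) \<longlongrightarrow> f 0) (at_right (0::real))"
      by (rule Lim_transform_eventually)
    then have "f 0 = 0"
      by (intro tendsto_unique[OF trivial_limit_at_right_real _ tendsto_const])
    then show ?thesis using True by simp
  qed (use x z in auto)
qed

lemma wip_square_le:
  assumes f: "cont01 f" and g: "cont01 g"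
  shows "(wip f g)\<^sup>2 \<le> wip f f * wip g g"
proof (cases "wip g g = 0")
  case True
  then have "wip f g = wip f (\<lambda>x. 0)"
    using wip_self_eq_0[OF g] by (intro wip_cong) auto
  also have "\<dots> = 0" by (simp add: wip_def)
  finally show ?thesis by (simp add: True)
next
  case False
  define t where "t = wip f g / wip g g"
  have tg: "cont01 (\<lambda>x. t * g x)" by (intro continuous_intros g)
  define d where "d = (\<lambda>x. f x - t * g x)"
  have d: "cont01 d" unfolding d_def by (intro continuous_intros f g)
  have A: "wip d k = wip f k - t * wip g k" if "cont01 k" for k
    unfolding d_def using wip_diff_left[OF f tg that] by (simp only: wip_cmult_left)
  have "0 \<le> wip d d" by (rule wip_self_nonneg)
  also have "\<dots> = (wip f f - t * wip f g) - t * (wip f g - t * wip g g)"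
    using A[OF d] A[OF f] A[OF g] wip_commute[of f d] wip_commute[of g d] wip_commute[of g f] by simp
  also have "\<dots> = wip f f - (wip f g)\<^sup>2 / wip g g"
    using False by (simp add: t_def power2_eq_square field_simps)
  finally show ?thesis
    using False wip_self_nonneg[of g] by (simp add: field_simps)
qed

lemma wip_uniform_limit:
  assumes F: "\<And>n. cont01 (F n)" and f: "cont01 f" and UF: "uniform_limit {0..1} F f sequentially"
    and G: "\<And>n. cont01 (G n)" and g: "cont01 g" and UG: "uniform_limit {0..1} G g sequentially"
  shows "(\<lambda>n. wip (F n) (G n)) \<longlonglongrightarrow> wip f g"
proof -
  have bf: "bounded (f ` {0..1})" and bg: "bounded (g ` {0..1})" and bi: "bounded ((\<lambda>x::real. x) ` {0..1})"
    and xf: "bounded ((\<lambda>x. x * f x) ` {0..1})"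
    by (intro compact_imp_bounded compact_continuous_image continuous_intros f g compact_Icc)+
  have U: "uniform_limit {0..1} (\<lambda>n x. x * F n x * G n x) (\<lambda>x. x * f x * g x) sequentially"
    by (intro uniform_lim_mult uniform_limit_const UF UG xf bf bg bi)
  have C: "cont01 (\<lambda>x. x * F n x * G n x)" for n
    by (intro continuous_intros F G)
  obtain I J where IJ: "\<And>n. ((\<lambda>x. x * F n x * G n x) has_integral I n) {0..1}"
    "((\<lambda>x. x * f x * g x) has_integral J) {0..1}" "I \<longlonglongrightarrow> J"
    by (rule uniform_limit_integral[OF U C trivial_limit_sequentially], rule that)
  have "I = (\<lambda>n. wip (F n) (G n))" "J = wip f g"
    unfolding wip_def using integral_unique[OF IJ(1)] integral_unique[OF IJ(2)] by auto
  then show ?thesis using IJ(3) by simp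
qed

text \<open>The negative derivative of the solution \<open>v\<close> of
  \<open>v'' + v' / x = - h\<close>. At \<open>0\<close> the division yields \<open>0\<close>, which
  is also the limit, as the flux of a bounded \<open>h\<close> is of order \<open>s\<close>.\<close>

definition radial_flux :: "(real \<Rightarrow> real) \<Rightarrow> real \<Rightarrow> real" where
  "radial_flux h s = 1 / s * integral {0..s} (\<lambda>r. r * h r)"

text \<open>Inverse of the negative radial Laplacian with Dirichlet condition at \<open>1\<close>.\<close>

definition radial_green :: "(real \<Rightarrow> real) \<Rightarrow> real \<Rightarrow> real" where
  "radial_green h x = integral {x..1} (radial_flux h)"

section \<open>The Green operator of the radial Laplacian\<close>

lemma radial_mass_deriv:
  assumes h: "cont01 h" and x: "0 \<le> x" "x \<le> 1"
  shows "((\<lambda>s. integral {0..s} (\<lambda>r. r * h r)) has_real_derivative x * h x) (at x within {0..1})"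
  using x by (intro integral_has_real_derivative continuous_intros h) auto

lemma abs_radial_mass_le:
  assumes h: "cont01 h" and B: "\<And>x. x \<in> {0..1} \<Longrightarrow> \<bar>h x\<bar> \<le> B" and s: "0 \<le> s" "s \<le> 1"
  shows "\<bar>integral {0..s} (\<lambda>r. r * h r)\<bar> \<le> B * s\<^sup>2 / 2"
proof -
  have c: "continuous_on {0..s} h" by (rule continuous_on_subset[OF h]) (use s in auto)
  have "norm (integral {0..s} (\<lambda>r. r * h r)) \<le> integral {0..s} (\<lambda>r. B * r)"
  proof (rule hk_integral_norm_bound_integral)
    show "(\<lambda>r. r * h r) integrable_on {0..s}" "(\<lambda>r. B * r) integrable_on {0..s}"
      by (intro integrable_continuous_interval continuous_intros c)+
    show "norm (r * h r) \<le> B * r" if "r \<in> {0..s}" for r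
      using mult_left_mono[OF B[of r], of r] that s by (simp add: abs_mult mult.commute)
  qed
  also have "\<dots> = B * s\<^sup>2 / 2"
    using has_integral_mult_right[OF ident_has_integral[of 0 s], of B] s by (simp add: integral_unique)
  finally show ?thesis by simp
qed

lemma radial_flux_le:
  assumes h: "cont01 h" and B: "\<And>x. x \<in> {0..1} \<Longrightarrow> \<bar>h x\<bar> \<le> B" and s: "0 \<le> s" "s \<le> 1"
  shows "\<bar>radial_flux h s\<bar> \<le> B * s / 2"
proof (cases "s = 0")
  case False
  have "\<bar>radial_flux h s\<bar> \<le> 1 / s * (B * s\<^sup>2 / 2)"
    unfolding radial_flux_def abs_mult using s False
    by (intro mult_mono abs_radial_mass_le[OF h B s]) auto
  then show ?thesis using False by (simp add: power2_eq_square)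
qed (simp add: radial_flux_def)

lemma radial_flux_continuous:
  assumes h: "cont01 h"
  shows "cont01 (radial_flux h)"
proof -
  have M: "cont01 (\<lambda>s. integral {0..s} (\<lambda>r. r * h r))"
    by (intro indefinite_integral_continuous_1 integrable_continuous_interval continuous_intros h)
  obtain B where "\<forall>y\<in>h ` {0..1}. norm y \<le> B"
    using compact_imp_bounded[OF compact_continuous_image[OF h compact_Icc]] unfolding bounded_iff by blast
  then have B: "\<bar>h x\<bar> \<le> B" if "x \<in> {0..1}" for x
    using that by auto
  have "(radial_flux h \<longlongrightarrow> radial_flux h x) (at x within {0..1})" if x: "x \<in> {0..1}" for x
  proof (cases "x = 0")
    case True
    have "((\<lambda>s. B * s / 2) \<longlongrightarrow> B * 0 / 2) (at 0 within {0..1})"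
      by (intro tendsto_intros) auto
    then have "((\<lambda>s. B * s / 2) \<longlongrightarrow> 0) (at 0 within {0..1})" by simp
    moreover have "\<forall>\<^sub>F s in at 0 within {0..1}. norm (radial_flux h s) \<le> B * s / 2"
      unfolding eventually_at_filter using radial_flux_le[OF h B] by (auto intro!: always_eventually)
    ultimately have "(radial_flux h \<longlongrightarrow> 0) (at 0 within {0..1})"
      by (rule Lim_null_comparison[rotated])
    then show ?thesis using True by (simp add: radial_flux_def)
  next
    case False
    then show ?thesis
      unfolding radial_flux_def[abs_def] using M x
      by (intro tendsto_intros) (auto simp: continuous_on_def)
  qed
  then show ?thesis by (simp add: continuous_on_def)
qed

lemma radial_green_continuous:
  assumes h: "cont01 h" shows "cont01 (radial_green h)"
  unfolding radial_green_def[abs_def]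
  by (intro indefinite_integral_continuous_1' integrable_continuous_interval radial_flux_continuous h)

lemma radial_green_1 [simp]: "radial_green h 1 = 0"
  by (simp add: radial_green_def)

lemma radial_flux_mult: "x * radial_flux h x = integral {0..x} (\<lambda>r. r * h r)"
  by (simp add: radial_flux_def)

lemma radial_green_deriv:
  assumes h: "cont01 h" and x: "0 < x" "x < 1"
  shows "(radial_green h has_real_derivative - radial_flux h x) (at x)"
proof -
  have "((\<lambda>x. integral {x..1} (radial_flux h)) has_real_derivative - radial_flux h x) (at x within {0..1})"
    using x by (intro integral_has_real_derivative' radial_flux_continuous h) auto
  then show ?thesis
    using x by (simp add: radial_green_def[abs_def] at_within_Icc_at)
qed

lemma radial_flux_mult_deriv:
  assumes h: "cont01 h" and x: "0 < x" "x < 1"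
  shows "((\<lambda>x. x * radial_flux h x) has_real_derivative x * h x) (at x)"
  using radial_mass_deriv[OF h, of x] x by (simp add: radial_flux_mult at_within_Icc_at)

lemma radial_green_laplacian:
  assumes h: "cont01 h"
  shows "radial_laplacian (radial_green h) (\<lambda>x. - radial_flux h x) (\<lambda>x. - h x)"
  unfolding radial_laplacian_def
  using radial_green_deriv[OF h] DERIV_minus[OF radial_flux_mult_deriv[OF h]]
  by (auto intro!: radial_green_continuous continuous_intros radial_flux_continuous h)

text \<open>Integration by parts with vanishing boundary terms. The right side is symmetric, and
  nonnegative for \<open>h = k\<close>, so the Green operator is symmetric and positive.\<close>

lemma wip_radial_green:
  assumes h: "cont01 h" and k: "cont01 k"
  shows "wip (radial_green h) k = wip (radial_flux h) (radial_flux k)"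
proof -
  let ?K = "\<lambda>x. x * radial_flux k x"
  have c: "cont01 (radial_green h)" "cont01 (radial_flux h)" "cont01 (radial_flux k)"
    using h k by (auto intro: radial_green_continuous radial_flux_continuous)
  have "((\<lambda>x. x * radial_green h x * k x - x * radial_flux h x * radial_flux k x) has_integral
      (radial_green h 1 * ?K 1 - radial_green h 0 * ?K 0)) {0..1}"
  proof (rule fundamental_theorem_of_calculus_interior)
    show "cont01 (\<lambda>x. radial_green h x * ?K x)"
      by (intro continuous_intros c)
    fix x :: real assume "x \<in> {0<..<1}"
    then have x: "0 < x" "x < 1" by auto
    have "((\<lambda>x. radial_green h x * ?K x) has_real_derivative
        (x * radial_green h x * k x - x * radial_flux h x * radial_flux k x)) (at x)"
      using DERIV_mult[OF radial_green_deriv[OF h x] radial_flux_mult_deriv[OF k x]]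
      by (simp add: mult_ac)
    then show "((\<lambda>x. radial_green h x * ?K x) has_vector_derivative
        (x * radial_green h x * k x - x * radial_flux h x * radial_flux k x)) (at x)"
      by (simp add: has_real_derivative_iff_has_vector_derivative)
  qed simp
  then have "integral {0..1} (\<lambda>x. x * radial_green h x * k x - x * radial_flux h x * radial_flux k x) = 0"
    by (simp add: integral_unique)
  then show ?thesis
    using c k by (simp add: wip_def hk_integral_diff wip_integrand)
qed

lemma wip_radial_green_symmetric:
  assumes "cont01 h" "cont01 k" shows "wip (radial_green h) k = wip h (radial_green k)"
  using assms by (metis wip_radial_green wip_commute)

text \<open>Green's identity turns each coefficient of \<open>radial_green h\<close> into that of
  \<open>h\<close> divided by \<open>(zeroJ n)\<^sup>2\<close>, so the orthogonal complement of the
  system is invariant.\<close>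

lemma radial_green_perp:
  assumes h: "cont01 h" and p: "wip h (bfun n) = 0"
  shows "wip (radial_green h) (bfun n) = 0"
proof -
  have "wip (\<lambda>x. - h x) (bfun n) = - (zeroJ n)\<^sup>2 * wip (radial_green h) (bfun n)"
    unfolding wip_def[of "\<lambda>x. - h x"]
    by (intro integral_unique radial_laplacian_parts[OF radial_green_laplacian[OF h]] bessel_zero_Suc)
  moreover have "wip (\<lambda>x. - h x) (bfun n) = 0"
    using wip_cmult_left[of "-1" h "bfun n"] p by simp
  ultimately show ?thesis
    using bessel_zero_Suc(1)[of n] by simp
qed

text \<open>If the image vanishes, so does the norm of the flux, hence the flux, hence the
  derivative \<open>x * h x\<close> of \<open>x\<close> times the flux.\<close>

lemma radial_green_eq_0:
  assumes h: "cont01 h" and z: "\<And>x. x \<in> {0..1} \<Longrightarrow> radial_green h x = 0" and x: "x \<in> {0..1}"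
  shows "h x = 0"
proof -
  have "wip (radial_flux h) (radial_flux h) = 0"
    using wip_radial_green[OF h h] z wip_cong[of "radial_green h" "\<lambda>x. 0" h h] by (simp add: wip_def)
  then have f: "radial_flux h y = 0" if "y \<in> {0..1}" for y
    using wip_self_eq_0[OF radial_flux_continuous[OF h]] that by blast
  have "y * h y = 0" if y: "y \<in> {0<..<1}" for y
  proof (rule DERIV_unique)
    show "((\<lambda>x. x * radial_flux h x) has_real_derivative y * h y) (at y)"
      using y by (intro radial_flux_mult_deriv h) auto
    have "\<forall>\<^sub>F z in nhds y. z * radial_flux h z = 0"
      using y f by (intro eventually_nhds_in_open[of "{0<..<1}", THEN eventually_mono]) auto
    then show "((\<lambda>x. x * radial_flux h x) has_real_derivative 0) (at y)"
      using DERIV_cong_ev[of y y "\<lambda>x. x * radial_flux h x" "\<lambda>x. 0" 0 0] by simp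
  qed
  then have "integral {0<..<1} (\<lambda>x. x * h x * h x) = integral {0<..<1} (\<lambda>x. 0)"
    using hk_integral_cong[of "{0<..<1}" "\<lambda>x. x * h x * h x" "\<lambda>x. 0"] by simp
  then have "wip h h = 0"
    by (simp add: wip_def integral_open_interval_real)
  then show ?thesis using wip_self_eq_0[OF h] x by blast
qed

text \<open>AM-GM with the parameter \<open>s\<close>: the majorant
  \<open>r / (2 * s) + s * r * h\<^sup>2 / 2\<close> of \<open>r * |h|\<close> has integral at most
  \<open>s / 4 + s / 2\<close>, below \<open>s\<close>.\<close>

lemma radial_flux_le_norm:
  assumes h: "cont01 h" and n: "wip h h \<le> 1" and s: "0 \<le> s" "s \<le> 1"
  shows "\<bar>radial_flux h s\<bar> \<le> 1"
proof (cases "s = 0")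
  case False
  with s have s0: "s > 0" by simp
  have c: "continuous_on {0..s} h" by (rule continuous_on_subset[OF h]) (use s in auto)
  let ?g = "\<lambda>r. 1 / s * r / 2 + s * (r * h r * h r) / 2"
  have i1: "(\<lambda>r. r * h r * h r) integrable_on {0..s}"
    by (intro integrable_continuous_interval continuous_intros c)
  have "norm (integral {0..s} (\<lambda>r. r * h r)) \<le> integral {0..s} ?g"
  proof (rule hk_integral_norm_bound_integral)
    show "(\<lambda>r. r * h r) integrable_on {0..s}" "?g integrable_on {0..s}"
      by (intro integrable_continuous_interval continuous_intros c; simp)+
    show "norm (r * h r) \<le> ?g r" if r: "r \<in> {0..s}" for r
    proof -
      define a where "a = \<bar>h r\<bar>"
      have "0 \<le> (1 - s * a)\<^sup>2" by simp
      then have "a \<le> (1 / s + s * a\<^sup>2) / 2"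
        using s0 by (simp add: power2_eq_square field_simps)
      then have "r * a \<le> r * ((1 / s + s * a\<^sup>2) / 2)"
        using r by (intro mult_left_mono) auto
      then show ?thesis
        using r by (simp add: a_def abs_mult power2_eq_square algebra_simps)
    qed
  qed
  also have "integral {0..s} ?g = 1 / s * (s\<^sup>2 / 2) / 2 + s * integral {0..s} (\<lambda>r. r * h r * h r) / 2"
  proof -
    have "((\<lambda>r. r) has_integral s\<^sup>2 / 2) {0..s}"
      using ident_has_integral[of 0 s] s by simp
    then have "(?g has_integral (1 / s * (s\<^sup>2 / 2) / 2 + s * integral {0..s} (\<lambda>r. r * h r * h r) / 2)) {0..s}"
      by (intro has_integral_add has_integral_divide has_integral_mult_right integrable_integral i1)
    then show ?thesis by (rule integral_unique)
  qed
  also have "integral {0..s} (\<lambda>r. r * h r * h r) \<le> wip h h"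
    unfolding wip_def using s
    by (intro integral_subset_le i1 wip_integrand h) (auto simp: mult.assoc)
  also note n
  also have "1 / s * (s\<^sup>2 / 2) / 2 + s * 1 / 2 \<le> s"
    using s0 by (simp add: power2_eq_square)
  finally have "\<bar>integral {0..s} (\<lambda>r. r * h r)\<bar> \<le> s"
    using s0 by (simp add: mult_left_mono)
  then show ?thesis
    using s0 by (simp add: radial_flux_def abs_mult)
qed (simp add: radial_flux_def)

text \<open>Equicontinuity for Arzela-Ascoli: the whole unit ball of the weighted norm is mapped to
  functions with Lipschitz constant \<open>1\<close>.\<close>

lemma radial_green_lipschitz:
  assumes h: "cont01 h" and n: "wip h h \<le> 1" and xy: "x \<in> {0..1}" "y \<in> {0..1}"
  shows "\<bar>radial_green h x - radial_green h y\<bar> \<le> \<bar>x - y\<bar>"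
proof -
  have *: "\<bar>radial_green h x - radial_green h y\<bar> \<le> y - x" if xy: "0 \<le> x" "x \<le> y" "y \<le> 1" for x y
  proof -
    have i: "radial_flux h integrable_on {a..b}" if "0 \<le> a" "b \<le> 1" for a b
      using that by (intro integrable_continuous_interval continuous_on_subset[OF radial_flux_continuous[OF h]]) auto
    have "radial_green h x = integral {x..y} (radial_flux h) + radial_green h y"
      unfolding radial_green_def using xy by (intro hk_integral_combine[symmetric] i) auto
    moreover have "norm (integral {x..y} (radial_flux h)) \<le> integral {x..y} (\<lambda>x. 1)"
      using xy by (intro hk_integral_norm_bound_integral i) (auto intro!: radial_flux_le_norm[OF h n])
    ultimately show ?thesis using xy by simp
  qed
  show ?thesis
    using *[of x y] *[of y x] xy by (cases "x \<le> y") (auto simp: abs_minus_commute)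
qed

lemma radial_flux_add_cmult:
  assumes h: "cont01 h" and k: "cont01 k" and s: "0 \<le> s" "s \<le> 1"
  shows "radial_flux (\<lambda>x. h x + c * k x) s = radial_flux h s + c * radial_flux k s"
proof -
  have i: "(\<lambda>r. r * h r) integrable_on {0..s}" "(\<lambda>r. r * k r) integrable_on {0..s}"
    using s by (auto intro!: integrable_continuous_interval continuous_intros
        continuous_on_subset[OF h] continuous_on_subset[OF k])
  have "integral {0..s} (\<lambda>r. r * h r + c * (r * k r)) = integral {0..s} (\<lambda>r. r * h r) + c * integral {0..s} (\<lambda>r. r * k r)"
    using i by (subst hk_integral_add) (auto intro: integrable_on_mult_right)
  moreover have "(\<lambda>r. r * (h r + c * k r)) = (\<lambda>r. r * h r + c * (r * k r))"
    by (simp add: fun_eq_iff algebra_simps)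
  ultimately show ?thesis
    by (simp add: radial_flux_def algebra_simps add_divide_distrib)
qed

lemma radial_green_add_cmult:
  assumes h: "cont01 h" and k: "cont01 k" and x: "0 \<le> x"
  shows "radial_green (\<lambda>x. h x + c * k x) x = radial_green h x + c * radial_green k x"
proof -
  have i: "radial_flux h integrable_on {x..1}" if "cont01 h" for h
    using x that by (intro integrable_continuous_interval continuous_on_subset[OF radial_flux_continuous]) auto
  have "radial_green (\<lambda>x. h x + c * k x) x = integral {x..1} (\<lambda>s. radial_flux h s + c * radial_flux k s)"
    unfolding radial_green_def using x h k
    by (intro hk_integral_cong radial_flux_add_cmult) auto
  also have "\<dots> = radial_green h x + c * radial_green k x"
    unfolding radial_green_def using i[OF h] i[OF k]
    by (subst hk_integral_add) (auto intro: integrable_on_mult_right)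
  finally show ?thesis .
qed

text \<open>Uniqueness for a singular initial value problem. With
  \<open>l = 1 / sqrt \<rho>\<close>, the difference \<open>d\<close> to the Bessel function solves
  \<open>d'' + d' / x + l\<^sup>2 * d = 0\<close> and vanishes at \<open>0\<close> together with its
  derivative \<open>p\<close>. The energy \<open>E\<close> has derivative
  \<open>- 2 * p\<^sup>2 / x\<close> and starts at \<open>0\<close>.\<close>

lemma radial_green_eigenfunction:
  assumes e: "cont01 e" and \<rho>: "0 < \<rho>" and eig: "\<And>x. x \<in> {0..1} \<Longrightarrow> radial_green e x = \<rho> * e x"
    and x: "x \<in> {0..1}"
  shows "e x = e 0 * besselJ 0 (1 / sqrt \<rho> * x)"
proof -
  define l where "l = 1 / sqrt \<rho>"
  have l: "l > 0" "l\<^sup>2 = 1 / \<rho>" using \<rho> by (simp_all add: l_def power_divide)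
  define p where "p = (\<lambda>x. e 0 * l * besselJ1 (l * x) - l\<^sup>2 * radial_flux e x)"
  define d where "d = (\<lambda>x. e x - e 0 * besselJ 0 (l * x))"
  define E where "E = (\<lambda>x. (p x)\<^sup>2 + l\<^sup>2 * (d x)\<^sup>2)"
  have e_eq: "e x = l\<^sup>2 * radial_green e x" if "x \<in> {0..1}" for x
    using eig[OF that] \<rho> by (simp add: l)
  have J0: "((\<lambda>x. besselJ 0 (l * x)) has_real_derivative (- besselJ1 (l * x)) * l) (at x)" for x
    by (rule DERIV_chain2[OF has_derivative_besselJ_0]) (auto intro!: derivative_eq_intros)
  have J1: "((\<lambda>x. (l * x) * besselJ1 (l * x)) has_real_derivative (l * x * besselJ 0 (l * x)) * l) (at x)" for x
    by (rule DERIV_chain2[OF has_derivative_x_besselJ_1]) (auto intro!: derivative_eq_intros)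
  have de: "(e has_real_derivative l\<^sup>2 * - radial_flux e x) (at x)" if x: "0 < x" "x < 1" for x
  proof (rule has_field_derivative_transform_within_open)
    show "((\<lambda>x. l\<^sup>2 * radial_green e x) has_real_derivative l\<^sup>2 * - radial_flux e x) (at x)"
      by (intro DERIV_cmult radial_green_deriv e x)
    show "l\<^sup>2 * radial_green e y = e y" if "y \<in> {0<..<1}" for y
      using e_eq[of y] that by simp
  qed (use x in auto)
  have dd: "(d has_real_derivative p x) (at x)" if x: "0 < x" "x < 1" for x
    unfolding d_def by (rule DERIV_cong[OF DERIV_diff[OF de[OF x] DERIV_cmult[OF J0]]]) (simp add: p_def)
  have dp: "(p has_real_derivative - l\<^sup>2 * d x - p x / x) (at x)" if x: "0 < x" "x < 1" for x
  proof -
    have "((\<lambda>x. e 0 * ((l * x) * besselJ1 (l * x)) - l\<^sup>2 * (x * radial_flux e x)) has_real_derivative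
        e 0 * ((l * x * besselJ 0 (l * x)) * l) - l\<^sup>2 * (x * e x)) (at x)"
      by (intro DERIV_diff DERIV_cmult J1 radial_flux_mult_deriv e x)
    moreover have "(\<lambda>x. e 0 * ((l * x) * besselJ1 (l * x)) - l\<^sup>2 * (x * radial_flux e x)) = (\<lambda>x. x * p x)"
      by (simp add: p_def fun_eq_iff algebra_simps)
    moreover have "e 0 * ((l * x * besselJ 0 (l * x)) * l) - l\<^sup>2 * (x * e x) = - l\<^sup>2 * d x * x"
      by (simp add: d_def algebra_simps power2_eq_square)
    ultimately have "((\<lambda>x. x * p x) has_real_derivative - l\<^sup>2 * d x * x) (at x)"
      by simp
    then have "(p has_real_derivative (- l\<^sup>2 * d x * x - p x) / x) (at x)"
      by (rule DERIV_factor_ident) (use x in simp)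
    then show ?thesis using x by (simp add: diff_divide_distrib)
  qed
  have "E x \<le> E 0"
  proof (rule DERIV_nonpos_imp_decreasing_open[where f = E])
    have "cont01 E"
      unfolding E_def p_def d_def by (intro continuous_intros e radial_flux_continuous)
    then show "continuous_on {0..x} E" by (rule continuous_on_subset) (use x in auto)
    fix y assume "0 < y" "y < x"
    then have y: "0 < y" "y < 1" using x by auto
    have "(E has_real_derivative (2 * p y * (- l\<^sup>2 * d y - p y / y) + l\<^sup>2 * (2 * d y * p y))) (at y)"
      unfolding E_def by (auto intro!: derivative_eq_intros dp dd y)
    also have "2 * p y * (- l\<^sup>2 * d y - p y / y) + l\<^sup>2 * (2 * d y * p y) = - 2 * (p y)\<^sup>2 / y"
      by (simp add: algebra_simps power2_eq_square)
    finally show "\<exists>D. (E has_real_derivative D) (at y) \<and> D \<le> 0"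
      using y by (intro exI conjI) auto
  qed (use x in simp)
  also have "E 0 = 0"
    by (simp add: E_def p_def d_def radial_flux_def)
  finally have "(p x)\<^sup>2 + l\<^sup>2 * (d x)\<^sup>2 \<le> 0" by (simp add: E_def)
  moreover have "0 \<le> (p x)\<^sup>2" "0 \<le> l\<^sup>2 * (d x)\<^sup>2" by simp_all
  ultimately have "l\<^sup>2 * (d x)\<^sup>2 = 0" by linarith
  then show ?thesis using l(1) by (simp add: d_def l_def)
qed

lemma radial_green_cmult:
  assumes h: "cont01 h" and x: "0 \<le> x"
  shows "radial_green (\<lambda>x. c * h x) x = c * radial_green h x"
proof -
  have "(\<lambda>x. h x + (c - 1) * h x) = (\<lambda>x. c * h x)"
    by (simp add: fun_eq_iff left_diff_distrib)
  then show ?thesis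
    using radial_green_add_cmult[OF h h x, of "c - 1"] by (simp add: left_diff_distrib)
qed

text \<open>
  Power iteration: if \<open>h \<noteq> 0\<close> is orthogonal to all \<open>bfun n\<close>, the normalised iterates of
  \<open>radial_green\<close> accumulate (Arzela-Ascoli) at an eigenfunction of \<open>radial_green\<^sup>2\<close>, which yields an eigenfunction of
  \<open>radial_green\<close> that is still orthogonal to all \<open>bfun n\<close>; but it must be one of them.
\<close>

theorem bfun_complete:
  assumes h: "cont01 h" and perp: "\<And>n. wip h (bfun n) = 0" and x: "x \<in> {0..1}"
  shows "h x = 0"
proof (rule ccontr)
  assume hx: "h x \<noteq> 0"
  define H where "H = (\<lambda>n. (radial_green ^^ n) h)"
  have H0: "H 0 = h" and HS: "H (Suc n) = radial_green (H n)" for n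
    by (simp_all add: H_def)
  have Hc: "cont01 (H n)" for n
    by (induction n) (simp_all add: H0 HS h radial_green_continuous)
  have Hperp: "wip (H n) (bfun k) = 0" for n k
    by (induction n) (simp_all add: H0 HS perp radial_green_perp Hc)
  have nz: "\<exists>x\<in>{0..1}. H n x \<noteq> 0" for n
  proof (induction n)
    case (Suc n)
    then show ?case unfolding HS using radial_green_eq_0[OF Hc[of n]] by blast
  qed (use hx x in \<open>auto simp: H0\<close>)
  define a where "a = (\<lambda>n. wip (H n) (H n))"
  have a: "a n > 0" for n
  proof -
    have "a n \<noteq> 0" using wip_self_eq_0[OF Hc[of n]] nz[of n] by (auto simp: a_def)
    then show ?thesis using wip_self_nonneg[of "H n"] by (simp add: a_def less_le)
  qed
  have shift: "wip (H (Suc m)) (H n) = wip (H m) (H (Suc n))" for m n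
    by (simp add: HS wip_radial_green_symmetric Hc)
  \<comment> \<open>By symmetry \<open>a (Suc n)\<close> is the product of \<open>H n\<close> and
    \<open>H (Suc (Suc n))\<close>; Cauchy-Schwarz makes \<open>a\<close> log-convex, so the
    Rayleigh quotients \<open>r n\<close> of the squared operator increase.\<close>
  have lc: "(a (Suc n))\<^sup>2 \<le> a n * a (Suc (Suc n))" for n
    using wip_square_le[OF Hc[of n] Hc[of "Suc (Suc n)"]] shift[of n "Suc n"] by (simp add: a_def)
  define r where "r = (\<lambda>n. a (Suc n) / a n)"
  have r: "r n > 0" for n using a by (simp add: r_def)
  have r_mono: "incseq r"
  proof (rule incseq_SucI)
    fix n
    have "a (Suc n) * a (Suc n) \<le> a (Suc (Suc n)) * a n" using lc[of n] by (simp add: power2_eq_square mult.commute)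
    then show "r n \<le> r (Suc n)" using a by (simp add: r_def divide_simps)
  qed
  define W where "W = (\<lambda>n x. 1 / sqrt (a n) * H n x)"
  have Wc: "cont01 (W n)" for n unfolding W_def by (intro continuous_intros Hc)
  have WW: "wip (W n) (W n) = 1" for n
  proof -
    have "wip (W n) (W n) = 1 / sqrt (a n) * (1 / sqrt (a n) * a n)"
      unfolding W_def wip_cmult_left wip_commute[of "H n" "\<lambda>x. 1 / sqrt (a n) * H n x"] by (simp add: a_def)
    then show ?thesis using a[of n] by (simp add: field_simps)
  qed
  have GW: "radial_green (W n) x = 1 / sqrt (a n) * H (Suc n) x" if "x \<in> {0..1}" for n x
    unfolding W_def HS using that by (intro radial_green_cmult Hc) simp
  have GW_le: "\<bar>radial_green (W n) x\<bar> \<le> 1" if "x \<in> {0..1}" for n x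
    using radial_green_lipschitz[OF Wc, of n x 1] that by (simp add: WW)
  have r_le: "r n \<le> 1" for n
  proof -
    have "r n = wip (radial_green (W n)) (radial_green (W n))"
    proof -
      have "wip (radial_green (W n)) (radial_green (W n))
          = wip (\<lambda>x. 1 / sqrt (a n) * H (Suc n) x) (\<lambda>x. 1 / sqrt (a n) * H (Suc n) x)"
        by (intro wip_cong GW)
      also have "\<dots> = 1 / sqrt (a n) * (1 / sqrt (a n) * a (Suc n))"
        unfolding wip_cmult_left wip_commute[of "H (Suc n)" "\<lambda>x. 1 / sqrt (a n) * H (Suc n) x"] by (simp add: a_def)
      also have "\<dots> = r n"
        using a[of n] by (simp add: r_def field_simps)
      finally show ?thesis ..
    qed
    also have "\<dots> \<le> integral {0..1} (\<lambda>x::real. 1)"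
      unfolding wip_def
    proof (rule hk_integral_le)
      show "(\<lambda>x. x * radial_green (W n) x * radial_green (W n) x) integrable_on {0..1}"
        by (intro wip_integrand radial_green_continuous Wc)
      fix x :: real assume x: "x \<in> {0..1}"
      have "\<bar>x * radial_green (W n) x * radial_green (W n) x\<bar> \<le> 1 * 1 * 1"
        unfolding abs_mult using x GW_le[OF x, of n] by (intro mult_mono) auto
      then show "x * radial_green (W n) x * radial_green (W n) x \<le> 1" by simp
    qed auto
    finally show ?thesis by simp
  qed
  obtain R where R: "r \<longlonglongrightarrow> R" "\<And>i. r i \<le> R"
    using incseq_convergent[OF r_mono, of 1] r_le by blast
  have Rpos: "R > 0" using r[of 0] R(2)[of 0] by linarith
  \<comment> \<open>The shift makes \<open>F n\<close> an image under the Green operator, namely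
    that of \<open>W n\<close> divided by \<open>sqrt (r n)\<close>. Since
    \<open>r n \<ge> r 0\<close>, all \<open>F n\<close> share the Lipschitz constant
    \<open>K\<close>.\<close>
  define F where "F = (\<lambda>n. W (Suc n))"
  have Fc: "cont01 (F n)" for n by (simp add: F_def Wc)
  define K where "K = 1 / sqrt (r 0)"
  have K: "K > 0" using r[of 0] by (simp add: K_def)
  have F_eq: "F n x = 1 / sqrt (r n) * radial_green (W n) x" if "x \<in> {0..1}" for n x
    using a[of n] a[of "Suc n"] unfolding GW[OF that] by (simp add: F_def W_def r_def real_sqrt_divide)
  have F_lip: "\<bar>F n x - F n y\<bar> \<le> K * \<bar>x - y\<bar>" if xy: "x \<in> {0..1}" "y \<in> {0..1}" for n x y
  proof -
    have "F n x - F n y = 1 / sqrt (r n) * (radial_green (W n) x - radial_green (W n) y)"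
      unfolding F_eq[OF xy(1)] F_eq[OF xy(2)] by (simp only: right_diff_distrib)
    then have "\<bar>F n x - F n y\<bar> = 1 / sqrt (r n) * \<bar>radial_green (W n) x - radial_green (W n) y\<bar>"
      using r[of n] by (simp add: abs_mult)
    also have "\<dots> \<le> 1 / sqrt (r n) * \<bar>x - y\<bar>"
      using r[of n] xy by (intro mult_left_mono radial_green_lipschitz Wc) (simp_all add: WW)
    also have "1 / sqrt (r n) \<le> K"
      unfolding K_def using r[of 0] incseqD[OF r_mono, of 0 n] by (intro divide_left_mono) auto
    then have "1 / sqrt (r n) * \<bar>x - y\<bar> \<le> K * \<bar>x - y\<bar>"
      by (rule mult_right_mono) simp
    finally show ?thesis .
  qed
  have F1: "F n 1 = 0" for n using F_eq[of 1 n] by simp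
  obtain w \<kappa> where w: "cont01 w" and \<kappa>: "strict_mono (\<kappa> :: nat \<Rightarrow> nat)"
    and conv: "\<And>e. 0 < e \<Longrightarrow> \<exists>N. \<forall>n x. n \<ge> N \<and> x \<in> {0..1} \<longrightarrow> norm (F (\<kappa> n) x - w x) < e"
  proof (rule Arzela_Ascoli[of "{0..1::real}" F K])
    show "norm (F n x) \<le> K" if "x \<in> {0..1}" for n x
    proof -
      have "\<bar>F n x\<bar> \<le> K * \<bar>x - 1\<bar>" using F_lip[OF that, of 1 n] F1[of n] by simp
      also have "\<dots> \<le> K * 1" using that K by (intro mult_left_mono) auto
      finally show ?thesis by simp
    qed
    show "\<exists>d>0. \<forall>n y. y \<in> {0..1} \<and> norm (x - y) < d \<longrightarrow> norm (F n x - F n y) < e"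
      if x: "x \<in> {0..1}" and e: "0 < e" for x e
    proof (intro exI conjI allI impI)
      show "0 < e / K" using e K by simp
      fix n y assume y: "y \<in> {0..1} \<and> norm (x - y) < e / K"
      have "\<bar>F n x - F n y\<bar> \<le> K * \<bar>x - y\<bar>" using F_lip[OF x, of y n] y by simp
      also have "\<dots> < e" using y K by (simp add: field_simps)
      finally show "norm (F n x - F n y) < e" by simp
    qed
  qed (simp, rule that)
  have conv': "uniform_limit {0..1} (\<lambda>n. F (\<kappa> n)) w sequentially"
  proof (rule uniform_limitI)
    fix e :: real assume "0 < e"
    from conv[OF this] obtain N
      where N: "\<forall>n x. n \<ge> N \<and> x \<in> {0..1} \<longrightarrow> norm (F (\<kappa> n) x - w x) < e" ..
    show "\<forall>\<^sub>F n in sequentially. \<forall>x\<in>{0..1}. dist (F (\<kappa> n) x) (w x) < e"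
      using eventually_ge_at_top[of N] by eventually_elim (use N in \<open>simp add: dist_norm\<close>)
  qed
  have lim: "(\<lambda>n. wip (F (\<kappa> n)) g) \<longlonglongrightarrow> wip w g" if "cont01 g" for g
    by (rule wip_uniform_limit[OF Fc w conv' that that uniform_limit_const])
  have "(\<lambda>n. wip (F (\<kappa> n)) (F (\<kappa> n))) \<longlonglongrightarrow> wip w w"
    by (rule wip_uniform_limit[OF Fc w conv' Fc w conv'])
  then have ww: "wip w w = 1"
    by (simp add: F_def WW LIMSEQ_const_iff)
  have wperp: "wip w (bfun k) = 0" for k
  proof -
    have "wip (F n) (bfun k) = 0" for n
      unfolding F_def W_def wip_cmult_left by (simp add: Hperp)
    then show ?thesis
      using lim[of "bfun k"] by (simp add: continuous_on_besselJ_0 continuous_intros LIMSEQ_const_iff)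
  qed
  define G where "G = radial_green"
  have Gc: "cont01 (G f)" if "cont01 f" for f unfolding G_def by (rule radial_green_continuous[OF that])
  have Gsym: "wip (G f) g = wip f (G g)" if "cont01 f" "cont01 g" for f g
    unfolding G_def by (rule wip_radial_green_symmetric[OF that])
  define T where "T = (\<lambda>f x. G (G f) x - R * f x)"
  have Tc: "cont01 (T f)" if "cont01 f" for f
    unfolding T_def using that by (intro continuous_intros Gc)
  have T_left: "wip (T f) g = wip (G (G f)) g - R * wip f g" if "cont01 f" "cont01 g" for f g
    unfolding T_def using that wip_diff_left[of "G (G f)" "\<lambda>x. R * f x" g] wip_cmult_left[of R f g]
    by (simp add: Gc continuous_on_mult)
  have Tsym: "wip (T f) g = wip f (T g)" if "cont01 f" "cont01 g" for f g
    using T_left[OF that] T_left[OF that(2,1)] that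
    by (simp add: Gsym Gc wip_commute[of "G (G g)" f] wip_commute[of g f] wip_commute[of "T g" f])
  \<comment> \<open>Expansion of the square for a normalised \<open>F n\<close>: the leading term is
    a product of two consecutive ratios, the mixed term a single one. The value tends to
    \<open>R\<^sup>2 - 2 * R\<^sup>2 + R\<^sup>2 = 0\<close>.\<close>
  have TF: "wip (T (F n)) (T (F n)) = r (Suc (Suc n)) * r (Suc n) - 2 * R * r (Suc n) + R\<^sup>2" for n
  proof -
    define c where "c = 1 / sqrt (a (Suc n))"
    have c2: "c * c * y = y / a (Suc n)" for y
      using a[of "Suc n"] by (simp add: c_def)
    have TFx: "T (F n) x = c * (H (Suc (Suc (Suc n))) x - R * H (Suc n) x)" if x: "x \<in> {0..1}" for x
    proof -
      have F: "F n = (\<lambda>x. c * H (Suc n) x)" by (simp add: F_def W_def c_def)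
      have G1: "G (F n) x = c * H (Suc (Suc n)) x" if "0 \<le> x" for x
        unfolding F G_def HS[of "Suc n"] by (rule radial_green_cmult[OF Hc that])
      \<comment> \<open>\<open>G1\<close> holds for nonnegative arguments, so the functions are not
        equal by extensionality; the integrals that define \<open>G\<close> see only such
        arguments.\<close>
      have "G (G (F n)) x = G (\<lambda>x. c * H (Suc (Suc n)) x) x"
        unfolding G_def radial_green_def[of "radial_green (F n)"] radial_green_def[of "\<lambda>x. c * H (Suc (Suc n)) x"]
          radial_flux_def
        using x G1 by (intro hk_integral_cong arg_cong[where f = "\<lambda>x. y * x" for y]) (auto simp: G_def)
      also have "\<dots> = c * H (Suc (Suc (Suc n))) x"
        unfolding G_def HS[of "Suc (Suc n)"] using x by (intro radial_green_cmult Hc) simp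
      finally show ?thesis by (simp add: T_def F right_diff_distrib)
    qed
    define D where "D = (\<lambda>x. H (Suc (Suc (Suc n))) x - R * H (Suc n) x)"
    have Dc: "cont01 D" unfolding D_def by (intro continuous_intros Hc)
    have RH: "cont01 (\<lambda>x. R * H (Suc n) x)" by (intro continuous_intros Hc)
    have "wip (T (F n)) (T (F n)) = wip (\<lambda>x. c * D x) (\<lambda>x. c * D x)"
      by (intro wip_cong) (simp_all add: TFx D_def)
    also have "\<dots> = c * c * wip D D"
      unfolding wip_cmult_left wip_commute[of D "\<lambda>x. c * D x"] by simp
    also have "wip D D = wip (H (Suc (Suc (Suc n)))) D - R * wip (H (Suc n)) D"
      unfolding D_def using wip_diff_left[OF Hc RH Dc] by (simp add: D_def wip_cmult_left)
    also have "wip (H (Suc (Suc (Suc n)))) D = a (Suc (Suc (Suc n))) - R * a (Suc (Suc n))"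
      using wip_diff_left[OF Hc[of "Suc (Suc (Suc n))"] RH Hc[of "Suc (Suc (Suc n))"]] shift[of "Suc n" "Suc (Suc n)"]
      unfolding wip_commute[of "H (Suc (Suc (Suc n)))" D] by (simp add: D_def wip_cmult_left a_def)
    also have "wip (H (Suc n)) D = a (Suc (Suc n)) - R * a (Suc n)"
      using wip_diff_left[OF Hc[of "Suc (Suc (Suc n))"] RH Hc[of "Suc n"]] shift[of "Suc (Suc n)" "Suc n"]
      unfolding wip_commute[of "H (Suc n)" D] by (simp add: D_def wip_cmult_left a_def)
    finally show ?thesis
      unfolding c2 using a[of "Suc n"] a[of "Suc (Suc n)"]
      by (simp add: r_def power2_eq_square field_simps)
  qed
  define \<phi> where "\<phi> = T w"
  have \<phi>: "cont01 \<phi>" unfolding \<phi>_def by (rule Tc[OF w])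
  \<comment> \<open>The squared norm of \<open>T w\<close> is the limit of
    \<open>wip (T (F (\<kappa> n))) \<phi>\<close>, with \<open>T\<close> moved to the other side by
    symmetry and then bounded by Cauchy-Schwarz. So only limits against the fixed function
    \<open>T \<phi>\<close> are taken.\<close>
  have "(\<lambda>n. (wip (F (\<kappa> n)) (T \<phi>))\<^sup>2) \<longlonglongrightarrow> 0"
  proof (rule Lim_null_comparison)
    have "(\<lambda>n. (r (Suc (Suc n)) * r (Suc n) - 2 * R * r (Suc n) + R\<^sup>2) * wip \<phi> \<phi>) \<longlonglongrightarrow> (R * R - 2 * R * R + R\<^sup>2) * wip \<phi> \<phi>"
      by (intro tendsto_intros R(1) LIMSEQ_Suc)
    then have "(\<lambda>n. (r (Suc (Suc n)) * r (Suc n) - 2 * R * r (Suc n) + R\<^sup>2) * wip \<phi> \<phi>) \<longlonglongrightarrow> 0"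
      by (simp add: power2_eq_square)
    then show "(\<lambda>n. (r (Suc (Suc (\<kappa> n))) * r (Suc (\<kappa> n)) - 2 * R * r (Suc (\<kappa> n)) + R\<^sup>2) * wip \<phi> \<phi>) \<longlonglongrightarrow> 0"
      using LIMSEQ_subseq_LIMSEQ[OF _ \<kappa>] by (force simp: o_def)
    show "\<forall>\<^sub>F n in sequentially. norm ((wip (F (\<kappa> n)) (T \<phi>))\<^sup>2)
        \<le> (r (Suc (Suc (\<kappa> n))) * r (Suc (\<kappa> n)) - 2 * R * r (Suc (\<kappa> n)) + R\<^sup>2) * wip \<phi> \<phi>"
      using wip_square_le[OF Tc[OF Fc] \<phi>] by (simp add: Tsym[OF Fc \<phi>, symmetric] TF)
  qed
  moreover have "(\<lambda>n. (wip (F (\<kappa> n)) (T \<phi>))\<^sup>2) \<longlonglongrightarrow> (wip w (T \<phi>))\<^sup>2"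
    by (intro tendsto_power lim Tc \<phi>)
  ultimately have "(wip w (T \<phi>))\<^sup>2 = 0"
    by (rule LIMSEQ_unique[rotated])
  then have "wip \<phi> \<phi> = 0"
    using Tsym[OF w \<phi>] by (simp add: \<phi>_def)
  then have GGw: "G (G w) x = R * w x" if "x \<in> {0..1}" for x
    using wip_self_eq_0[OF \<phi>] that by (simp add: \<phi>_def T_def)
  define \<rho> where "\<rho> = sqrt R"
  have \<rho>: "\<rho> > 0" "\<rho> * \<rho> = R" using Rpos by (simp_all add: \<rho>_def)
  \<comment> \<open>From \<open>G\<^sup>2 - R = (G - \<rho>) (G + \<rho>)\<close>: the function
    \<open>(G + \<rho>) w\<close> is annihilated by the first factor.\<close>
  define e where "e = (\<lambda>x. G w x + \<rho> * w x)"
  have ec: "cont01 e" unfolding e_def by (intro continuous_intros Gc w)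
  have rw: "cont01 (\<lambda>x. \<rho> * w x)" by (intro continuous_intros w)
  have eig: "radial_green e x = \<rho> * e x" if "x \<in> {0..1}" for x
  proof -
    have "radial_green e x = G (G w) x + \<rho> * G w x"
      unfolding e_def G_def using that by (intro radial_green_add_cmult radial_green_continuous w) simp
    then show ?thesis using GGw[OF that] by (simp add: e_def \<rho>(2)[symmetric] algebra_simps)
  qed
  have e_left: "wip e g = wip (G w) g + \<rho> * wip w g" if "cont01 g" for g
    unfolding e_def using wip_add_left[OF Gc[OF w] rw that] by (simp add: wip_cmult_left)
  \<comment> \<open>Positivity of the Green operator leaves at least
    \<open>\<rho> * wip w w = \<rho>\<close>, so \<open>e\<close> does not vanish.\<close>
  have "wip e w > 0"
    using e_left[OF w] ww \<rho> wip_self_nonneg[of "radial_flux w"] by (simp add: G_def wip_radial_green w)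
  moreover have "wip e w = wip (\<lambda>x. 0) w" if "e 0 = 0"
    using radial_green_eigenfunction[OF ec \<rho>(1) eig] that by (intro wip_cong) auto
  ultimately have e0: "e 0 \<noteq> 0" by (auto simp: wip_def)
  \<comment> \<open>The Green operator imposes the Dirichlet condition, which forces
    \<open>1 / sqrt \<rho>\<close> to be a zero of \<open>J\<^sub>0\<close>.\<close>
  have "e 1 = 0" using eig[of 1] \<rho> by simp
  then have "besselJ 0 (1 / sqrt \<rho>) = 0"
    using radial_green_eigenfunction[OF ec \<rho>(1) eig, of 1] e0 by simp
  then obtain k where k: "1 / sqrt \<rho> = zeroJ k"
    using besselJ_0_zero_cases[of "1 / sqrt \<rho>"] \<rho> by auto
  have bc: "cont01 (bfun k)" by (intro continuous_intros)
  have "e x = e 0 * bfun k x" if "x \<in> {0..1}" for x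
    unfolding k[symmetric] by (rule radial_green_eigenfunction[OF ec \<rho>(1) eig that])
  then have "wip e (bfun k) = wip (\<lambda>x. e 0 * bfun k x) (bfun k)"
    by (rule wip_cong) (assumption | rule refl)+
  also have "\<dots> = e 0 * ((besselJ1 (zeroJ k))\<^sup>2 / 2)"
    by (simp only: wip_cmult_left bfun_norm)
  also have "\<dots> \<noteq> 0"
    using e0 besselJ1_zero_neq_0[of k] by simp
  also have "wip e (bfun k) = 0"
    using e_left[OF bc] wperp[of k] radial_green_perp[OF w wperp[of k]] by (simp add: G_def)
  finally show False by simp
qed

section \<open>Absolutely convergent Fourier-Bessel series\<close>

lemma bfun_le_1: "0 \<le> x \<Longrightarrow> \<bar>bfun k x\<bar> \<le> 1"
  using bessel_zero_Suc(1)[of k] by (intro abs_besselJ_0_le) simp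

context
  fixes c :: "nat \<Rightarrow> real"
  assumes c: "summable (\<lambda>k. \<bar>c k\<bar>)"
begin

lemma bfun_series_uniform:
  "uniform_limit {0..1} (\<lambda>n x. \<Sum>k<n. c k * bfun k x) (\<lambda>x. \<Sum>k. c k * bfun k x) sequentially"
proof (rule Weierstrass_m_test[OF _ c])
  fix n and x :: real assume "x \<in> {0..1}"
  then show "norm (c n * bfun n x) \<le> \<bar>c n\<bar>"
    using bfun_le_1[of x n] by (simp add: abs_mult mult_left_le)
qed

lemma bfun_series_continuous: "cont01 (\<lambda>x. \<Sum>k. c k * bfun k x)"
  by (rule uniform_limit_theorem[OF _ bfun_series_uniform])
    (auto intro!: always_eventually continuous_intros)

lemma wip_bfun_series: "wip (\<lambda>x. \<Sum>k. c k * bfun k x) (bfun j) = c j * wip (bfun j) (bfun j)"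
proof -
  have fin: "wip (\<lambda>x. \<Sum>k<n. c k * bfun k x) (bfun j) = (if j < n then c j * wip (bfun j) (bfun j) else 0)" for n
  proof (induction n)
    case 0
    show ?case by (simp add: wip_def)
  next
    case (Suc n)
    have "wip (\<lambda>x. \<Sum>k<Suc n. c k * bfun k x) (bfun j)
        = wip (\<lambda>x. \<Sum>k<n. c k * bfun k x) (bfun j) + c n * wip (bfun n) (bfun j)"
      unfolding sum.lessThan_Suc wip_cmult_left[symmetric]
      by (intro wip_add_left continuous_intros)
    also have "\<dots> = (if j < Suc n then c j * wip (bfun j) (bfun j) else 0)"
      unfolding Suc.IH using bfun_orthogonal[of n j] by (cases "j = n") auto
    finally show ?case .
  qed
  have "(\<lambda>n. wip (\<lambda>x. \<Sum>k<n. c k * bfun k x) (bfun j)) \<longlonglongrightarrow> wip (\<lambda>x. \<Sum>k. c k * bfun k x) (bfun j)"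
    by (rule wip_uniform_limit[OF _ bfun_series_continuous bfun_series_uniform _ _ uniform_limit_const])
      (intro continuous_intros)+
  moreover have "(\<lambda>n. wip (\<lambda>x. \<Sum>k<n. c k * bfun k x) (bfun j)) \<longlonglongrightarrow> c j * wip (bfun j) (bfun j)"
    unfolding fin by (rule tendsto_eventually, use eventually_gt_at_top[of j] in eventually_elim) simp
  ultimately show ?thesis by (rule LIMSEQ_unique)
qed

end

lemma wip_bfun_pos: "0 < wip (bfun k) (bfun k)"
  using besselJ1_zero_neq_0[of k] by (simp add: bfun_norm)

lemma bfun_coeffs_unique:
  assumes f: "cont01 f" and g: "cont01 g" and eq: "\<And>k. wip f (bfun k) = wip g (bfun k)" and x: "x \<in> {0..1}"
  shows "f x = g x"
proof -
  have "(\<lambda>x. f x - g x) x = 0"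
  proof (rule bfun_complete[OF _ _ x])
    show "cont01 (\<lambda>x. f x - g x)" by (intro continuous_intros f g)
    fix k
    have "cont01 (bfun k)" by (intro continuous_intros)
    then show "wip (\<lambda>x. f x - g x) (bfun k) = 0"
      using eq[of k] by (simp add: wip_diff_left f g)
  qed
  then show ?thesis by simp
qed

lemma fb_coeff_summable:
  assumes h: "radial_laplacian h h' k" and B: "\<And>x. 0 < x \<Longrightarrow> x < 1 \<Longrightarrow> \<bar>k x\<bar> \<le> B"
  shows "summable (\<lambda>n. \<bar>fb_coeff h (Suc n)\<bar>)"
  by (rule summable_comparison_test[OF _ summable_mult[OF summable_bessel_zero, of "4 / 3 * B"]])
    (use fb_coeff_laplacian_bound[OF h B] in auto)

text \<open>Uniform convergence makes the sum continuous with the same coefficients as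
  \<open>h\<close>, and completeness identifies the two at every point.\<close>

lemma fourier_bessel_expansion:
  assumes h: "cont01 h" and s: "summable (\<lambda>n. \<bar>fb_coeff h (Suc n)\<bar>)" and x: "x \<in> {0..1}"
  shows "(\<Sum>n. fb_coeff h (Suc n) * bfun n x) = h x"
proof (rule bfun_coeffs_unique[OF bfun_series_continuous[OF s] h _ x])
  fix k
  show "wip (\<lambda>x. \<Sum>n. fb_coeff h (Suc n) * bfun n x) (bfun k) = wip h (bfun k)"
    unfolding wip_bfun_series[OF s] fb_coeff_eq[of h k] using wip_bfun_pos[of k] by simp
qed

text \<open>Polynomials in \<open>x\<^sup>2\<close> that vanish at \<open>1\<close> are dense and have summable coefficients.\<close>

lemma bfun_dense:
  assumes g: "cont01 g" and g1: "g 1 = 0" and e: "0 < e"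
  obtains c where "summable (\<lambda>k. \<bar>c k\<bar>)" "\<And>x. x \<in> {0..1} \<Longrightarrow> \<bar>g x - (\<Sum>k. c k * bfun k x)\<bar> \<le> e"
proof -
  \<comment> \<open>Approximation in the variable \<open>s = x\<^sup>2\<close> yields even
    polynomials, for which the quotient \<open>h' x / x\<close> in the radial Laplacian stays
    bounded at \<open>0\<close>.\<close>
  have "cont01 (\<lambda>s. g (sqrt s))"
    by (rule continuous_on_compose2[OF g]) (auto intro!: continuous_intros)
  then obtain p where p: "real_polynomial_function p" and pe: "\<And>s. s \<in> {0..1} \<Longrightarrow> \<bar>g (sqrt s) - p s\<bar> < e / 2"
    using Stone_Weierstrass_real_polynomial_function[of "{0..1::real}" "\<lambda>s. g (sqrt s)" "e / 2"] e by auto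
  obtain p' where p': "real_polynomial_function p'" "\<And>x. (p has_real_derivative p' x) (at x)"
    using has_real_derivative_polynomial_function[OF p] by blast
  obtain p'' where p'': "real_polynomial_function p''" "\<And>x. (p' has_real_derivative p'' x) (at x)"
    using has_real_derivative_polynomial_function[OF p'(1)] by blast
  have cp: "continuous_on A q" if "real_polynomial_function q" for q :: "real \<Rightarrow> real" and A
    using that by (intro continuous_on_polymonial_function) (simp add: real_polynomial_function_eq)
  have sq: "continuous_on {0..1} (\<lambda>x. q (x\<^sup>2))" if "real_polynomial_function q" for q :: "real \<Rightarrow> real"
    by (rule continuous_on_compose2[OF cp[OF that, of UNIV]]) (auto intro!: continuous_intros)
  define h where "h = (\<lambda>x::real. p (x\<^sup>2) - p 1)"
  define h' where "h' = (\<lambda>x::real. 2 * x * p' (x\<^sup>2))"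
  define k where "k = (\<lambda>x::real. 4 * p' (x\<^sup>2) + 4 * x\<^sup>2 * p'' (x\<^sup>2))"
  have D: "((\<lambda>x. x\<^sup>2) has_real_derivative 2 * x) (at x)" for x :: real
    by (auto intro!: derivative_eq_intros)
  have lap: "radial_laplacian h h' k"
    unfolding radial_laplacian_def
  proof (intro conjI ballI)
    show "cont01 h" unfolding h_def by (intro continuous_intros sq p)
    show "h 1 = 0" by (simp add: h_def)
    show "cont01 (\<lambda>x. x * h' x)" unfolding h'_def by (intro continuous_intros sq p')
    fix x :: real
    show "(h has_real_derivative h' x) (at x)"
      unfolding h_def h'_def
      by (rule DERIV_cong[OF DERIV_diff[OF DERIV_chain2[OF p'(2) D] DERIV_const]]) simp
    have "((\<lambda>x. 2 * x\<^sup>2 * p' (x\<^sup>2)) has_real_derivative (2 * (2 * x)) * p' (x\<^sup>2) + p'' (x\<^sup>2) * (2 * x) * (2 * x\<^sup>2)) (at x)"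
      by (intro DERIV_mult DERIV_cmult D DERIV_chain2[OF p''(2) D])
    moreover have "(\<lambda>x. 2 * x\<^sup>2 * p' (x\<^sup>2)) = (\<lambda>x. x * h' x)"
      by (simp add: h'_def fun_eq_iff power2_eq_square)
    moreover have "(2 * (2 * x)) * p' (x\<^sup>2) + p'' (x\<^sup>2) * (2 * x) * (2 * x\<^sup>2) = x * k x"
      by (simp add: k_def power2_eq_square algebra_simps)
    ultimately show "((\<lambda>x. x * h' x) has_real_derivative x * k x) (at x)"
      by simp
  qed
  have "cont01 k" unfolding k_def by (intro continuous_intros sq p' p'')
  then have "bounded (k ` {0..1})" by (intro compact_imp_bounded compact_continuous_image) auto
  then obtain B where "\<forall>y\<in>k ` {0..1}. norm y \<le> B" unfolding bounded_iff by blast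
  then have B: "\<bar>k x\<bar> \<le> B" if "0 < x" "x < 1" for x using that by auto
  note s = fb_coeff_summable[OF lap B]
  show ?thesis
  proof (rule that[OF s])
    fix x :: real assume x: "x \<in> {0..1}"
    have "cont01 h" using lap by (simp add: radial_laplacian_def)
    then have eq: "(\<Sum>n. fb_coeff h (Suc n) * bfun n x) = h x"
      by (rule fourier_bessel_expansion[OF _ s x])
    have "\<bar>g x - p (x\<^sup>2)\<bar> < e / 2" using pe[of "x\<^sup>2"] x by (simp add: power_le_one)
    \<comment> \<open>Subtracting \<open>p 1\<close> restores the Dirichlet condition and, as
      \<open>g 1 = 0\<close>, costs another \<open>e / 2\<close>.\<close>
    moreover have "\<bar>p 1\<bar> < e / 2" using pe[of 1] g1 by simp
    ultimately show "\<bar>g x - (\<Sum>n. fb_coeff h (Suc n) * bfun n x)\<bar> \<le> e"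
      unfolding eq unfolding h_def by linarith
  qed
qed

section \<open>The maximum principle for the diffusion equation\<close>

text \<open>The space derivatives are witnesses \<open>p\<close> and \<open>q\<close> instead of
  \<open>deriv\<close> terms, so that differences of solutions are handled by the differentiation
  rules directly.\<close>

definition diffusion_solution :: "real \<Rightarrow> real \<Rightarrow> (real \<Rightarrow> real \<Rightarrow> real) \<Rightarrow> bool" where
  "diffusion_solution \<alpha> T u \<longleftrightarrow>
     continuous_on ({0..1} \<times> {0..T}) (\<lambda>(x, t). u x t) \<and>
     (\<forall>t\<in>{0<..<T}. u 1 t = 0 \<and> (\<exists>p q. \<forall>x\<in>{0<..<1}.
        ((\<lambda>y. u y t) has_real_derivative p x) (at x) \<and> (p has_real_derivative q x) (at x) \<and>
        has_caputo \<alpha> (\<lambda>s. u x s) t \<and> caputo \<alpha> (\<lambda>s. u x s) t = q x + p x / x))"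

lemma diffusion_solution_diff:
  assumes u: "diffusion_solution \<alpha> T u" and v: "diffusion_solution \<alpha> T v"
  shows "diffusion_solution \<alpha> T (\<lambda>x t. u x t - v x t)"
  unfolding diffusion_solution_def
proof (intro conjI ballI)
  show "continuous_on ({0..1} \<times> {0..T}) (\<lambda>(x, t). u x t - v x t)"
    using u v unfolding diffusion_solution_def case_prod_beta by (intro continuous_intros) auto
  fix t assume t: "t \<in> {0<..<T}"
  then show "u 1 t - v 1 t = 0" using u v by (auto simp: diffusion_solution_def)
  obtain p q where p: "\<And>x. x \<in> {0<..<1} \<Longrightarrow> ((\<lambda>y. u y t) has_real_derivative p x) (at x)"
      "\<And>x. x \<in> {0<..<1} \<Longrightarrow> (p has_real_derivative q x) (at x)"
      "\<And>x. x \<in> {0<..<1} \<Longrightarrow> has_caputo \<alpha> (\<lambda>s. u x s) t"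
      "\<And>x. x \<in> {0<..<1} \<Longrightarrow> caputo \<alpha> (\<lambda>s. u x s) t = q x + p x / x"
    using u t unfolding diffusion_solution_def by metis
  obtain p' q' where p': "\<And>x. x \<in> {0<..<1} \<Longrightarrow> ((\<lambda>y. v y t) has_real_derivative p' x) (at x)"
      "\<And>x. x \<in> {0<..<1} \<Longrightarrow> (p' has_real_derivative q' x) (at x)"
      "\<And>x. x \<in> {0<..<1} \<Longrightarrow> has_caputo \<alpha> (\<lambda>s. v x s) t"
      "\<And>x. x \<in> {0<..<1} \<Longrightarrow> caputo \<alpha> (\<lambda>s. v x s) t = q' x + p' x / x"
    using v t unfolding diffusion_solution_def by metis
  have t0: "0 < t" using t by simp
  show "\<exists>p q. \<forall>x\<in>{0<..<1}. ((\<lambda>y. u y t - v y t) has_real_derivative p x) (at x) \<and>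
      (p has_real_derivative q x) (at x) \<and> has_caputo \<alpha> (\<lambda>s. u x s - v x s) t \<and>
      caputo \<alpha> (\<lambda>s. u x s - v x s) t = q x + p x / x"
  proof (intro exI ballI conjI)
    fix x :: real assume x: "x \<in> {0<..<1}"
    show "((\<lambda>y. u y t - v y t) has_real_derivative (\<lambda>x. p x - p' x) x) (at x)"
      "((\<lambda>x. p x - p' x) has_real_derivative (\<lambda>x. q x - q' x) x) (at x)"
      using p p' x by (auto intro!: DERIV_diff)
    show "has_caputo \<alpha> (\<lambda>s. u x s - v x s) t"
      by (rule caputo_diff[OF t0 p(3)[OF x] p'(3)[OF x]])
    show "caputo \<alpha> (\<lambda>s. u x s - v x s) t = (\<lambda>x. q x - q' x) x + (\<lambda>x. p x - p' x) x / x"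
      using caputo_diff(2)[OF t0 p(3)[OF x] p'(3)[OF x]] p(4)[OF x] p'(4)[OF x]
      by (simp add: diff_divide_distrib)
  qed
qed

text \<open>
  Adding \<open>\<delta> * ln x\<close>, a solution of the stationary equation, keeps the maximum away from \<open>x = 0\<close>,
  so that no boundary condition is needed there.
\<close>

lemma diffusion_maximum_principle:
  assumes a: "0 < \<alpha>" "\<alpha> < 1" and T: "0 < T" and w: "diffusion_solution \<alpha> T w"
    and M: "0 \<le> M" "\<And>x. x \<in> {0..1} \<Longrightarrow> w x 0 \<le> M" and xt: "x \<in> {0..1}" "t \<in> {0..T}"
  shows "w x t \<le> M"
proof -
  have cont: "continuous_on ({0..1} \<times> {0..T}) (\<lambda>z. w (fst z) (snd z))"
    using w by (simp add: diffusion_solution_def case_prod_beta)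
  have inner: "w x t \<le> M" if x1: "0 < x" "x < 1" and t1: "0 < t" "t < T" for x t
  proof (rule ccontr)
    assume neg: "\<not> w x t \<le> M"
    define L where "L = 1 - ln x"
    have L: "L > 0" using x1 ln_le_minus_one[of x] unfolding L_def by linarith
    \<comment> \<open>\<open>\<delta> * L\<close> is half the excess over \<open>M\<close>, so the
      perturbed function still exceeds \<open>M\<close> at \<open>(x, t)\<close>.\<close>
    define \<delta> where "\<delta> = (w x t - M) / (2 * L)"
    have \<delta>: "\<delta> > 0" using neg L by (simp add: \<delta>_def)
    have "\<delta> * L = (w x t - M) / 2" using L by (simp add: \<delta>_def)
    then have start: "w x t + \<delta> * ln x > M" using neg \<delta> by (simp add: L_def algebra_simps)
    have "bounded ((\<lambda>z. w (fst z) (snd z)) ` ({0..1} \<times> {0..T}))"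
      by (intro compact_imp_bounded compact_continuous_image cont compact_Times compact_Icc)
    then obtain B where "\<forall>y\<in>(\<lambda>z. w (fst z) (snd z)) ` ({0..1} \<times> {0..T}). norm y \<le> B"
      unfolding bounded_iff by blast
    then have B: "w y s \<le> B" if "y \<in> {0..1}" "s \<in> {0..T}" for y s
      using that by force
    \<comment> \<open>The exponential makes \<open>B + \<delta> * ln r < M\<close>, so the maximum
      is not on the line at \<open>r\<close>; the minimum with \<open>x\<close> keeps
      \<open>(x, t)\<close> inside \<open>K\<close>.\<close>
    define r where "r = min x (exp ((M - B) / \<delta> - 1))"
    have r: "0 < r" "r \<le> x" using x1 by (auto simp: r_def)
    have "ln r \<le> (M - B) / \<delta> - 1"
      using r(1) by (metis exp_gt_zero ln_exp ln_le_cancel_iff min.cobounded2 r_def)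
    then have "\<delta> * ln r \<le> \<delta> * ((M - B) / \<delta> - 1)" using \<delta> by (intro mult_left_mono) auto
    also have "\<dots> = M - B - \<delta>" using \<delta> by (simp add: field_simps)
    finally have rB: "B + \<delta> * ln r < M" using \<delta> by linarith
    \<comment> \<open>The time interval ends at \<open>t < T\<close>: the maximum may lie on its
      upper edge, where the equation still holds.\<close>
    define K where "K = {r..1} \<times> {0..t}"
    have "continuous_on K (\<lambda>z. w (fst z) (snd z) + \<delta> * ln (fst z))"
      unfolding K_def using r t1
      by (intro continuous_intros continuous_on_subset[OF cont]) auto
    moreover have "compact K" "K \<noteq> {}" using r x1 t1 by (auto simp: K_def compact_Times)
    ultimately obtain z where z: "z \<in> K" "\<And>y. y \<in> K \<Longrightarrow>
        w (fst y) (snd y) + \<delta> * ln (fst y) \<le> w (fst z) (snd z) + \<delta> * ln (fst z)"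
      using continuous_attains_sup[of K "\<lambda>z. w (fst z) (snd z) + \<delta> * ln (fst z)"] by blast
    define x0 t0 where "x0 = fst z" and "t0 = snd z"
    have dom: "r \<le> x0" "x0 \<le> 1" "0 \<le> t0" "t0 \<le> t" using z(1) by (auto simp: K_def x0_def t0_def)
    have max: "w y s + \<delta> * ln y \<le> w x0 t0 + \<delta> * ln x0" if "r \<le> y" "y \<le> 1" "0 \<le> s" "s \<le> t" for y s
      using z(2)[of "(y, s)"] that by (simp add: K_def x0_def t0_def)
    have gt: "w x0 t0 + \<delta> * ln x0 > M"
      using max[of x t] start r x1 t1 by simp
    have x0: "0 < x0" using dom r by simp
    have ln0: "\<delta> * ln x0 \<le> 0" using dom x0 \<delta> by (simp add: mult_nonneg_nonpos)
    have "t0 \<noteq> 0" using gt ln0 M(2)[of x0] dom x0 by auto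
    then have t0: "0 < t0" "t0 < T" using dom t1 by auto
    have "x0 \<noteq> r" using gt rB B[of r t0] r x1 t0 by auto
    then have rx0: "r < x0" using dom by simp
    have "w 1 t0 = 0" using w t0 by (simp add: diffusion_solution_def)
    then have "x0 \<noteq> 1" using gt M(1) by auto
    then have x01: "x0 < 1" using dom by simp
    obtain p q where p: "\<And>x. x \<in> {0<..<1} \<Longrightarrow> ((\<lambda>y. w y t0) has_real_derivative p x) (at x)"
        "\<And>x. x \<in> {0<..<1} \<Longrightarrow> (p has_real_derivative q x) (at x)"
        "\<And>x. x \<in> {0<..<1} \<Longrightarrow> has_caputo \<alpha> (\<lambda>s. w x s) t0"
        "\<And>x. x \<in> {0<..<1} \<Longrightarrow> caputo \<alpha> (\<lambda>s. w x s) t0 = q x + p x / x"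
      using w t0 unfolding diffusion_solution_def by (metis greaterThanLessThan_iff)
    have x0': "x0 \<in> {0<..<1}" using x0 x01 by simp
    have "p x0 + \<delta> / x0 = 0 \<and> q x0 - \<delta> / x0\<^sup>2 \<le> 0"
    proof (rule conjI)
      have D: "((\<lambda>y. w y t0 + \<delta> * ln y) has_real_derivative p y + \<delta> / y) (at y)" if "r < y" "y < 1" for y
        using p(1)[of y] that r by (auto intro!: derivative_eq_intros)
      have D2: "((\<lambda>y. p y + \<delta> / y) has_real_derivative q x0 - \<delta> / x0\<^sup>2) (at x0)"
        using p(2)[OF x0'] x0 by (auto intro!: derivative_eq_intros simp: power2_eq_square)
      have m: "w y t0 + \<delta> * ln y \<le> w x0 t0 + \<delta> * ln x0" if "r < y" "y < 1" for y
        using max[of y t0] that dom by simp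
      show "p x0 + \<delta> / x0 = 0" "q x0 - \<delta> / x0\<^sup>2 \<le> 0"
        by (rule deriv_at_interior_max[OF rx0 x01 D D2 m]; assumption)+
    qed
    \<comment> \<open>The logarithm is radially harmonic, so the two contributions of
      \<open>\<delta>\<close> cancel.\<close>
    then have "q x0 + p x0 / x0 \<le> \<delta> / x0\<^sup>2 + (- \<delta> / x0) / x0"
      using x0 by (intro add_mono divide_right_mono) auto
    also have "\<dots> = 0" by (simp add: power2_eq_square)
    finally have "caputo \<alpha> (\<lambda>s. w x0 s) t0 \<le> 0" using p(4)[OF x0'] by simp
    moreover have "0 < caputo \<alpha> (\<lambda>s. w x0 s) t0"
    proof (rule caputo_pos_at_max[OF a t0(1) p(3)[OF x0']])
      have "continuous_on {0..t0} (\<lambda>s. w (fst (x0, s)) (snd (x0, s)))"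
        by (rule continuous_on_compose2[OF cont]) (use x0 x01 t0 in \<open>auto intro!: continuous_intros\<close>)
      then show "continuous_on {0..t0} (\<lambda>s. w x0 s)" by simp
      \<comment> \<open>Any time between \<open>t0\<close> and \<open>T\<close> serves:
        \<open>has_caputo\<close> there includes differentiability at \<open>t0\<close>.\<close>
      have "(t0 + T) / 2 \<in> {0<..<T}" using t0 by simp
      then have "has_caputo \<alpha> (\<lambda>s. w x0 s) ((t0 + T) / 2)"
        using w x0' unfolding diffusion_solution_def by metis
      then show "(\<lambda>s. w x0 s) differentiable at t0"
        using t0 by (simp add: has_caputo_def)
      show "w x0 s \<le> w x0 t0" if "0 \<le> s" "s \<le> t0" for s
        using max[of x0 s] that dom by simp
      show "w x0 0 < w x0 t0"
        using gt ln0 M(2)[of x0] x0 x01 by auto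
    qed
    ultimately show False by simp
  qed
  have cl: "closure ({0<..<1::real} \<times> {0<..<T}) = {0..1} \<times> {0..T}"
    using T by (simp add: closure_Times)
  have "(\<lambda>z. w (fst z) (snd z)) (x, t) \<le> M"
  proof (rule continuous_le_on_closure[of "{0<..<1} \<times> {0<..<T}"])
    show "continuous_on (closure ({0<..<1} \<times> {0<..<T})) (\<lambda>z. w (fst z) (snd z))"
      unfolding cl by (rule cont)
    show "(x, t) \<in> closure ({0<..<1} \<times> {0<..<T})"
      unfolding cl using xt by simp
  qed (use inner in auto)
  then show ?thesis by simp
qed

lemma diffusion_stability:
  assumes a: "0 < \<alpha>" "\<alpha> < 1" and T: "0 < T" and u: "diffusion_solution \<alpha> T u" and v: "diffusion_solution \<alpha> T v"
    and le: "\<And>x. x \<in> {0..1} \<Longrightarrow> \<bar>u x 0 - v x 0\<bar> \<le> e" and xt: "x \<in> {0..1}" "t \<in> {0..T}"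
  shows "\<bar>u x t - v x t\<bar> \<le> e"
proof -
  have e: "0 \<le> e" using le[of 0] by simp
  have "u x t - v x t \<le> e"
    by (rule diffusion_maximum_principle[OF a T diffusion_solution_diff[OF u v] e _ xt]) (use le in \<open>auto simp: abs_le_iff\<close>)
  moreover have "v x t - u x t \<le> e"
    by (rule diffusion_maximum_principle[OF a T diffusion_solution_diff[OF v u] e _ xt]) (use le in \<open>auto simp: abs_le_iff\<close>)
  ultimately show ?thesis by (simp add: abs_le_iff)
qed

section \<open>Series solutions\<close>

abbreviation relax :: "real \<Rightarrow> nat \<Rightarrow> real \<Rightarrow> real" where
  "relax \<alpha> k \<equiv> ml_relax \<alpha> ((zeroJ k)\<^sup>2)"

abbreviation diffusion_series :: "real \<Rightarrow> (nat \<Rightarrow> real) \<Rightarrow> real \<Rightarrow> real \<Rightarrow> real" where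
  "diffusion_series \<alpha> c x t \<equiv> (\<Sum>k. c k * relax \<alpha> k t * bfun k x)"

lemma deriv_series_Ioo:
  fixes f f' :: "nat \<Rightarrow> real \<Rightarrow> real"
  assumes f: "\<And>k x. a < x \<Longrightarrow> x < b \<Longrightarrow> (f k has_real_derivative f' k x) (at x)"
    and M: "\<And>k x. a < x \<Longrightarrow> x < b \<Longrightarrow> \<bar>f' k x\<bar> \<le> M k" "summable M"
    and s: "summable (\<lambda>k. f k x0)" and x0: "a < x0" "x0 < b" and x: "a < x" "x < b"
  shows "((\<lambda>x. \<Sum>k. f k x) has_real_derivative (\<Sum>k. f' k x)) (at x)"
proof (rule has_field_derivative_series'(2)[of "{a<..<b}" f f' x0])
  show "(f k has_real_derivative f' k x) (at x within {a<..<b})" if "x \<in> {a<..<b}" for k x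
    using f[of x k] that by (auto intro: has_field_derivative_at_within)
  show "uniformly_convergent_on {a<..<b} (\<lambda>n x. \<Sum>i<n. f' i x)"
    by (rule Weierstrass_m_test'[OF _ M(2)]) (use M(1) in auto)
qed (use s x0 x in auto)

lemma bessel_zero_sq_pos: "0 < (zeroJ k)\<^sup>2"
  using bessel_zero_Suc(1)[of k] by simp

lemma bessel_zero_ge_2: "2 \<le> zeroJ k"
  using bessel_zero_Suc[of k] by (intro besselJ_0_zero_ge_2) auto

context
  fixes \<alpha> :: real and c :: "nat \<Rightarrow> real"
  assumes a: "0 < \<alpha>" "\<alpha> < 1" and c: "summable (\<lambda>k. \<bar>c k\<bar>)"
begin

lemma relax_bounds:
  assumes "0 \<le> t" shows "0 < relax \<alpha> k t" "relax \<alpha> k t \<le> 1"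
  using ml_relax_pos[OF a bessel_zero_sq_pos assms] ml_relax_le_1[OF a bessel_zero_sq_pos assms] .

lemma relax_summable: "0 \<le> t \<Longrightarrow> summable (\<lambda>k. \<bar>c k * relax \<alpha> k t\<bar>)"
proof (rule summable_comparison_test[OF _ c], intro exI allI impI)
  fix k assume "0 \<le> t"
  then show "norm \<bar>c k * relax \<alpha> k t\<bar> \<le> \<bar>c k\<bar>"
    using relax_bounds[of t k] by (simp add: abs_mult mult_left_le)
qed

lemma diffusion_series_continuous:
  "continuous_on ({0..1} \<times> {0..T}) (\<lambda>(x, t). diffusion_series \<alpha> c x t)"
  unfolding case_prod_beta
proof (rule uniform_limit_theorem[OF _ Weierstrass_m_test[OF _ c]])
  show "\<forall>\<^sub>F n in sequentially. continuous_on ({0..1} \<times> {0..T})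
      (\<lambda>z. \<Sum>k<n. c k * relax \<alpha> k (snd z) * bfun k (fst z))"
  proof (intro always_eventually allI continuous_intros)
    fix k
    show "continuous_on ({0..1} \<times> {0..T}) (\<lambda>z. relax \<alpha> k (snd z))"
      by (rule continuous_on_compose2[OF ml_relax_continuous[OF a bessel_zero_sq_pos]])
        (auto intro!: continuous_intros)
  qed
  fix k and z :: "real \<times> real" assume z: "z \<in> {0..1} \<times> {0..T}"
  have "\<bar>c k\<bar> * (\<bar>relax \<alpha> k (snd z)\<bar> * \<bar>bfun k (fst z)\<bar>) \<le> \<bar>c k\<bar> * (1 * 1)"
    using relax_bounds[of "snd z" k] bfun_le_1[of "fst z" k] z by (intro mult_left_mono mult_mono) auto
  then show "norm (c k * relax \<alpha> k (snd z) * bfun k (fst z)) \<le> \<bar>c k\<bar>"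
    by (simp add: abs_mult)
qed simp

text \<open>\<open>ml_relax_upper\<close> bounds
  \<open>(zeroJ k)\<^sup>2 * relax \<alpha> k t\<close> uniformly in \<open>k\<close>; a positive
  time thus gains two powers of the zeros over \<open>c\<close>.\<close>

lemma relax_sq_summable:
  assumes t: "0 < t"
  shows "summable (\<lambda>k. \<bar>c k * relax \<alpha> k t\<bar> * (zeroJ k)\<^sup>2)"
proof -
  define C where "C = (2 powr \<alpha> + 2 * \<alpha> * Beta 1 (1 - \<alpha>)) * t powr (-\<alpha>) / Gamma (1 - \<alpha>)"
  have G: "Gamma (1 - \<alpha>) > 0" using a by (simp add: Gamma_real_pos)
  show ?thesis
  proof (rule summable_comparison_test[OF _ summable_mult2[OF c, of C]], intro exI allI impI)
    fix k
    have "Gamma (1 - \<alpha>) * ((zeroJ k)\<^sup>2 * relax \<alpha> k t)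
        \<le> (2 powr \<alpha> + 2 * \<alpha> * Beta 1 (1 - \<alpha>)) * t powr (-\<alpha>)"
      by (rule ml_relax_upper[OF a bessel_zero_sq_pos t])
    then have "(zeroJ k)\<^sup>2 * relax \<alpha> k t \<le> C"
      using G by (simp add: C_def pos_le_divide_eq mult.commute)
    then have "\<bar>c k\<bar> * ((zeroJ k)\<^sup>2 * relax \<alpha> k t) \<le> \<bar>c k\<bar> * C"
      by (rule mult_left_mono) simp
    then show "norm (\<bar>c k * relax \<alpha> k t\<bar> * (zeroJ k)\<^sup>2) \<le> \<bar>c k\<bar> * C"
      using relax_bounds(1)[of t k] t by (simp add: abs_mult mult_ac)
  qed
qed

text \<open>The sum may leave the Caputo integral because the L1 norms of the terms are summable,
  which is \<open>relax_sq_summable\<close> in disguise. Pointwise convergence of the derivatives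
  uses the bound \<open>\<alpha> / s\<close>, uniform in \<open>k\<close>.\<close>

lemma diffusion_series_caputo:
  assumes x: "0 \<le> x" and t: "0 < t"
  shows "has_caputo \<alpha> (\<lambda>s. diffusion_series \<alpha> c x s) t"
    and "caputo \<alpha> (\<lambda>s. diffusion_series \<alpha> c x s) t
      = (\<Sum>k. - (zeroJ k)\<^sup>2 * (c k * relax \<alpha> k t * bfun k x))"
proof -
  define e where "e = (\<lambda>k. c k * bfun k x)"
  have e: "\<bar>e k\<bar> \<le> \<bar>c k\<bar>" for k
    using bfun_le_1[OF x, of k] by (simp add: e_def abs_mult mult_left_le)
  have es: "summable (\<lambda>k. \<bar>e k\<bar>)"
    by (rule summable_comparison_test[OF _ c]) (use e in auto)
  note y = ml_relax_deriv[OF a bessel_zero_sq_pos]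
  have yb: "\<bar>deriv (relax \<alpha> k) s\<bar> \<le> \<alpha> / s" if "0 < s" for k s
    using y(2,3)[OF that, of k] by simp
  define f where "f = (\<lambda>k s. e k * (deriv (relax \<alpha> k) s / (t - s) powr \<alpha>))"
  note yc = ml_relax_caputo[OF a bessel_zero_sq_pos t]
  have G: "Gamma (1 - \<alpha>) > 0" using a by (simp add: Gamma_real_pos)
  have I: "integral {0<..<t} (\<lambda>s. deriv (relax \<alpha> k) s / (t - s) powr \<alpha>)
      = - Gamma (1 - \<alpha>) * (zeroJ k)\<^sup>2 * relax \<alpha> k t" for k
    using yc(2)[of k] G unfolding caputo_eq_Ioo by (simp add: field_simps)
  have 1: "f k absolutely_integrable_on {0<..<t}" for k
    unfolding f_def by (intro set_integrable_mult_right has_caputoD(2) yc)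
  have 2: "summable (\<lambda>k. \<bar>f k s\<bar>)" if s: "s \<in> {0<..<t}" for s
  proof (rule summable_comparison_test[OF _ summable_mult2[OF es, of "\<alpha> / s / (t - s) powr \<alpha>"]], intro exI allI impI)
    fix k
    have "\<bar>e k\<bar> * (\<bar>deriv (relax \<alpha> k) s\<bar> / (t - s) powr \<alpha>) \<le> \<bar>e k\<bar> * (\<alpha> / s / (t - s) powr \<alpha>)"
      using yb[of s k] s by (intro mult_left_mono divide_right_mono) auto
    then show "norm \<bar>f k s\<bar> \<le> \<bar>e k\<bar> * (\<alpha> / s / (t - s) powr \<alpha>)"
      by (simp add: f_def abs_mult)
  qed
  have 3: "summable (\<lambda>k. integral {0<..<t} (\<lambda>s. \<bar>f k s\<bar>))"
  proof (rule summable_comparison_test[OF _ summable_mult[OF relax_sq_summable[OF t], of "Gamma (1 - \<alpha>)"]], intro exI allI impI)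
    fix k
    \<comment> \<open>Each relaxation function decreases, so its L1 norm against the kernel is the
      Caputo integral up to sign, and that is known exactly.\<close>
    have "integral {0<..<t} (\<lambda>s. \<bar>f k s\<bar>) = integral {0<..<t} (\<lambda>s. - \<bar>e k\<bar> * (deriv (relax \<alpha> k) s / (t - s) powr \<alpha>))"
    proof (rule hk_integral_cong)
      fix s assume "s \<in> {0<..<t}"
      then show "\<bar>f k s\<bar> = - \<bar>e k\<bar> * (deriv (relax \<alpha> k) s / (t - s) powr \<alpha>)"
        using y(2)[of s k] by (simp add: f_def abs_mult abs_of_nonpos)
    qed
    also have "\<dots> = - \<bar>e k\<bar> * (- Gamma (1 - \<alpha>) * (zeroJ k)\<^sup>2 * relax \<alpha> k t)"
      unfolding hk_integral_mult_right I ..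
    also have "\<dots> = \<bar>e k\<bar> * (Gamma (1 - \<alpha>) * (zeroJ k)\<^sup>2 * relax \<alpha> k t)"
      by simp
    also have "\<dots> \<le> \<bar>c k\<bar> * (Gamma (1 - \<alpha>) * (zeroJ k)\<^sup>2 * relax \<alpha> k t)"
      using G relax_bounds(1)[of t k] t by (intro mult_right_mono e) auto
    finally have "integral {0<..<t} (\<lambda>s. \<bar>f k s\<bar>) \<le> Gamma (1 - \<alpha>) * (\<bar>c k * relax \<alpha> k t\<bar> * (zeroJ k)\<^sup>2)"
      using relax_bounds(1)[of t k] t by (simp add: abs_mult mult_ac)
    moreover have "0 \<le> integral {0<..<t} (\<lambda>s. \<bar>f k s\<bar>)"
      by (intro hk_integral_nonneg set_lebesgue_integral_eq_integral(1)
          absolutely_integrable_norm[OF 1, unfolded o_def real_norm_def]) auto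
    ultimately show "norm (integral {0<..<t} (\<lambda>s. \<bar>f k s\<bar>))
        \<le> Gamma (1 - \<alpha>) * (\<bar>c k * relax \<alpha> k t\<bar> * (zeroJ k)\<^sup>2)"
      by simp
  qed
  have S: "{0<..<t} \<in> sets lebesgue" by simp
  note swap = sums_integral_absolutely_integrable[OF S 1 2 3]
  have ser: "(\<lambda>s. diffusion_series \<alpha> c x s) = (\<lambda>s. \<Sum>k. e k * relax \<alpha> k s)"
    by (simp add: e_def mult_ac)
  have D: "((\<lambda>s. diffusion_series \<alpha> c x s) has_real_derivative (\<Sum>k. e k * deriv (relax \<alpha> k) s)) (at s)"
    if s: "0 < s" "s < t" for s
    unfolding ser
  \<comment> \<open>The left end \<open>s / 2\<close> stays away from \<open>0\<close>, where the
    bound \<open>\<alpha> / r\<close> on the derivatives blows up.\<close>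
  proof (rule deriv_series_Ioo[of "s / 2" t])
    show "((\<lambda>s. e k * relax \<alpha> k s) has_real_derivative e k * deriv (relax \<alpha> k) r) (at r)" if "s / 2 < r" "r < t" for k r
      using that s by (intro DERIV_cmult y(1)) auto
    show "\<bar>e k * deriv (relax \<alpha> k) r\<bar> \<le> \<bar>e k\<bar> * (\<alpha> / (s / 2))" if "s / 2 < r" "r < t" for k r
    proof -
      have "\<bar>deriv (relax \<alpha> k) r\<bar> \<le> \<alpha> / r" using that s by (intro yb) auto
      also have "\<dots> \<le> \<alpha> / (s / 2)" using that s a by (intro divide_left_mono) auto
      finally show ?thesis unfolding abs_mult by (rule mult_left_mono) simp
    qed
    show "summable (\<lambda>k. \<bar>e k\<bar> * (\<alpha> / (s / 2)))" by (rule summable_mult2[OF es])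
    show "summable (\<lambda>k. e k * relax \<alpha> k s)"
    proof (rule summable_comparison_test[OF _ es], intro exI allI impI)
      fix k show "norm (e k * relax \<alpha> k s) \<le> \<bar>e k\<bar>"
        using relax_bounds[of s k] s by (simp add: abs_mult mult_left_le)
    qed
  qed (use s in auto)
  have eq: "(\<Sum>k. e k * deriv (relax \<alpha> k) s) / (t - s) powr \<alpha> = (\<Sum>k. f k s)" if s: "s \<in> {0<..<t}" for s
  proof -
    have "summable (\<lambda>k. e k * deriv (relax \<alpha> k) s)"
    proof (rule summable_comparison_test[OF _ summable_mult2[OF es, of "\<alpha> / s"]], intro exI allI impI)
      fix k show "norm (e k * deriv (relax \<alpha> k) s) \<le> \<bar>e k\<bar> * (\<alpha> / s)"
        using yb[of s k] s by (simp only: real_norm_def abs_mult) (intro mult_left_mono, auto)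
    qed
    then show ?thesis by (simp add: f_def suminf_divide[symmetric])
  qed
  have AI: "(\<lambda>s. (\<Sum>k. e k * deriv (relax \<alpha> k) s) / (t - s) powr \<alpha>) absolutely_integrable_on {0<..<t}"
  proof (rule absolutely_integrable_spike[OF swap(1) negligible_empty])
    fix s assume "s \<in> {0<..<t} - {}"
    then show "(\<Sum>k. e k * deriv (relax \<alpha> k) s) / (t - s) powr \<alpha> = (\<Sum>k. f k s)"
      by (intro eq) simp
  qed
  show "has_caputo \<alpha> (\<lambda>s. diffusion_series \<alpha> c x s) t"
    by (rule has_caputoI(1)[OF t D AI])
  have sm: "summable (\<lambda>k. (zeroJ k)\<^sup>2 * (c k * relax \<alpha> k t * bfun k x))"
  proof (rule summable_comparison_test[OF _ relax_sq_summable[OF t]], intro exI allI impI)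
    fix k
    have "\<bar>c k * relax \<alpha> k t\<bar> * (zeroJ k)\<^sup>2 * \<bar>bfun k x\<bar> \<le> \<bar>c k * relax \<alpha> k t\<bar> * (zeroJ k)\<^sup>2 * 1"
      using bfun_le_1[OF x, of k] by (intro mult_left_mono) auto
    then show "norm ((zeroJ k)\<^sup>2 * (c k * relax \<alpha> k t * bfun k x)) \<le> \<bar>c k * relax \<alpha> k t\<bar> * (zeroJ k)\<^sup>2"
      by (simp add: abs_mult mult_ac)
  qed
  note has_caputoI(2)[OF t D AI]
  also note hk_integral_cong[OF eq]
  also have "integral {0<..<t} (\<lambda>s. \<Sum>k. f k s)
      = (\<Sum>k. - Gamma (1 - \<alpha>) * ((zeroJ k)\<^sup>2 * (c k * relax \<alpha> k t * bfun k x)))"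
  proof -
    have "integral {0<..<t} (f k) = - Gamma (1 - \<alpha>) * ((zeroJ k)\<^sup>2 * (c k * relax \<alpha> k t * bfun k x))" for k
      unfolding f_def hk_integral_mult_right I by (simp add: e_def mult_ac)
    then show ?thesis using sums_unique[OF swap(2)] by (simp only:)
  qed
  also have "\<dots> = - Gamma (1 - \<alpha>) * (\<Sum>k. (zeroJ k)\<^sup>2 * (c k * relax \<alpha> k t * bfun k x))"
    by (rule suminf_mult[OF sm])
  finally have "caputo \<alpha> (\<lambda>s. diffusion_series \<alpha> c x s) t
      = - (\<Sum>k. (zeroJ k)\<^sup>2 * (c k * relax \<alpha> k t * bfun k x))"
    using G by simp
  then show "caputo \<alpha> (\<lambda>s. diffusion_series \<alpha> c x s) t
      = (\<Sum>k. - (zeroJ k)\<^sup>2 * (c k * relax \<alpha> k t * bfun k x))"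
    by (simp only: mult_minus_left suminf_minus[OF sm])
qed

text \<open>Two termwise derivatives cost \<open>(zeroJ k)\<^sup>2\<close>, and
  \<open>J\<^sub>1 z / z\<close> is bounded by \<open>1 / 2\<close>; the first derivative is cheaper
  because all zeros are at least \<open>2\<close>. The uniform bound \<open>P\<close> gives the
  limit condition at \<open>x = 0\<close>.\<close>

lemma diffusion_series_space:
  assumes t: "0 < t"
  obtains p q P where
    "\<And>x. 0 < x \<Longrightarrow> x < 1 \<Longrightarrow> ((\<lambda>x. diffusion_series \<alpha> c x t) has_real_derivative p x) (at x)"
    "\<And>x. 0 < x \<Longrightarrow> x < 1 \<Longrightarrow> (p has_real_derivative q x) (at x)"
    "\<And>x. 0 < x \<Longrightarrow> x < 1 \<Longrightarrow>
      q x + p x / x = (\<Sum>k. - (zeroJ k)\<^sup>2 * (c k * relax \<alpha> k t * bfun k x))"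
    "\<And>x. 0 < x \<Longrightarrow> x < 1 \<Longrightarrow> \<bar>p x\<bar> \<le> P"
proof -
  define d where "d = (\<lambda>k. c k * relax \<alpha> k t)"
  define l where "l = (\<lambda>k. zeroJ k)"
  have l2: "2 \<le> l k" for k unfolding l_def by (rule bessel_zero_ge_2)
  have l0: "0 < l k" for k using l2[of k] by linarith
  have s2: "summable (\<lambda>k. \<bar>d k\<bar> * (l k)\<^sup>2)"
    unfolding d_def l_def by (rule relax_sq_summable[OF t])
  have dl: "\<bar>d k\<bar> * l k \<le> \<bar>d k\<bar> * (l k)\<^sup>2" for k
    using l2[of k] by (intro mult_left_mono) (simp_all add: power2_eq_square)
  have s1: "summable (\<lambda>k. \<bar>d k\<bar> * l k)"
    by (rule summable_comparison_test[OF _ s2]) (use dl l0 in \<open>auto simp: abs_mult less_imp_le\<close>)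
  have s0: "summable (\<lambda>k. \<bar>d k\<bar>)" unfolding d_def using relax_summable t by simp
  define p where "p = (\<lambda>x. \<Sum>k. - (d k * l k) * besselJ1 (l k * x))"
  define q' where "q' = (\<lambda>k x. - (d k * l k) * ((besselJ 0 (l k * x) - besselJ1 (l k * x) / (l k * x)) * l k))"
  have J0: "\<bar>besselJ 0 (l k * x)\<bar> \<le> 1" and J1: "\<bar>besselJ1 (l k * x)\<bar> \<le> 1"
    and J1x: "\<bar>besselJ1 (l k * x) / (l k * x)\<bar> \<le> 1 / 2" if "0 < x" for k x
  proof -
    have lx: "0 < l k * x" using l0[of k] that by simp
    then show "\<bar>besselJ 0 (l k * x)\<bar> \<le> 1" "\<bar>besselJ1 (l k * x)\<bar> \<le> 1"
      by (intro abs_besselJ_0_le abs_besselJ_1_le; simp)+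
    show "\<bar>besselJ1 (l k * x) / (l k * x)\<bar> \<le> 1 / 2"
      using abs_besselJ_1_le_half[of "l k * x"] lx unfolding abs_divide by (simp add: divide_le_eq)
  qed
  have b1: "\<bar>- (d k * l k) * besselJ1 (l k * x)\<bar> \<le> \<bar>d k\<bar> * l k" if "0 < x" for k x
  proof -
    have "\<bar>d k\<bar> * l k * \<bar>besselJ1 (l k * x)\<bar> \<le> \<bar>d k\<bar> * l k * 1"
      using J1[OF that, of k] l0[of k] by (intro mult_left_mono) auto
    then show ?thesis using l0[of k] by (simp add: abs_mult)
  qed
  have b2: "\<bar>q' k x\<bar> \<le> \<bar>d k\<bar> * (l k)\<^sup>2 * 2" if "0 < x" for k x
  proof -
    have "\<bar>besselJ 0 (l k * x) - besselJ1 (l k * x) / (l k * x)\<bar> \<le> 2"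
      using J0[OF that, of k] J1x[OF that, of k] by linarith
    then have "(\<bar>d k\<bar> * (l k)\<^sup>2) * \<bar>besselJ 0 (l k * x) - besselJ1 (l k * x) / (l k * x)\<bar> \<le> \<bar>d k\<bar> * (l k)\<^sup>2 * 2"
      by (rule mult_left_mono) simp
    then show ?thesis using l0[of k] by (simp add: q'_def abs_mult power2_eq_square mult_ac)
  qed
  have sp: "summable (\<lambda>k. - (d k * l k) * besselJ1 (l k * x))" if "0 < x" for x
    by (rule summable_comparison_test[OF _ s1]) (use b1[OF that] in auto)
  have sq: "summable (\<lambda>k. q' k x)" if "0 < x" for x
    by (rule summable_comparison_test[OF _ summable_mult2[OF s2, of 2]]) (use b2[OF that] in auto)
  show ?thesis
  proof (rule that)
    fix x :: real assume x: "0 < x" "x < 1"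
    show "((\<lambda>x. diffusion_series \<alpha> c x t) has_real_derivative p x) (at x)"
      unfolding p_def
    proof (rule deriv_series_Ioo[where a = 0 and b = 1 and M = "\<lambda>k. \<bar>d k\<bar> * l k" and ?x0.0 = x])
      show "((\<lambda>x. c k * relax \<alpha> k t * bfun k x) has_real_derivative - (d k * l k) * besselJ1 (l k * x)) (at x)" for k x
      proof -
        have "((\<lambda>x. besselJ 0 (l k * x)) has_real_derivative (- besselJ1 (l k * x)) * l k) (at x)"
          by (rule DERIV_chain2[OF has_derivative_besselJ_0]) (auto intro!: derivative_eq_intros)
        from DERIV_cmult[OF this, of "d k"] show ?thesis by (simp add: d_def l_def mult_ac)
      qed
      show "summable (\<lambda>k. c k * relax \<alpha> k t * bfun k x)"
      proof (rule summable_comparison_test[OF _ s0], intro exI allI impI)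
        fix k show "norm (c k * relax \<alpha> k t * bfun k x) \<le> \<bar>d k\<bar>"
          using bfun_le_1[of x k] x by (simp add: d_def abs_mult mult_left_le)
      qed
    qed (use x s1 b1 in auto)
    show "(p has_real_derivative (\<Sum>k. q' k x)) (at x)"
      unfolding p_def
    proof (rule deriv_series_Ioo[where a = 0 and b = 1 and M = "\<lambda>k. \<bar>d k\<bar> * (l k)\<^sup>2 * 2" and ?x0.0 = x])
      show "((\<lambda>x. - (d k * l k) * besselJ1 (l k * x)) has_real_derivative q' k x) (at x)" if "0 < x" for k x
      proof -
        have "((\<lambda>x. besselJ1 (l k * x)) has_real_derivative
            (besselJ 0 (l k * x) - besselJ1 (l k * x) / (l k * x)) * l k) (at x)"
          by (rule DERIV_chain2[OF has_derivative_besselJ_1]) (use l0[of k] that in \<open>auto intro!: derivative_eq_intros\<close>)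
        from DERIV_cmult[OF this] show ?thesis unfolding q'_def .
      qed
      show "summable (\<lambda>k. \<bar>d k\<bar> * (l k)\<^sup>2 * 2)" by (rule summable_mult2[OF s2])
      show "summable (\<lambda>k. - (d k * l k) * besselJ1 (l k * x))" by (rule sp[OF x(1)])
    qed (use x b2 in auto)
    have "p x / x = (\<Sum>k. - (d k * l k) * besselJ1 (l k * x) / x)"
      unfolding p_def by (rule suminf_divide[symmetric, OF sp[OF x(1)]])
    then have "(\<Sum>k. q' k x) + p x / x = (\<Sum>k. q' k x + - (d k * l k) * besselJ1 (l k * x) / x)"
      by (simp only: suminf_add[OF sq[OF x(1)] summable_divide[OF sp[OF x(1)], of x]])
    also have "\<dots> = (\<Sum>k. - (zeroJ k)\<^sup>2 * (c k * relax \<alpha> k t * bfun k x))"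
    proof (intro arg_cong[where f = suminf] ext)
      fix k
      have "l k \<noteq> 0" using l0[of k] by simp
      then have h: "(besselJ 0 (l k * x) - besselJ1 (l k * x) / (l k * x)) * l k = besselJ 0 (l k * x) * l k - besselJ1 (l k * x) / x"
        using x by (simp add: left_diff_distrib)
      show "q' k x + - (d k * l k) * besselJ1 (l k * x) / x
          = - (zeroJ k)\<^sup>2 * (c k * relax \<alpha> k t * bfun k x)"
        unfolding q'_def h by (simp add: d_def l_def power2_eq_square algebra_simps)
    qed
    finally show "(\<Sum>k. q' k x) + p x / x = (\<Sum>k. - (zeroJ k)\<^sup>2 * (c k * relax \<alpha> k t * bfun k x))" .
    have "norm (p x) \<le> (\<Sum>k. norm (- (d k * l k) * besselJ1 (l k * x)))"
      unfolding p_def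
      by (intro summable_norm summable_comparison_test[OF _ s1]) (use b1[OF x(1)] in auto)
    also have "\<dots> \<le> (\<Sum>k. \<bar>d k\<bar> * l k)"
      by (intro suminf_le s1 summable_comparison_test[OF _ s1]) (use b1[OF x(1)] in auto)
    finally show "\<bar>p x\<bar> \<le> (\<Sum>k. \<bar>d k\<bar> * l k)" by simp
  qed
qed

lemma diffusion_series_boundary: "diffusion_series \<alpha> c 1 t = 0"
  using bessel_zero_Suc(2) by simp

lemma diffusion_series_solution: "diffusion_solution \<alpha> T (diffusion_series \<alpha> c)"
  unfolding diffusion_solution_def
proof (intro conjI ballI)
  show "continuous_on ({0..1} \<times> {0..T}) (\<lambda>(x, t). diffusion_series \<alpha> c x t)"
    by (rule diffusion_series_continuous)
  fix t assume "t \<in> {0<..<T}"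
  then have t: "0 < t" by simp
  show "diffusion_series \<alpha> c 1 t = 0" by (rule diffusion_series_boundary)
  obtain p q P where pq:
    "\<And>x. 0 < x \<Longrightarrow> x < 1 \<Longrightarrow> ((\<lambda>x. diffusion_series \<alpha> c x t) has_real_derivative p x) (at x)"
    "\<And>x. 0 < x \<Longrightarrow> x < 1 \<Longrightarrow> (p has_real_derivative q x) (at x)"
    "\<And>x. 0 < x \<Longrightarrow> x < 1 \<Longrightarrow>
      q x + p x / x = (\<Sum>k. - (zeroJ k)\<^sup>2 * (c k * relax \<alpha> k t * bfun k x))"
    "\<And>x. 0 < x \<Longrightarrow> x < 1 \<Longrightarrow> \<bar>p x\<bar> \<le> P"
    by (rule diffusion_series_space[OF t], rule that)
  show "\<exists>p q. \<forall>x\<in>{0<..<1}. ((\<lambda>y. diffusion_series \<alpha> c y t) has_real_derivative p x) (at x) \<and>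
      (p has_real_derivative q x) (at x) \<and> has_caputo \<alpha> (\<lambda>s. diffusion_series \<alpha> c x s) t \<and>
      caputo \<alpha> (\<lambda>s. diffusion_series \<alpha> c x s) t = q x + p x / x"
  proof (intro exI ballI conjI)
    fix x :: real assume "x \<in> {0<..<1}"
    then have x: "0 < x" "x < 1" by auto
    then have x0: "0 \<le> x" by simp
    show "((\<lambda>y. diffusion_series \<alpha> c y t) has_real_derivative p x) (at x)" by (rule pq(1)[OF x])
    show "(p has_real_derivative q x) (at x)" by (rule pq(2)[OF x])
    show "has_caputo \<alpha> (\<lambda>s. diffusion_series \<alpha> c x s) t" by (rule diffusion_series_caputo(1)[OF x0 t])
    show "caputo \<alpha> (\<lambda>s. diffusion_series \<alpha> c x s) t = q x + p x / x"
      unfolding diffusion_series_caputo(2)[OF x0 t] pq(3)[OF x] ..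
  qed
qed

end

section \<open>The inverse problem\<close>

context
  fixes f f1 f2 f3 f4 :: "real \<Rightarrow> real"
  assumes D: "\<And>x. x \<in> {0..1} \<Longrightarrow> (f has_real_derivative f1 x) (at x within {0..1})"
      "\<And>x. x \<in> {0..1} \<Longrightarrow> (f1 has_real_derivative f2 x) (at x within {0..1})"
      "\<And>x. x \<in> {0..1} \<Longrightarrow> (f2 has_real_derivative f3 x) (at x within {0..1})"
      "\<And>x. x \<in> {0..1} \<Longrightarrow> (f3 has_real_derivative f4 x) (at x within {0..1})"
    and z0: "f1 0 = 0" "f2 0 = 0" "f3 0 = 0"
    and z1: "f 1 = 0" "f1 1 = 0" "f2 1 = 0"
    and bd: "bounded (f4 ` {0..1})"
begin

private lemma cont: "cont01 f" "cont01 f1" "cont01 f2" "cont01 f3"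
  by (rule DERIV_continuous_on, rule D, assumption)+

private lemma Dat: "0 < x \<Longrightarrow> x < 1 \<Longrightarrow> (f has_real_derivative f1 x) (at x)"
    "0 < x \<Longrightarrow> x < 1 \<Longrightarrow> (f1 has_real_derivative f2 x) (at x)"
    "0 < x \<Longrightarrow> x < 1 \<Longrightarrow> (f2 has_real_derivative f3 x) (at x)"
    "0 < x \<Longrightarrow> x < 1 \<Longrightarrow> (f3 has_real_derivative f4 x) (at x)"
  using D[of x] by (simp_all add: at_within_Icc_at)

text \<open>The mean value theorem at each \<open>x\<close>. Iterated from the bound on
  \<open>f4\<close>, it gives \<open>f3\<close>, \<open>f2\<close>, \<open>f1\<close> of orders
  \<open>x\<close>, \<open>x\<^sup>2\<close>, \<open>x\<^sup>3\<close>, just enough for the singular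
  quotients of \<open>laplacian_2\<close>.\<close>

private lemma growth:
  assumes g: "\<And>x. 0 < x \<Longrightarrow> x < 1 \<Longrightarrow> (g has_real_derivative g' x) (at x)" "cont01 g" "g 0 = 0"
    and b: "\<And>x. 0 < x \<Longrightarrow> x < 1 \<Longrightarrow> \<bar>g' x\<bar> \<le> B * x ^ n" and x: "0 < x" "x < 1"
  shows "\<bar>g x\<bar> \<le> B * x ^ Suc n"
proof -
  have "\<exists>l z. 0 < z \<and> z < x \<and> (g has_real_derivative l) (at z) \<and> g x - g 0 = (x - 0) * l"
  proof (rule MVT[OF x(1)])
    show "continuous_on {0..x} g" by (rule continuous_on_subset[OF g(2)]) (use x in auto)
    show "g differentiable (at y)" if "0 < y" "y < x" for y
      using g(1)[of y] that x real_differentiable_def by auto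
  qed
  then obtain l z where z: "0 < z" "z < x" and l: "(g has_real_derivative l) (at z)"
    and eq: "g x - g 0 = (x - 0) * l" by blast
  have lz: "l = g' z" by (rule DERIV_unique[OF l g(1)]) (use z x in auto)
  have "0 \<le> B * x ^ n" by (rule order_trans[OF abs_ge_zero b[OF x]])
  then have B: "0 \<le> B"
    using mult_neg_pos[of B "x ^ n"] x by (meson not_less zero_less_power)
  have "\<bar>g' z\<bar> \<le> B * z ^ n" using b[of z] z x by simp
  also have "\<dots> \<le> B * x ^ n" using z B by (intro mult_left_mono power_mono) auto
  finally have "x * \<bar>g' z\<bar> \<le> x * (B * x ^ n)" using x by (intro mult_left_mono) auto
  then show ?thesis using eq lz g(3) x by (simp add: abs_mult mult_ac)
qed

text \<open>At \<open>0\<close> the quotient has the default value \<open>0\<close>, which equals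
  its limit, the derivative of \<open>g\<close>.\<close>

private lemma quotient_cont:
  assumes g: "cont01 g" and d: "(g has_real_derivative 0) (at 0 within {0..1})" and g0: "g 0 = 0"
  shows "cont01 (\<lambda>x. g x / x)"
proof -
  have "((\<lambda>x. g x / x) \<longlongrightarrow> g x / x) (at x within {0..1})" if x: "x \<in> {0..1}" for x
  proof (cases "x = 0")
    case True
    then show ?thesis using d g0 by (simp add: has_field_derivative_iff)
  next
    case False
    then show ?thesis using g x by (intro tendsto_intros) (auto simp: continuous_on_def)
  qed
  then show ?thesis by (simp add: continuous_on_def)
qed

private lemma laplacian_1: "radial_laplacian f f1 (\<lambda>x. f2 x + f1 x / x)"
  unfolding radial_laplacian_def
proof (intro conjI ballI)
  fix x :: real assume "x \<in> {0<..<1}"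
  then have x: "0 < x" "x < 1" by auto
  show "(f has_real_derivative f1 x) (at x)" by (rule Dat[OF x])
  have "((\<lambda>x. x * f1 x) has_real_derivative 1 * f1 x + f2 x * x) (at x)"
    by (intro DERIV_mult DERIV_ident Dat x)
  then show "((\<lambda>x. x * f1 x) has_real_derivative x * (f2 x + f1 x / x)) (at x)"
    by (rule DERIV_cong) (use x in \<open>simp add: field_simps\<close>)
qed (auto intro!: continuous_intros cont z1)

text \<open>The Laplacian of \<open>f\<close> is again in the domain of the operator:
  \<open>f1 1 = f2 1 = 0\<close> is its Dirichlet condition, and the vanishing at \<open>0\<close>
  makes it continuous there. The last function is the radial bi-Laplacian of
  \<open>f\<close>.\<close>

private lemma laplacian_2:
  "radial_laplacian (\<lambda>x. f2 x + f1 x / x) (\<lambda>x. f3 x + (f2 x - f1 x / x) / x)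
    (\<lambda>x. f4 x + 2 * f3 x / x - f2 x / x\<^sup>2 + f1 x / x ^ 3)"
  unfolding radial_laplacian_def
proof (intro conjI ballI)
  have q: "cont01 (\<lambda>x. f1 x / x)"
    using D(2)[of 0] z0 by (intro quotient_cont cont) auto
  then show "cont01 (\<lambda>x. f2 x + f1 x / x)"
    by (intro continuous_on_add cont)
  show "f2 1 + f1 1 / 1 = 0" using z1 by simp
  have "cont01 (\<lambda>x. x * f3 x + (f2 x - f1 x / x))"
    by (intro continuous_on_add continuous_on_diff continuous_on_mult continuous_on_id q cont)
  moreover have "x * f3 x + (f2 x - f1 x / x) = x * (f3 x + (f2 x - f1 x / x) / x)" for x
    using z0 by (cases "x = 0") (auto simp: distrib_left)
  ultimately show "cont01 (\<lambda>x. x * (f3 x + (f2 x - f1 x / x) / x))"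
    by simp
  fix x :: real assume "x \<in> {0<..<1}"
  then have x: "0 < x" "x < 1" and x0: "x \<noteq> 0" by auto
  have q': "((\<lambda>x. f1 x / x) has_real_derivative (f2 x * x - f1 x * 1) / (x * x)) (at x)"
    by (intro DERIV_divide Dat x DERIV_ident x0)
  show "((\<lambda>x. f2 x + f1 x / x) has_real_derivative f3 x + (f2 x - f1 x / x) / x) (at x)"
    by (rule DERIV_cong[OF DERIV_add[OF Dat(3)[OF x] q']]) (use x0 in \<open>simp add: field_simps\<close>)
  have "((\<lambda>x. x * f3 x + (f2 x - f1 x / x)) has_real_derivative
      (1 * f3 x + f4 x * x) + (f3 x - (f2 x * x - f1 x * 1) / (x * x))) (at x)"
    by (intro DERIV_add DERIV_diff DERIV_mult DERIV_ident q' Dat x)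
  then have "((\<lambda>x. x * (f3 x + (f2 x - f1 x / x) / x)) has_real_derivative
      (1 * f3 x + f4 x * x) + (f3 x - (f2 x * x - f1 x * 1) / (x * x))) (at x)"
    by (rule has_field_derivative_transform_within_open[of _ _ _ "{0<..<1}"])
      (use x in \<open>auto simp: distrib_left\<close>)
  then show "((\<lambda>x. x * (f3 x + (f2 x - f1 x / x) / x)) has_real_derivative
      x * (f4 x + 2 * f3 x / x - f2 x / x\<^sup>2 + f1 x / x ^ 3)) (at x)"
    by (rule DERIV_cong) (use x0 in \<open>simp add: field_simps power2_eq_square power3_eq_cube\<close>)
qed

text \<open>\<open>laplacian_1\<close> absorbs the factor \<open>(zeroJ n)\<^sup>2\<close> into a
  coefficient of the Laplacian, which \<open>laplacian_2\<close> bounds. The factor stays on the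
  left because division by \<open>relax \<alpha> n T\<close> consumes it.\<close>

lemma fb_coeff_decay:
  obtains K where "\<And>n. \<bar>fb_coeff f (Suc n)\<bar> * (zeroJ n)\<^sup>2 \<le> K * zeroJ n powr (-3/2)"
proof -
  obtain B where "\<forall>y\<in>f4 ` {0..1}. norm y \<le> B" using bd unfolding bounded_iff by blast
  then have b4: "\<bar>f4 x\<bar> \<le> B * x ^ 0" if "0 < x" "x < 1" for x using that by auto
  have b3: "\<bar>f3 x\<bar> \<le> B * x ^ Suc 0" if "0 < x" "x < 1" for x
    by (rule growth[OF Dat(4) cont(4) z0(3) b4 that])
  have b2: "\<bar>f2 x\<bar> \<le> B * x ^ Suc (Suc 0)" if "0 < x" "x < 1" for x
    by (rule growth[OF Dat(3) cont(3) z0(2) b3 that])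
  have b1: "\<bar>f1 x\<bar> \<le> B * x ^ Suc (Suc (Suc 0))" if "0 < x" "x < 1" for x
    by (rule growth[OF Dat(2) cont(2) z0(1) b2 that])
  \<comment> \<open>Each quotient by a power of \<open>x\<close> is at most \<open>B\<close>; the
    weights \<open>1 + 2 + 1 + 1\<close> give \<open>5\<close>.\<close>
  have k: "\<bar>f4 x + 2 * f3 x / x - f2 x / x\<^sup>2 + f1 x / x ^ 3\<bar> \<le> 5 * B" if x: "0 < x" "x < 1" for x
  proof -
    have "\<bar>f3 x / x\<bar> \<le> B" using b3[OF x] x by (simp add: abs_divide divide_le_eq)
    moreover have "\<bar>f2 x / x\<^sup>2\<bar> \<le> B" using b2[OF x] x by (simp add: abs_divide divide_le_eq power2_eq_square)
    moreover have "\<bar>f1 x / x ^ 3\<bar> \<le> B" using b1[OF x] x by (simp add: abs_divide divide_le_eq power3_eq_cube)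
    moreover have "\<bar>f4 x\<bar> \<le> B" using b4[OF x] by simp
    moreover have "2 * f3 x / x = 2 * (f3 x / x)" by simp
    ultimately show ?thesis by linarith
  qed
  show ?thesis
  proof (rule that)
    fix n
    have "\<bar>fb_coeff f (Suc n)\<bar> * (zeroJ n)\<^sup>2 = \<bar>fb_coeff (\<lambda>x. f2 x + f1 x / x) (Suc n)\<bar>"
      unfolding fb_coeff_laplacian[OF laplacian_1] using bessel_zero_Suc(1)[of n] by simp
    also have "\<dots> \<le> 4 / 3 * (5 * B) * zeroJ n powr (-3/2)"
      by (rule fb_coeff_laplacian_bound[OF laplacian_2 k])
    finally show "\<bar>fb_coeff f (Suc n)\<bar> * (zeroJ n)\<^sup>2 \<le> 4 / 3 * (5 * B) * zeroJ n powr (-3/2)" .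
  qed
qed

end

text \<open>\<open>ml_relax_lower\<close> bounds \<open>1 / relax \<alpha> n T\<close> by
  \<open>1 + G * l\<close>, hence by \<open>(1 + G) * l\<close> as
  \<open>l = (zeroJ n)\<^sup>2 \<ge> 1\<close>; this is the factor that \<open>K\<close> allows
  for.\<close>

lemma inverse_coeff_summable:
  assumes a: "0 < \<alpha>" "\<alpha> < 1" and T: "0 < T"
    and K: "\<And>n. \<bar>\<phi> n\<bar> * (zeroJ n)\<^sup>2 \<le> K * zeroJ n powr (-3/2)"
  shows "summable (\<lambda>n. \<bar>\<phi> n / relax \<alpha> n T\<bar>)"
proof -
  define G where "G = Gamma (1 - \<alpha>) * T powr \<alpha>"
  have G: "G > 0" using a T by (simp add: G_def Gamma_real_pos)
  show ?thesis
  proof (rule summable_comparison_test[OF _ summable_mult[OF summable_bessel_zero, of "(1 + G) * K"]], intro exI allI impI)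
    fix n
    define l where "l = (zeroJ n)\<^sup>2"
    have l: "l > 0" unfolding l_def using bessel_zero_Suc(1)[of n] by simp
    have "2 * 2 \<le> l"
      unfolding l_def power2_eq_square using besselJ_0_zero_ge_2[of "zeroJ n"] bessel_zero_Suc[of n]
      by (intro mult_mono) auto
    then have l1: "1 \<le> l" by simp
    have y: "0 < relax \<alpha> n T" unfolding l_def[symmetric] by (rule ml_relax_pos[OF a l]) (use T in simp)
    have "1 \<le> relax \<alpha> n T * (1 + G * l)"
      using ml_relax_lower[OF a l T] by (simp add: l_def G_def mult_ac)
    also have "\<dots> \<le> relax \<alpha> n T * ((1 + G) * l)"
      using y l1 by (intro mult_left_mono) (auto simp: distrib_right)
    finally have "1 / relax \<alpha> n T \<le> (1 + G) * l" using y by (simp add: divide_le_eq mult.commute)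
    then have "\<bar>\<phi> n\<bar> * (1 / relax \<alpha> n T) \<le> \<bar>\<phi> n\<bar> * ((1 + G) * l)"
      by (rule mult_left_mono) simp
    also have "\<dots> = (1 + G) * (\<bar>\<phi> n\<bar> * l)" by simp
    also have "\<dots> \<le> (1 + G) * (K * zeroJ n powr (-3/2))"
      using G K[of n] by (intro mult_left_mono) (auto simp: l_def)
    finally show "norm \<bar>\<phi> n / relax \<alpha> n T\<bar> \<le> (1 + G) * K * zeroJ n powr (-3/2)"
      using y by (simp add: mult.assoc)
  qed
qed

lemma u_term_eq:
  "u_term \<alpha> T f x t (Suc k) = fb_coeff f (Suc k) / relax \<alpha> k T * relax \<alpha> k t * bfun k x"
  by (simp add: u_term_def ml_relax_def)

lemma g_term_eq: "g_term \<alpha> T f x (Suc k) = fb_coeff f (Suc k) / relax \<alpha> k T * bfun k x"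
  by (simp add: g_term_def ml_relax_def)

lemma inverse_solution_imp_diffusion:
  assumes "inverse_solution \<alpha> T f u g"
  shows "diffusion_solution \<alpha> T u"
  unfolding diffusion_solution_def
proof (intro conjI ballI)
  show "continuous_on ({0..1} \<times> {0..T}) (\<lambda>(x, t). u x t)"
    using assms by (simp add: inverse_solution_def)
  fix t assume t: "t \<in> {0<..<T}"
  then show "u 1 t = 0" using assms by (simp add: inverse_solution_def)
  show "\<exists>p q. \<forall>x\<in>{0<..<1}. ((\<lambda>y. u y t) has_real_derivative p x) (at x) \<and>
      (p has_real_derivative q x) (at x) \<and> has_caputo \<alpha> (\<lambda>s. u x s) t \<and>
      caputo \<alpha> (\<lambda>s. u x s) t = q x + p x / x"
    by (intro exI[of _ "deriv (\<lambda>y. u y t)"] exI[of _ "deriv (deriv (\<lambda>y. u y t))"])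
      (use assms t in \<open>simp add: inverse_solution_def DERIV_deriv_iff_real_differentiable\<close>)
qed

section \<open>Coefficients of an arbitrary solution\<close>

lemma abs_wip_bfun_le:
  assumes f: "cont01 f" and e: "\<And>x. x \<in> {0..1} \<Longrightarrow> \<bar>f x\<bar> \<le> e"
  shows "\<bar>wip f (bfun k)\<bar> \<le> e"
proof -
  have bc: "cont01 (bfun k)" by (intro continuous_intros)
  have "norm (wip f (bfun k)) \<le> integral {0..1} (\<lambda>x::real. e)"
    unfolding wip_def
  proof (rule hk_integral_norm_bound_integral)
    show "(\<lambda>x. x * f x * bfun k x) integrable_on {0..1}" by (rule wip_integrand[OF f bc])
    fix x :: real assume x: "x \<in> {0..1}"
    have "\<bar>x\<bar> * \<bar>f x\<bar> * \<bar>bfun k x\<bar> \<le> 1 * e * 1"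
      using x e[OF x] bfun_le_1[of x k] by (intro mult_mono) auto
    then show "norm (x * f x * bfun k x) \<le> e" by (simp add: abs_mult)
  qed auto
  then show ?thesis by simp
qed

lemma diffusion_slice_continuous:
  assumes u: "diffusion_solution \<alpha> T u" and t: "t \<in> {0..T}"
  shows "cont01 (\<lambda>x. u x t)"
proof -
  have "continuous_on ({0..1} \<times> {0..T}) (\<lambda>z. u (fst z) (snd z))"
    using u by (simp add: diffusion_solution_def case_prod_beta)
  then have "cont01 (\<lambda>x. u (fst (x, t)) (snd (x, t)))"
    by (rule continuous_on_compose2)
      (use t in \<open>auto intro!: continuous_on_Pair continuous_on_const continuous_on_id\<close>)
  then show ?thesis by simp
qed

text \<open>The boundary condition is imposed at positive times and reaches the corner by
  continuity. It makes the initial datum admissible for \<open>bfun_dense\<close>.\<close>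

lemma diffusion_boundary_0:
  assumes T: "0 < T" and u: "diffusion_solution \<alpha> T u"
  shows "u 1 0 = 0"
proof -
  have c: "continuous_on ({0..1} \<times> {0..T}) (\<lambda>z. u (fst z) (snd z))"
    using u by (simp add: diffusion_solution_def case_prod_beta)
  have "continuous_on {0..T} (\<lambda>t. (\<lambda>z. u (fst z) (snd z)) (1, t))"
  proof (rule continuous_on_compose2[where g = "\<lambda>z. u (fst z) (snd z)" and f = "\<lambda>t. (1, t)", OF c])
    show "continuous_on {0..T} (\<lambda>t. (1::real, t))"
      by (intro continuous_on_Pair continuous_on_const continuous_on_id)
  qed auto
  then have "((\<lambda>t. u 1 t) \<longlongrightarrow> u 1 0) (at 0 within {0..T})"
    using T by (auto simp: continuous_on_def)
  then have "((\<lambda>t. u 1 t) \<longlongrightarrow> u 1 0) (at_right 0)"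
    using T by (simp add: at_within_Icc_at_right)
  moreover have "\<forall>\<^sub>F t in at_right 0. u 1 t = 0"
    using eventually_at_right_real[OF T]
    by eventually_elim (use u in \<open>simp add: diffusion_solution_def\<close>)
  ultimately have "((\<lambda>t. 0) \<longlongrightarrow> u 1 0) (at_right (0::real))"
    by (rule Lim_transform_eventually)
  then show ?thesis
    by (intro tendsto_unique[OF trivial_limit_at_right_real _ tendsto_const])
qed

text \<open>
  The coefficients of an arbitrary solution evolve like those of the series solutions, which
  approximate it uniformly by the maximum principle.
\<close>

lemma diffusion_coeffs:
  assumes a: "0 < \<alpha>" "\<alpha> < 1" and T: "0 < T" and u: "diffusion_solution \<alpha> T u" and t: "t \<in> {0..T}"
  shows "wip (\<lambda>x. u x t) (bfun k) = relax \<alpha> k t * wip (\<lambda>x. u x 0) (bfun k)"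
proof -
  let ?y = "relax \<alpha> k t"
  have t0: "0 \<le> t" using t by simp
  have T0: "0 \<in> {0..T}" using T by simp
  have bc: "cont01 (bfun k)" by (intro continuous_intros)
  have y: "0 < ?y" "?y \<le> 1"
    by (rule ml_relax_pos[OF a bessel_zero_sq_pos t0], rule ml_relax_le_1[OF a bessel_zero_sq_pos t0])
  have "\<bar>wip (\<lambda>x. u x t) (bfun k) - ?y * wip (\<lambda>x. u x 0) (bfun k)\<bar> \<le> 0 + e" if e: "0 < e" for e
  proof -
    \<comment> \<open>Half of \<open>e\<close> is for the error at time \<open>t\<close>, half for
      that at time \<open>0\<close>, which is damped by \<open>?y \<le> 1\<close>.\<close>
    obtain c where c: "summable (\<lambda>k. \<bar>c k\<bar>)"
      and ce: "\<And>x. x \<in> {0..1} \<Longrightarrow> \<bar>u x 0 - (\<Sum>k. c k * bfun k x)\<bar> \<le> e / 2"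
      using bfun_dense[OF diffusion_slice_continuous[OF u T0] diffusion_boundary_0[OF T u], of "e / 2"] e by auto
    define v where "v = diffusion_series \<alpha> c"
    have v: "diffusion_solution \<alpha> T v" unfolding v_def by (rule diffusion_series_solution[OF a c])
    have v0: "v x 0 = (\<Sum>k. c k * bfun k x)" for x
      by (simp add: v_def ml_relax_0[OF a bessel_zero_sq_pos])
    have le: "\<bar>u x s - v x s\<bar> \<le> e / 2" if "x \<in> {0..1}" "s \<in> {0..T}" for x s
      by (rule diffusion_stability[OF a T u v _ that]) (use ce in \<open>simp add: v0\<close>)
    have vt: "wip (\<lambda>x. v x s) (bfun k) = c k * relax \<alpha> k s * wip (bfun k) (bfun k)" if "0 \<le> s" for s
      unfolding v_def by (rule wip_bfun_series[OF relax_summable[OF a c that]])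
    have d: "\<bar>wip (\<lambda>x. u x s) (bfun k) - wip (\<lambda>x. v x s) (bfun k)\<bar> \<le> e / 2" if s: "s \<in> {0..T}" for s
    proof -
      have cu: "cont01 (\<lambda>x. u x s)" and cv: "cont01 (\<lambda>x. v x s)"
        by (rule diffusion_slice_continuous[OF u s], rule diffusion_slice_continuous[OF v s])
      have "\<bar>wip (\<lambda>x. u x s - v x s) (bfun k)\<bar> \<le> e / 2"
        by (rule abs_wip_bfun_le) (use le s in \<open>auto intro!: continuous_on_diff cu cv\<close>)
      then show ?thesis unfolding wip_diff_left[OF cu cv bc] .
    qed
    have "wip (\<lambda>x. v x t) (bfun k) = ?y * wip (\<lambda>x. v x 0) (bfun k)"
      using vt[OF t0] vt[of 0] by (simp add: ml_relax_0[OF a bessel_zero_sq_pos])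
    moreover have "\<bar>?y * (wip (\<lambda>x. u x 0) (bfun k) - wip (\<lambda>x. v x 0) (bfun k))\<bar> \<le> 1 * (e / 2)"
      unfolding abs_mult using d[OF T0] y by (intro mult_mono) auto
    ultimately show ?thesis
      using d[OF t] unfolding right_diff_distrib by linarith
  qed
  then have "\<bar>wip (\<lambda>x. u x t) (bfun k) - ?y * wip (\<lambda>x. u x 0) (bfun k)\<bar> \<le> 0"
    by (rule field_le_epsilon)
  then show ?thesis by simp
qed

text \<open>Convergence is asserted separately because \<open>suminf\<close> is total. Uniqueness of
  \<open>u\<close> reaches the closed rectangle by continuity, that of \<open>g\<close> the open
  interval on which \<open>inverse_solution\<close> constrains it.\<close>

theorem theorem3p1:
  fixes \<alpha> T :: real and f f1 f2 f3 f4 :: "real \<Rightarrow> real"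
  assumes "0 < \<alpha>" and "\<alpha> < 1" and "0 < T"
    and "\<And>x. x \<in> {0..1} \<Longrightarrow> (f has_real_derivative f1 x) (at x within {0..1})"
    and "\<And>x. x \<in> {0..1} \<Longrightarrow> (f1 has_real_derivative f2 x) (at x within {0..1})"
    and "\<And>x. x \<in> {0..1} \<Longrightarrow> (f2 has_real_derivative f3 x) (at x within {0..1})"
    and "\<And>x. x \<in> {0..1} \<Longrightarrow> (f3 has_real_derivative f4 x) (at x within {0..1})"
    and "f 0 = 0" and "f1 0 = 0" and "f2 0 = 0" and "f3 0 = 0"
    and "f 1 = 0" and "f1 1 = 0" and "f2 1 = 0"
    and "bounded (f4 ` {0..1})"
  shows "(\<forall>x\<in>{0..1}. \<forall>t\<in>{0..T}. summable (\<lambda>k. u_term \<alpha> T f x t (Suc k))) \<and>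
    (\<forall>x\<in>{0..1}. summable (\<lambda>k. g_term \<alpha> T f x (Suc k))) \<and>
    inverse_solution \<alpha> T f
      (\<lambda>x t. \<Sum>k. u_term \<alpha> T f x t (Suc k)) (\<lambda>x. \<Sum>k. g_term \<alpha> T f x (Suc k)) \<and>
    (\<forall>u g. inverse_solution \<alpha> T f u g \<longrightarrow>
      (\<forall>x\<in>{0..1}. \<forall>t\<in>{0..T}. u x t = (\<Sum>k. u_term \<alpha> T f x t (Suc k))) \<and>
      (\<forall>x\<in>{0<..<1}. g x = (\<Sum>k. g_term \<alpha> T f x (Suc k))))"
proof -
  note a = assms(1,2) and T = assms(3)
  define c where "c = (\<lambda>k. fb_coeff f (Suc k) / relax \<alpha> k T)"
  obtain K where K: "\<And>n. \<bar>fb_coeff f (Suc n)\<bar> * (zeroJ n)\<^sup>2 \<le> K * zeroJ n powr (-3/2)"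
    using fb_coeff_decay[OF assms(4-7,9-15)] by blast
  have c: "summable (\<lambda>k. \<bar>c k\<bar>)"
    unfolding c_def by (rule inverse_coeff_summable[OF a T K])
  have cf: "cont01 f" by (rule DERIV_continuous_on, rule assms(4))
  have y0: "relax \<alpha> k 0 = 1" for k
    by (rule ml_relax_0[OF a bessel_zero_sq_pos])
  have yT: "relax \<alpha> k t > 0" if "0 \<le> t" for k t
    by (rule ml_relax_pos[OF a bessel_zero_sq_pos that])
  have ut: "u_term \<alpha> T f x t (Suc k) = c k * relax \<alpha> k t * bfun k x" for x t k
    by (simp add: u_term_eq c_def)
  \<comment> \<open>As \<open>relax \<alpha> k 0 = 1\<close>, the series for \<open>g\<close> is the
    series for \<open>u\<close> at time \<open>0\<close>.\<close>
  have gt: "g_term \<alpha> T f x (Suc k) = c k * relax \<alpha> k 0 * bfun k x" for x k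
    by (simp add: g_term_eq c_def y0)
  let ?u = "diffusion_series \<alpha> c"
  have us: "summable (\<lambda>k. c k * relax \<alpha> k t * bfun k x)" if "x \<in> {0..1}" "0 \<le> t" for x t
  proof (rule summable_comparison_test[OF _ relax_summable[OF a c that(2)]], intro exI allI impI)
    fix k show "norm (c k * relax \<alpha> k t * bfun k x) \<le> \<bar>c k * relax \<alpha> k t\<bar>"
      using bfun_le_1[of x k] that(1) by (simp add: abs_mult mult_left_le)
  qed
  have sol: "diffusion_solution \<alpha> T ?u" by (rule diffusion_series_solution[OF a c])
  have cT: "c k * relax \<alpha> k T = fb_coeff f (Suc k)" for k
    using yT[of T k] T by (simp add: c_def)
  have fs: "summable (\<lambda>k. \<bar>fb_coeff f (Suc k)\<bar>)"
    using relax_summable[OF a c, of T] T by (simp add: cT)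
  have uT: "?u x T = f x" if "x \<in> {0..1}" for x
    unfolding cT by (rule fourier_bessel_expansion[OF cf fs that])
  have inv: "inverse_solution \<alpha> T f ?u (\<lambda>x. ?u x 0)"
    unfolding inverse_solution_def
  proof (intro conjI ballI)
    show "continuous_on ({0..1} \<times> {0..T}) (\<lambda>(x, t). ?u x t)"
      using sol by (simp add: diffusion_solution_def)
    fix t assume "t \<in> {0<..<T}"
    then have t: "0 < t" by simp
    obtain p q P where pq:
      "\<And>x. 0 < x \<Longrightarrow> x < 1 \<Longrightarrow> ((\<lambda>x. ?u x t) has_real_derivative p x) (at x)"
      "\<And>x. 0 < x \<Longrightarrow> x < 1 \<Longrightarrow> (p has_real_derivative q x) (at x)"
      "\<And>x. 0 < x \<Longrightarrow> x < 1 \<Longrightarrow>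
        q x + p x / x = (\<Sum>k. - (zeroJ k)\<^sup>2 * (c k * relax \<alpha> k t * bfun k x))"
      "\<And>x. 0 < x \<Longrightarrow> x < 1 \<Longrightarrow> \<bar>p x\<bar> \<le> P"
      by (rule diffusion_series_space[OF a c t], rule that)
    have d1: "deriv (\<lambda>x. ?u x t) x = p x" if "0 < x" "x < 1" for x
      by (rule DERIV_imp_deriv[OF pq(1)[OF that]])
    show "?u 1 t = 0" by (rule diffusion_series_boundary[OF a c])
    show "((\<lambda>x. x * deriv (\<lambda>y. ?u y t) x) \<longlongrightarrow> 0) (at_right 0)"
    proof (rule Lim_null_comparison)
      show "\<forall>\<^sub>F x in at_right 0. norm (x * deriv (\<lambda>y. ?u y t) x) \<le> x * P"
        using eventually_at_right_real[OF zero_less_one]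
      proof eventually_elim
        fix x :: real assume "x \<in> {0<..<1}"
        then have x: "0 < x" "x < 1" by auto
        show "norm (x * deriv (\<lambda>y. ?u y t) x) \<le> x * P"
          unfolding d1[OF x] using pq(4)[OF x] x by (simp add: abs_mult mult_left_mono)
      qed
      have "((\<lambda>x. x * P) \<longlongrightarrow> 0 * P) (at_right 0)" by (intro tendsto_intros)
      then show "((\<lambda>x. x * P) \<longlongrightarrow> 0) (at_right 0)" by simp
    qed
    fix x :: real assume "x \<in> {0<..<1}"
    then have x: "0 < x" "x < 1" and x0: "0 \<le> x" by auto
    have d2: "(deriv (\<lambda>x. ?u x t) has_real_derivative q x) (at x)"
      by (rule has_field_derivative_transform_within_open[OF pq(2)[OF x], of "{0<..<1}"])
        (use x d1 in auto)
    show "has_caputo \<alpha> (\<lambda>s. ?u x s) t" by (rule diffusion_series_caputo(1)[OF a c x0 t])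
    show "(\<lambda>y. ?u y t) differentiable (at x)"
      using pq(1)[OF x] real_differentiable_def by blast
    show "deriv (\<lambda>y. ?u y t) differentiable (at x)"
      using d2 real_differentiable_def by blast
    show "caputo \<alpha> (\<lambda>s. ?u x s) t = deriv (deriv (\<lambda>y. ?u y t)) x + 1 / x * deriv (\<lambda>y. ?u y t) x"
      unfolding diffusion_series_caputo(2)[OF a c x0 t] DERIV_imp_deriv[OF d2] d1[OF x]
      using pq(3)[OF x] by simp
  next
    fix x :: real assume "x \<in> {0<..<1}"
    then show "?u x T = f x" by (intro uT) auto
  qed simp
  have uniq: "v x t = ?u x t" if v: "inverse_solution \<alpha> T f v g" and xt: "x \<in> {0..1}" "t \<in> {0..T}" for v g x t
  proof -
    have dv: "diffusion_solution \<alpha> T v" by (rule inverse_solution_imp_diffusion[OF v])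
    have TT: "T \<in> {0..T}" using T by simp
    have vT: "wip (\<lambda>x. v x T) (bfun k) = wip f (bfun k)" for k
    proof -
      \<comment> \<open>The final condition is given on the open interval, which suffices for the
        integral.\<close>
      have "integral {0<..<1} (\<lambda>x. x * v x T * bfun k x) = integral {0<..<1} (\<lambda>x. x * f x * bfun k x)"
        using v by (intro hk_integral_cong) (simp add: inverse_solution_def)
      then show ?thesis by (simp add: wip_def integral_open_interval_real)
    qed
    \<comment> \<open>The coefficient law is run backwards from \<open>T\<close>, dividing by
      \<open>relax \<alpha> k T > 0\<close>.\<close>
    have v0: "wip (\<lambda>x. v x 0) (bfun k) = c k * wip (bfun k) (bfun k)" for k
      using diffusion_coeffs[OF a T dv TT, of k] vT[of k] yT[of T k] T wip_bfun_pos[of k]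
      by (simp add: c_def fb_coeff_eq field_simps)
    show ?thesis
    proof (rule bfun_coeffs_unique[where f = "\<lambda>x. v x t" and g = "\<lambda>x. ?u x t"])
      show "cont01 (\<lambda>x. v x t)" by (rule diffusion_slice_continuous[OF dv xt(2)])
      show "cont01 (\<lambda>x. ?u x t)" by (rule diffusion_slice_continuous[OF sol xt(2)])
      fix k
      have "wip (\<lambda>x. ?u x t) (bfun k) = c k * relax \<alpha> k t * wip (bfun k) (bfun k)"
        by (rule wip_bfun_series[OF relax_summable[OF a c]]) (use xt in simp)
      then show "wip (\<lambda>x. v x t) (bfun k) = wip (\<lambda>x. ?u x t) (bfun k)"
        unfolding diffusion_coeffs[OF a T dv xt(2)] v0 by simp
    qed (rule xt)
  qed
  show ?thesis
    unfolding ut gt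
  proof (intro conjI ballI allI impI)
    fix v :: "real \<Rightarrow> real \<Rightarrow> real" and g :: "real \<Rightarrow> real" and x :: real
    assume v: "inverse_solution \<alpha> T f v g" and "x \<in> {0<..<1}"
    then show "g x = ?u x 0"
      using uniq[OF v, of x 0] v T by (simp add: inverse_solution_def)
  qed (use us inv uniq in auto)
qed

end
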